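(* Let $\mathcal{T}$ be a fixed point of a primitive tile-substitution in $\mathbb{R}^d$. Then the associated topological dynamical system $(X_\mathcal{T},\mathbb{R}^d)$ is uniquely ergodic. (No finite local complexity assumption is made.)
   Context: Prototiles $T_i=(A_i,i)$, $1\le i\le\kappa$: $A_i=\mathrm{supp}(T_i)\subset\mathbb{R}^d$ is nonempty, compact, and the closure of its interior; $i$ is the type. A tile of type $i$ is a translate $g+T_i=(g+A_i,i)$. A tiling is a set of tiles whose supports cover $\mathbb{R}^d$ and such that distinct tiles have supports with disjoint interiors. A patch is a finite set of tiles with mutually disjoint interiors. A linear map $Q$ on $\mathbb{R}^d$ is expansive if all its (real and complex) eigenvalues have modulus $>1$. A tile-substitution $\omega$ on $\mathcal{A}=\{T_1,\dots,T_\kappa\}$ with expansive map $Q$ is given by finite sets $\mathcal{D}_{ij}\subset\mathbb{R}^d$ with $\omega(T_j)=\{u+T_i:u\in\mathcal{D}_{ij},1\le i\le\kappa\}$ and $QA_j=\bigcup_{i=1}^\kappa(\mathcal{D}_{ij}+A_i)$, where all the sets $u+A_i$ ($u\in\mathcal D_{ij}$, $i\le\kappa$) have disjoint interiors. It is extended by $\omega(T_j+x)=\omega(T_j)+Qx$ and $\omega(S)=\bigcup_{T\in S}\omega(T)$ for patches and tilings $S$ made of translates of the prototiles. The substitution matrix is $\mathsf{S}=(\#\mathcal{D}_{ij})_{i,j}$; $\omega$ is primitive if some power $\mathsf{S}^\ell$, $\ell>0$, has no zero entries. A fixed point of $\omega$ is a tiling $\mathcal{T}$ by translates of the prototiles with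 $\omega(\mathcal{T})=\mathcal{T}$. For a tiling $\mathcal{S}$ by translates of the prototiles let $\Lambda(\mathcal{S})=\{(x,i):x+T_i\in\mathcal{S}\}\subset\mathbb{R}^d\times\{1,\dots,\kappa\}$. For such coloured sets, intersection with $B_r(0)$ and addition of $B_\epsilon(0)$ are applied to the $\mathbb{R}^d$-coordinate, keeping colours. Metric: $d(\mathcal{S}_1,\mathcal{S}_2)=\min\{2^{-1/2},\inf\{\epsilon>0:B_{1/\epsilon}(0)\cap\Lambda(\mathcal{S}_2)\subset\Lambda(\mathcal{S}_1)+B_\epsilon(0),\ B_{1/\epsilon}(0)\cap\Lambda(\mathcal{S}_1)\subset\Lambda(\mathcal{S}_2)+B_\epsilon(0)\}\}$. $X_\mathcal{T}$ is the closure of $\{\mathcal{T}-g:g\in\mathbb{R}^d\}$ in the space of all tilings by translates of the prototiles; it is compact, and $\mathbb{R}^d$ acts on it by $\mathcal{S}\mapsto\mathcal{S}-g$. *)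

theory Defs
  imports "HOL-Probability.Probability"
begin

section \<open>Tiles and tilings\<close>

text \<open>The space is \<open>real ^ 'n\<close>. The finitely many tile types are the elements of the finite
  type \<open>'k\<close>, and \<open>A i\<close> is the support of the prototile of type \<open>i\<close>.
  A tile is a pair consisting of its support and its type.\<close>

type_synonym ('n, 'k) tile = "(real ^ 'n) set \<times> 'k"

definition prototile_supports :: "('k \<Rightarrow> (real ^ 'n) set) \<Rightarrow> bool" where
  "prototile_supports A \<longleftrightarrow>
     (\<forall>i. A i \<noteq> {} \<and> compact (A i) \<and> closure (interior (A i)) = A i)"

definition prototile :: "('k \<Rightarrow> (real ^ 'n) set) \<Rightarrow> 'k \<Rightarrow> ('n, 'k) tile" where
  "prototile A i = (A i, i)"

definition translate_tile :: "real ^ 'n \<Rightarrow> ('n, 'k) tile \<Rightarrow> ('n, 'k) tile" where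
  "translate_tile g t = ((+) g ` fst t, snd t)"

definition tiling :: "('n::finite, 'k) tile set \<Rightarrow> bool" where
  "tiling S \<longleftrightarrow>
     (\<Union>t\<in>S. fst t) = UNIV \<and>
     pairwise (\<lambda>s t. interior (fst s) \<inter> interior (fst t) = {}) S"

definition tilings_by :: "('k \<Rightarrow> (real ^ 'n) set) \<Rightarrow> ('n, 'k) tile set set" where
  "tilings_by A = {S. tiling S \<and> S \<subseteq> {translate_tile x (prototile A i) | x i. True}}"

text \<open>Since prototile supports are nonempty and compact, a translate of a prototile determines
  the translation vector, so a set of translated prototiles can be recovered from its coloured
  set of translation vectors.\<close>

definition coloured_set ::
    "('k \<Rightarrow> (real ^ 'n) set) \<Rightarrow> ('n, 'k) tile set \<Rightarrow> ((real ^ 'n) \<times> 'k) set" where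
  "coloured_set A S = {(x, i). translate_tile x (prototile A i) \<in> S}"


section \<open>Tile-substitutions\<close>

text \<open>Eigenvalues are those of the complexification, so that real and non-real ones are both
  covered.\<close>

definition expansive :: "(real ^ 'n \<Rightarrow> real ^ 'n) \<Rightarrow> bool" where
  "expansive Q \<longleftrightarrow> linear Q \<and>
     (\<forall>(c :: complex) (v :: complex ^ 'n).
        v \<noteq> 0 \<and> map_matrix complex_of_real (matrix Q) *v v = c *s v \<longrightarrow> cmod c > 1)"

definition tile_substitution ::
    "('k \<Rightarrow> (real ^ 'n) set) \<Rightarrow> (real ^ 'n \<Rightarrow> real ^ 'n) \<Rightarrow> ('k \<Rightarrow> 'k \<Rightarrow> (real ^ 'n) set) \<Rightarrow> bool" where
  "tile_substitution A Q D \<longleftrightarrow>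
     prototile_supports A \<and> expansive Q \<and>
     (\<forall>i j. finite (D i j)) \<and>
     (\<forall>j. Q ` A j = (\<Union>i. \<Union>u\<in>D i j. (+) u ` A i)) \<and>
     (\<forall>j. pairwise (\<lambda>(u, i) (v, k). interior ((+) u ` A i) \<inter> interior ((+) v ` A k) = {})
                   {(u, i). u \<in> D i j})"

definition subst_prototile ::
    "('k \<Rightarrow> (real ^ 'n) set) \<Rightarrow> ('k \<Rightarrow> 'k \<Rightarrow> (real ^ 'n) set) \<Rightarrow> 'k \<Rightarrow> ('n, 'k) tile set" where
  "subst_prototile A D j = {translate_tile u (prototile A i) | u i. u \<in> D i j}"

definition subst_tiles ::
    "('k \<Rightarrow> (real ^ 'n) set) \<Rightarrow> (real ^ 'n \<Rightarrow> real ^ 'n) \<Rightarrow> ('k \<Rightarrow> 'k \<Rightarrow> (real ^ 'n) set) \<Rightarrow>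
     ('n, 'k) tile set \<Rightarrow> ('n, 'k) tile set" where
  "subst_tiles A Q D S =
     (\<Union>(x, j)\<in>coloured_set A S. translate_tile (Q x) ` subst_prototile A D j)"

definition subst_matrix :: "('k::finite \<Rightarrow> 'k \<Rightarrow> (real ^ 'n) set) \<Rightarrow> nat ^ 'k ^ 'k" where
  "subst_matrix D = (\<chi> i j. card (D i j))"

text \<open>The power is the matrix power: \<open>(^)\<close> on \<open>nat ^ 'k ^ 'k\<close> would be
  taken entrywise.\<close>

definition primitive_substitution :: "('k::finite \<Rightarrow> 'k \<Rightarrow> (real ^ 'n) set) \<Rightarrow> bool" where
  "primitive_substitution D \<longleftrightarrow>
     (\<exists>l>0. \<forall>i j. (((**) (subst_matrix D) ^^ l) (mat 1)) $ i $ j \<noteq> 0)"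

definition subst_fixed_point ::
    "('k \<Rightarrow> (real ^ 'n) set) \<Rightarrow> (real ^ 'n \<Rightarrow> real ^ 'n) \<Rightarrow> ('k \<Rightarrow> 'k \<Rightarrow> (real ^ 'n) set) \<Rightarrow>
     ('n, 'k) tile set \<Rightarrow> bool" where
  "subst_fixed_point A Q D \<T> \<longleftrightarrow> \<T> \<in> tilings_by A \<and> subst_tiles A Q D \<T> = \<T>"


section \<open>The tiling space\<close>

definition coloured_restrict :: "real \<Rightarrow> ((real ^ 'n) \<times> 'k) set \<Rightarrow> ((real ^ 'n) \<times> 'k) set" where
  "coloured_restrict r L = {(x, i) \<in> L. x \<in> ball 0 r}"

definition coloured_thicken :: "real \<Rightarrow> ((real ^ 'n) \<times> 'k) set \<Rightarrow> ((real ^ 'n) \<times> 'k) set" where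
  "coloured_thicken e L = {(x + y, i) | x y i. (x, i) \<in> L \<and> y \<in> ball 0 e}"

text \<open>The minimum of \<open>2 powr (-1/2)\<close> and the infimum of a set of positive reals is written
  as a single infimum; this gives the value \<open>2 powr (-1/2)\<close> when that set is empty, where
  \<open>Inf\<close> on \<open>real\<close> would be unspecified.\<close>

definition tiling_dist ::
    "('k \<Rightarrow> (real ^ 'n) set) \<Rightarrow> ('n, 'k) tile set \<Rightarrow> ('n, 'k) tile set \<Rightarrow> real" where
  "tiling_dist A S1 S2 =
     Inf (insert (2 powr (-1/2))
       {e. e > 0 \<and>
           coloured_restrict (1/e) (coloured_set A S2) \<subseteq> coloured_thicken e (coloured_set A S1) \<and>
           coloured_restrict (1/e) (coloured_set A S1) \<subseteq> coloured_thicken e (coloured_set A S2)})"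

definition tilings_topology :: "('k \<Rightarrow> (real ^ 'n) set) \<Rightarrow> ('n, 'k) tile set topology" where
  "tilings_topology A = Metric_space.mtopology (tilings_by A) (tiling_dist A)"

text \<open>\<open>tiling_shift g S\<close> is \<open>S - g\<close>.\<close>

definition tiling_shift :: "real ^ 'n \<Rightarrow> ('n, 'k) tile set \<Rightarrow> ('n, 'k) tile set" where
  "tiling_shift g S = translate_tile (- g) ` S"

definition tiling_hull ::
    "('k \<Rightarrow> (real ^ 'n) set) \<Rightarrow> ('n, 'k) tile set \<Rightarrow> ('n, 'k) tile set topology" where
  "tiling_hull A \<T> =
     subtopology (tilings_topology A)
       (tilings_topology A closure_of (range (\<lambda>g. tiling_shift g \<T>)))"


section \<open>Unique ergodicity\<close>

definition borel_of_topology :: "'x topology \<Rightarrow> 'x measure" where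
  "borel_of_topology X = sigma (topspace X) {U. openin X U}"

definition invariant_probability :: "'x topology \<Rightarrow> ('g \<Rightarrow> 'x \<Rightarrow> 'x) \<Rightarrow> 'x measure \<Rightarrow> bool" where
  "invariant_probability X act \<mu> \<longleftrightarrow>
     prob_space \<mu> \<and> sets \<mu> = sets (borel_of_topology X) \<and>
     (\<forall>g. act g \<in> measurable \<mu> \<mu> \<and> distr \<mu> \<mu> (act g) = \<mu>)"

definition uniquely_ergodic :: "'x topology \<Rightarrow> ('g \<Rightarrow> 'x \<Rightarrow> 'x) \<Rightarrow> bool" where
  "uniquely_ergodic X act \<longleftrightarrow> (\<exists>!\<mu>. invariant_probability X act \<mu>)"

end

theory Submission
  imports Defs "HOL-Computational_Algebra.Fundamental_Theorem_Algebra"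
begin

text \<open>Write \<open>\<phi> h = f (\<T> - h)\<close> for \<open>f\<close> continuous on the compact orbit closure.
  Two supertiles of the same level and type carry translates of the same patch, so the averages of
  \<open>\<phi>\<close> over them agree up to the effect of points near the boundary. Prototile boundaries
  are null sets and \<open>Q\<close> is expansive, so this effect vanishes as the level grows. A supertile of
  level \<open>m + l\<close> is a union of supertiles of level \<open>m\<close>, and by primitivity every type
  occurs with a weight bounded below; hence the oscillation of the averages over all supertiles
  contracts to 0. Large sets are almost tiled by supertiles, so the averages of \<open>\<phi>\<close> over
  the translates of a large set are nearly constant, and Riemann sums turn them into finite convex
  combinations of translates of \<open>\<phi>\<close>.

  If every continuous \<open>f\<close> has finite convex combinations of translates that are nearly constant,
  the constants define an invariant mean, since averaging operators commute. Any invariant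
  probability integrates \<open>f\<close> to this mean, which gives uniqueness, and the mean is represented by
  a measure, which gives existence. Working with finite combinations avoids Fubini on the
  tiling space.\<close>

text \<open>Without finite local complexity a window may show infinitely many patches up to
  translation, so continuous functions are averaged and no patches are counted. Compactness of the
  tiling space survives: at positive resolution a window shows finitely many patterns, and the
  separation \<open>sep\<close> of equal tiles makes Cauchy sequences converge tile by tile. As \<T>
  is its own image under every power of the substitution, supertiles of all levels are indexed by
  the coloured set of \<T> itself; the final estimate is a closed condition, so it passes from the
  orbit of \<T> to its closure. The weights of the contraction are relative volumes. Prototile
  volumes form a positive left eigenvector of the substitution matrix with eigenvalue
  \<open>q\<close>, so the weights inside a supertile sum to 1 and do not depend on its level. If
  \<open>d\<close> is the least of them, two supertiles of level m + l share a type among their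
  children with joint weight at least d * d, and the oscillation, measured above the error between
  supertiles of equal type, shrinks by the factor 1 - d * d.\<close>

section \<open>Distance functions, the source of continuous functions on a metric space\<close>

context Metric_space
begin

text \<open>The value 1 for the empty set replaces an unspecified infimum and keeps the function
  continuous and positive off every closed \<open>C\<close>. The case is real: it occurs for C = M -
  U with U = M.\<close>

definition setdistance :: "'a set \<Rightarrow> 'a \<Rightarrow> real" where
  "setdistance C x = (if C = {} then 1 else (INF y\<in>C. d x y))"

lemma setdistance_nonneg: "x \<in> M \<Longrightarrow> C \<subseteq> M \<Longrightarrow> 0 \<le> setdistance C x"
  by (auto simp: setdistance_def intro!: cINF_greatest)

lemma setdistance_eq_0:
  assumes "x \<in> C" "C \<subseteq> M" shows "setdistance C x = 0"
proof -
  have "(INF y\<in>C. d x y) \<le> d x x"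
    by (rule cINF_lower[OF _ \<open>x \<in> C\<close>]) (auto intro!: bdd_belowI2[where m=0])
  moreover have "x \<in> M" using assms by auto
  ultimately show ?thesis using assms setdistance_nonneg[of x C]
    by (auto simp: setdistance_def split: if_splits)
qed

lemma setdistance_Lipschitz:
  assumes "x \<in> M" "y \<in> M" "C \<subseteq> M" shows "\<bar>setdistance C x - setdistance C y\<bar> \<le> d x y"
proof (cases "C = {}")
  case False
  have *: "(INF z\<in>C. d x z) \<le> d x y + (INF z\<in>C. d y z)" if xy: "x \<in> M" "y \<in> M" for x y
  proof -
    have "(INF z\<in>C. d x z) - d x y \<le> (INF z\<in>C. d y z)"
    proof (rule cINF_greatest[OF False])
      fix z assume z: "z \<in> C"
      have "(INF z\<in>C. d x z) \<le> d x z"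
        by (rule cINF_lower[OF _ z]) (auto intro!: bdd_belowI2[where m=0])
      also have "\<dots> \<le> d x y + d y z" using triangle[of x y z] xy z assms by auto
      finally show "(INF z\<in>C. d x z) - d x y \<le> d y z" by simp
    qed
    then show ?thesis by simp
  qed
  show ?thesis using *[of x y] *[of y x] assms False by (simp add: setdistance_def commute abs_le_iff)
qed (simp add: setdistance_def)

lemma setdistance_pos:
  assumes C: "closedin mtopology C" and x: "x \<in> M" "x \<notin> C" shows "0 < setdistance C x"
proof (cases "C = {}")
  case False
  have "openin mtopology (M - C)" using C by (simp add: closedin_def)
  then obtain r where r: "r > 0" "mball x r \<subseteq> M - C" using x by (force simp: openin_mtopology)
  have CM: "C \<subseteq> M" using closedin_subset[OF C] by simp
  have "r \<le> (INF y\<in>C. d x y)"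
  proof (rule cINF_greatest[OF False])
    fix y assume "y \<in> C"
    then show "r \<le> d x y" using r x CM by (force simp: in_mball)
  qed
  then show ?thesis using r False by (simp add: setdistance_def)
qed (simp add: setdistance_def)

lemma continuous_map_realI:
  assumes "\<And>x e. x \<in> M \<Longrightarrow> e > 0 \<Longrightarrow> \<exists>r>0. \<forall>y\<in>M. d x y < r \<longrightarrow> \<bar>f x - f y\<bar> < e"
  shows "continuous_map mtopology euclideanreal f"
proof -
  have "continuous_map mtopology Met_TC.mtopology f"
    unfolding Met_TC.continuous_map_to_metric
  proof (intro ballI allI impI)
    fix x and e :: real assume "x \<in> topspace mtopology" "e > 0"
    with assms[of x e] obtain r where r: "r > 0" "\<forall>y\<in>M. d x y < r \<longrightarrow> \<bar>f x - f y\<bar> < e" and x: "x \<in> M" by auto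
    show "\<exists>U. openin mtopology U \<and> x \<in> U \<and> (\<forall>y\<in>U. f y \<in> Met_TC.mball (f x) e)"
      using r x by (intro exI[of _ "mball x r"]) (auto simp: dist_real_def)
  qed
  then show ?thesis by simp
qed

lemma continuous_map_setdistance:
  assumes "C \<subseteq> M" shows "continuous_map mtopology euclideanreal (setdistance C)"
  by (rule continuous_map_realI) (meson assms order_le_less_trans setdistance_Lipschitz)

end

section \<open>Representing a positive functional by a measure\<close>

text \<open>A positive functional in the sense of Riesz representation. Since \<open>mono\<close>
  compares values on \<open>M\<close> only, \<open>\<Lambda> f\<close> is determined by the
  restriction of a continuous \<open>f\<close> to \<open>M\<close>.\<close>

locale normalised_functional = Metric_space M d for M :: "'a set" and d +
  fixes \<Lambda> :: "('a \<Rightarrow> real) \<Rightarrow> real"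
  assumes compact: "compact_space mtopology"
    and add: "continuous_map mtopology euclideanreal f \<Longrightarrow> continuous_map mtopology euclideanreal g \<Longrightarrow>
       \<Lambda> (\<lambda>x. f x + g x) = \<Lambda> f + \<Lambda> g"
    and mono: "continuous_map mtopology euclideanreal f \<Longrightarrow> continuous_map mtopology euclideanreal g \<Longrightarrow>
       (\<And>x. x \<in> M \<Longrightarrow> f x \<le> g x) \<Longrightarrow> \<Lambda> f \<le> \<Lambda> g"
    and const: "\<Lambda> (\<lambda>_. c) = c"
begin

abbreviation cont where "cont \<equiv> continuous_map mtopology euclideanreal"

text \<open>Functions here merely vanish off \<open>U\<close>, whereas the usual Riesz construction
  asks for support inside \<open>U\<close>. The gap is closed by truncation in
  \<open>cut_below\<close>.\<close>

definition below :: "'a set \<Rightarrow> ('a \<Rightarrow> real) set" where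
  "below U = {f. cont f \<and> (\<forall>x\<in>M. 0 \<le> f x \<and> f x \<le> 1) \<and> (\<forall>x\<in>M - U. f x = 0)}"

definition inner_content :: "'a set \<Rightarrow> ennreal" where
  "inner_content U = (SUP f\<in>below U. ennreal (\<Lambda> f))"

definition outer :: "'a set \<Rightarrow> ennreal" where
  "outer E = (INF U\<in>{U. openin mtopology U \<and> E \<subseteq> U}. inner_content U)"

lemma below_zero: "(\<lambda>_. 0) \<in> below U"
  by (auto simp: below_def)

lemma below_mono: "U \<subseteq> V \<Longrightarrow> below U \<subseteq> below V"
  by (auto simp: below_def)

lemma nonneg: "cont f \<Longrightarrow> (\<And>x. x \<in> M \<Longrightarrow> 0 \<le> f x) \<Longrightarrow> 0 \<le> \<Lambda> f"
  using mono[of "\<lambda>_. 0" f] const[of 0] by simp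

lemma below_nonneg: "f \<in> below U \<Longrightarrow> 0 \<le> \<Lambda> f"
  by (rule nonneg) (auto simp: below_def)

lemma sum_eq: "finite I \<Longrightarrow> (\<And>i. i \<in> I \<Longrightarrow> cont (f i)) \<Longrightarrow> \<Lambda> (\<lambda>x. \<Sum>i\<in>I. f i x) = (\<Sum>i\<in>I. \<Lambda> (f i))"
proof (induction I rule: finite_induct)
  case empty then show ?case using const[of 0] by simp
next
  case (insert i I)
  then show ?case using add[of "f i" "\<lambda>x. \<Sum>i\<in>I. f i x"] by (simp add: continuous_map_sum)
qed

lemma inner_content_mono: "U \<subseteq> V \<Longrightarrow> inner_content U \<le> inner_content V"
  unfolding inner_content_def by (intro SUP_subset_mono below_mono order_refl)

lemma outer_open: "openin mtopology U \<Longrightarrow> outer U = inner_content U"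
  unfolding outer_def
  by (intro antisym INF_lower INF_greatest) (auto intro: inner_content_mono)

lemma outer_mono: "E \<subseteq> F \<Longrightarrow> outer E \<le> outer F"
  unfolding outer_def by (intro INF_superset_mono) auto

lemma inner_content_empty: "inner_content {} = 0"
proof -
  have "\<Lambda> f \<le> 0" if "f \<in> below {}" for f
    using mono[of f "\<lambda>_. 0"] const[of 0] that by (auto simp: below_def)
  then show ?thesis unfolding inner_content_def
    by (intro antisym SUP_least) (auto simp: ennreal_eq_0_iff ennreal_neg)
qed

lemma inner_content_M: "inner_content M = 1"
proof (rule antisym)
  have "\<Lambda> f \<le> 1" if "f \<in> below M" for f
    using mono[of f "\<lambda>_. 1"] const[of 1] that by (auto simp: below_def)
  then show "inner_content M \<le> 1" unfolding inner_content_def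
    by (intro SUP_least) (auto simp: ennreal_le_1)
  have "ennreal (\<Lambda> (\<lambda>_. 1)) \<le> inner_content M"
    unfolding inner_content_def by (intro SUP_upper) (auto simp: below_def)
  then show "1 \<le> inner_content M" using const[of 1] by simp
qed

text \<open>Truncation at height e > 0 costs at most \<open>e\<close> in the functional and confines
  the function to the set {f \<ge> e}, which is closed, hence compact, and lies in \<open>U\<close>.
  Both the covering and the splitting argument rest on this.\<close>

lemma cut_below:
  assumes f: "f \<in> below U" and e: "0 \<le> e"
  shows "(\<lambda>x. max 0 (f x - e)) \<in> below U" "\<Lambda> f \<le> e + \<Lambda> (\<lambda>x. max 0 (f x - e))"
proof -
  have cf: "cont f" using f by (auto simp: below_def)
  have c: "cont (\<lambda>x. max 0 (f x - e))"
    by (intro continuous_map_real_max continuous_map_diff cf) auto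
  show "(\<lambda>x. max 0 (f x - e)) \<in> below U" using f e c by (force simp: below_def max_def)
  have "\<Lambda> f \<le> \<Lambda> (\<lambda>x. e + max 0 (f x - e))"
    by (intro mono cf continuous_map_add c) auto
  also have "\<dots> = e + \<Lambda> (\<lambda>x. max 0 (f x - e))"
    using add[of "\<lambda>_. e" "\<lambda>x. max 0 (f x - e)"] c const[of e] by simp
  finally show "\<Lambda> f \<le> e + \<Lambda> (\<lambda>x. max 0 (f x - e))" .
qed

text \<open>Compactness of {f \<ge> e} leaves finitely many of the \<open>U i\<close>. A partition
  of unity made of distances to their complements then splits the truncated function into pieces
  below the single \<open>U i\<close>.\<close>

lemma inner_content_UN:
  fixes U :: "nat \<Rightarrow> 'a set"
  assumes U: "\<And>n. openin mtopology (U n)"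
  shows "inner_content (\<Union>n. U n) \<le> (\<Sum>n. inner_content (U n))"
  unfolding inner_content_def[of "\<Union>n. U n"]
proof (rule SUP_least)
  fix f assume f: "f \<in> below (\<Union>n. U n)"
  have cf: "cont f" using f by (auto simp: below_def)
  show "ennreal (\<Lambda> f) \<le> (\<Sum>n. inner_content (U n))"
  proof (rule ennreal_le_epsilon)
    fix e :: real assume e: "0 < e"
    define K where "K = {x \<in> M. f x \<in> {e..}}"
    have "closedin mtopology K" unfolding K_def
      using closedin_continuous_map_preimage[OF cf, of "{e..}"] by simp
    then have K: "compactin mtopology K" using compact closedin_compact_space by blast
    have "K \<subseteq> \<Union>(range U)" using f e by (force simp: K_def below_def)
    with K obtain \<F> where \<F>: "finite \<F>" "\<F> \<subseteq> range U" "K \<subseteq> \<Union>\<F>"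
      unfolding compactin_def using U by (metis (no_types, lifting) rangeE)
    then obtain I where I: "finite I" "\<F> = U ` I" by (meson finite_subset_image)
    define h where "h i = setdistance (M - U i)" for i
    \<comment> \<open>The second summand keeps the denominator positive where every
      \<open>h i\<close> vanishes. It is 0 where f \<ge> e, so the quotients below add up to exactly
      \<open>g\<close>.\<close>
    define s where "s x = (\<Sum>i\<in>I. h i x) + max 0 (e - f x)" for x
    define g where "g x = max 0 (f x - e)" for x
    have ch: "cont (h i)" for i unfolding h_def by (rule continuous_map_setdistance) auto
    have h0: "0 \<le> h i x" if "x \<in> M" for i x unfolding h_def using that by (intro setdistance_nonneg) auto
    have hp: "0 < h i x" if "x \<in> U i" for i x unfolding h_def
      using that openin_subset[OF U[of i]] U[of i] by (intro setdistance_pos) (auto simp: closedin_def)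
    have hz: "h i x = 0" if "x \<in> M - U i" for i x
      unfolding h_def using that by (intro setdistance_eq_0) auto
    have sp: "0 < s x" if x: "x \<in> M" for x
    proof (cases "f x < e")
      case True then show ?thesis using h0 x by (auto simp: s_def intro!: add_nonneg_pos sum_nonneg)
    next
      case False
      then have "x \<in> K" using x by (auto simp: K_def)
      then obtain i where "i \<in> I" "x \<in> U i" using \<F> I by auto
      then have "0 < (\<Sum>i\<in>I. h i x)" using I h0 x hp by (intro sum_pos2[of _ i]) auto
      then show ?thesis by (simp add: s_def add_pos_nonneg)
    qed
    have cs: "cont s" unfolding s_def
      by (intro continuous_map_add continuous_map_sum continuous_map_real_max continuous_map_diff cf ch I) auto
    have cg: "cont g" unfolding g_def by (intro continuous_map_real_max continuous_map_diff cf) auto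
    define k where "k i x = g x * h i x / s x" for i x
    have ck: "cont (k i)" for i unfolding k_def
      using sp by (intro continuous_map_real_divide continuous_map_real_mult cg ch cs) force
    have sumk: "(\<Sum>i\<in>I. k i x) = g x" if x: "x \<in> M" for x
    proof (cases "f x > e")
      case True
      then have "s x = (\<Sum>i\<in>I. h i x)" by (simp add: s_def)
      then show ?thesis using sp[OF x] by (simp add: k_def flip: sum_distrib_left sum_divide_distrib)
    qed (simp add: k_def g_def)
    have k0: "0 \<le> k i x" if "x \<in> M" for i x
      using h0 sp that by (simp add: k_def g_def less_imp_le)
    have kb: "k i \<in> below (U i)" if i: "i \<in> I" for i
    proof -
      have "k i x \<le> 1" if x: "x \<in> M" for x
      proof -
        have "k i x \<le> (\<Sum>i\<in>I. k i x)" using k0 x i I by (intro member_le_sum) auto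
        also have "\<dots> \<le> 1" using sumk[OF x] f x e by (force simp: g_def below_def)
        finally show ?thesis .
      qed
      then show ?thesis using ck k0 hz by (auto simp: below_def k_def)
    qed
    have "\<Lambda> f \<le> e + \<Lambda> g" using cut_below(2)[OF f, of e] e by (simp add: g_def[abs_def])
    also have "\<Lambda> g \<le> \<Lambda> (\<lambda>x. \<Sum>i\<in>I. k i x)"
      by (intro mono cg continuous_map_sum ck I) (auto simp: sumk)
    also have "\<dots> = (\<Sum>i\<in>I. \<Lambda> (k i))" by (intro sum_eq I ck)
    finally have "ennreal (\<Lambda> f) \<le> ennreal (e + (\<Sum>i\<in>I. \<Lambda> (k i)))" by (intro ennreal_leI) simp
    also have "\<dots> = (\<Sum>i\<in>I. ennreal (\<Lambda> (k i))) + ennreal e"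
    proof -
      have "0 \<le> \<Lambda> (k i)" if "i \<in> I" for i using kb[OF that] by (rule below_nonneg)
      then show ?thesis using e by (simp add: sum_nonneg add.commute)
    qed
    also have "(\<Sum>i\<in>I. ennreal (\<Lambda> (k i))) \<le> (\<Sum>i\<in>I. inner_content (U i))"
      unfolding inner_content_def using kb by (intro sum_mono SUP_upper) auto
    also have "\<dots> \<le> (\<Sum>n. inner_content (U n))"
      using I by (intro sum_le_suminf) auto
    finally show "ennreal (\<Lambda> f) \<le> (\<Sum>n. inner_content (U n)) + ennreal e" by simp
  qed
qed

lemma outer_subadditive:
  fixes E :: "nat \<Rightarrow> 'a set"
  assumes "\<And>n. E n \<subseteq> M"
  shows "outer (\<Union>n. E n) \<le> (\<Sum>n. outer (E n))"
proof (rule ennreal_le_epsilon)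
  fix e :: real assume e: "0 < e" and fin: "(\<Sum>n. outer (E n)) < top"
  have "\<exists>U. openin mtopology U \<and> E n \<subseteq> U \<and> inner_content U \<le> outer (E n) + ennreal (e * (1/2)^Suc n)" for n
  proof -
    have "outer (E n) < top"
      using fin ennreal_suminf_lessD by blast
    then have "outer (E n) < outer (E n) + ennreal (e * (1/2)^Suc n)"
      using e by (cases "outer (E n)" rule: ennreal_cases) (auto simp: ennreal_less_iff simp flip: ennreal_plus)
    then show ?thesis unfolding outer_def[of "E n"] INF_less_iff by (auto intro: less_imp_le)
  qed
  then obtain U where U: "\<And>n. openin mtopology (U n)" "\<And>n. E n \<subseteq> U n"
    "\<And>n. inner_content (U n) \<le> outer (E n) + ennreal (e * (1/2)^Suc n)" by metis
  have "outer (\<Union>n. E n) \<le> outer (\<Union>n. U n)" using U by (intro outer_mono) auto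
  also have "\<dots> = inner_content (\<Union>n. U n)" using U by (intro outer_open) auto
  also have "\<dots> \<le> (\<Sum>n. inner_content (U n))" using U by (intro inner_content_UN) auto
  also have "\<dots> \<le> (\<Sum>n. outer (E n) + ennreal (e * (1/2)^Suc n))" by (intro suminf_le U) auto
  also have "\<dots> = (\<Sum>n. outer (E n)) + (\<Sum>n. ennreal (e * (1/2)^Suc n))" by (simp add: suminf_add)
  also have "(\<Sum>n. ennreal (e * (1/2)^Suc n)) = ennreal e"
    using sums_mult[OF power_half_series, of e] e by (intro suminf_ennreal_eq) auto
  finally show "outer (\<Union>n. E n) \<le> (\<Sum>n. outer (E n)) + ennreal e" .
qed

text \<open>The superadditive half of the Caratheodory criterion for open \<open>V\<close>. A
  function below the intersection, truncated at \<open>e\<close>, is 0 where f < e; the open set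
  \<open>W\<close> around V - U lies in that region, so a function below \<open>W\<close> can be
  added without exceeding 1.\<close>

lemma inner_content_split:
  assumes U: "openin mtopology U" and V: "openin mtopology V"
  shows "inner_content (V \<inter> U) + outer (V - U) \<le> inner_content V"
proof -
  have "ennreal (\<Lambda> f) + outer (V - U) \<le> inner_content V" if f: "f \<in> below (V \<inter> U)" for f
  proof (rule ennreal_le_epsilon)
    fix e :: real assume e: "0 < e"
    have cf: "cont f" using f by (auto simp: below_def)
    define f' where "f' x = max 0 (f x - e)" for x
    have f': "f' \<in> below (V \<inter> U)" "\<Lambda> f \<le> e + \<Lambda> f'"
      using cut_below[OF f, of e] e by (auto simp: f'_def[abs_def])
    define W where "W = V \<inter> {x \<in> M. f x \<in> {..<e}}"
    have W: "openin mtopology W" unfolding W_def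
      using openin_continuous_map_preimage[OF cf, of "{..<e}"] V by (intro openin_Int) auto
    have "V - U \<subseteq> W" using f e openin_subset[OF V] by (auto simp: W_def below_def)
    then have oW: "outer (V - U) \<le> inner_content W" using outer_mono outer_open[OF W] by metis
    have step: "ennreal (\<Lambda> f') + ennreal (\<Lambda> g) \<le> inner_content V" if g: "g \<in> below W" for g
    proof -
      have "(\<lambda>x. f' x + g x) \<in> below V"
      proof -
        have "cont (\<lambda>x. f' x + g x)" using f' g by (auto simp: below_def intro!: continuous_map_add)
        moreover have "0 \<le> f' x + g x \<and> f' x + g x \<le> 1 \<and> (x \<notin> V \<longrightarrow> f' x + g x = 0)" if x: "x \<in> M" for x
        proof (cases "f x < e")
          case True
          then have "f' x = 0" by (simp add: f'_def)
          then show ?thesis using g x by (auto simp: below_def W_def)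
        next
          case False
          then have "g x = 0" using g x by (auto simp: below_def W_def)
          then show ?thesis using f'(1) x by (auto simp: below_def)
        qed
        ultimately show ?thesis by (auto simp: below_def)
      qed
      then have "ennreal (\<Lambda> (\<lambda>x. f' x + g x)) \<le> inner_content V"
        unfolding inner_content_def by (rule SUP_upper)
      then show ?thesis using add[of f' g] f' g below_nonneg[OF f'(1)] below_nonneg[OF g]
        by (simp add: below_def)
    qed
    have "ennreal (\<Lambda> f') + inner_content W \<le> inner_content V"
      unfolding inner_content_def[of W] using step below_zero
      by (subst ennreal_SUP_add_right) (auto intro!: SUP_least)
    then have "ennreal (\<Lambda> f) + outer (V - U) \<le> ennreal e + ennreal (\<Lambda> f') + outer (V - U)"
      using f' e below_nonneg[OF f'(1)] by (intro add_right_mono) (simp flip: ennreal_plus add: ennreal_leI)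
    also have "\<dots> \<le> ennreal e + (ennreal (\<Lambda> f') + inner_content W)"
      using oW by (simp add: add.assoc add_left_mono)
    also have "\<dots> \<le> ennreal e + inner_content V"
      using \<open>ennreal (\<Lambda> f') + inner_content W \<le> inner_content V\<close> by (intro add_left_mono)
    finally show "ennreal (\<Lambda> f) + outer (V - U) \<le> inner_content V + ennreal e" by (simp add: add.commute)
  qed
  then show ?thesis unfolding inner_content_def[of "V \<inter> U"]
    using below_zero by (subst ennreal_SUP_add_left[symmetric]) (auto intro!: SUP_least)
qed

lemma outer_empty: "outer {} = 0"
  using outer_open[of "{}"] inner_content_empty by simp

lemma outer_caratheodory:
  assumes U: "openin mtopology U" and E: "E \<subseteq> M"
  shows "outer (U \<inter> E) + outer ((M - U) \<inter> E) = outer E"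
proof (rule antisym)
  show "outer (U \<inter> E) + outer ((M - U) \<inter> E) \<le> outer E"
    unfolding outer_def[of E]
  proof (rule INF_greatest, clarify)
    fix V assume V: "openin mtopology V" "E \<subseteq> V"
    have "outer (U \<inter> E) + outer ((M - U) \<inter> E) \<le> outer (V \<inter> U) + outer (V - U)"
      using V by (intro add_mono outer_mono) auto
    also have "\<dots> \<le> inner_content V" using inner_content_split[OF U V(1)] V(1) U by (simp add: outer_open openin_Int)
    finally show "outer (U \<inter> E) + outer ((M - U) \<inter> E) \<le> inner_content V" .
  qed
  define F where "F n = (if n = 0 then U \<inter> E else if n = 1 then (M - U) \<inter> E else {})" for n :: nat
  have "(\<Union>n. F n) = E"
  proof -
    have "F 0 \<union> F 1 = E" using E by (auto simp: F_def)
    moreover have "F n \<subseteq> F 0 \<union> F 1" for n by (auto simp: F_def)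
    ultimately show ?thesis by blast
  qed
  moreover have "outer (\<Union>n. F n) \<le> (\<Sum>n. outer (F n))" using E by (intro outer_subadditive) (auto simp: F_def)
  moreover have "(\<Sum>n. outer (F n)) = (\<Sum>n\<in>{0,1}. outer (F n))"
    by (intro suminf_finite) (auto simp: F_def outer_empty)
  ultimately show "outer E \<le> outer (U \<inter> E) + outer ((M - U) \<inter> E)" by (simp add: F_def)
qed

text \<open>Only the values on open sets are exported: these sets are stable under intersection and
  generate the sigma algebra, so the values determine the measure, and invariance can be tested on
  them.\<close>

theorem representing_measure:
  obtains \<mu> where "prob_space \<mu>" "sets \<mu> = sets (borel_of_topology mtopology)"
    "\<And>U. openin mtopology U \<Longrightarrow> emeasure \<mu> U = inner_content U"
proof -
  interpret P: sigma_algebra M "Pow M" by (rule sigma_algebra_Pow)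
  have "outer_measure_space (Pow M) outer"
    unfolding outer_measure_space_def positive_def increasing_def countably_subadditive_def
    by (auto simp: outer_empty outer_mono intro!: outer_subadditive)
  then have ms: "measure_space M (lambda_system M (Pow M) outer) outer"
    by (rule P.caratheodory_lemma)
  define B where "B = sigma_sets M {U. openin mtopology U}"
  have opM: "{U. openin mtopology U} \<subseteq> Pow M" using openin_subset by fastforce
  have sub: "{U. openin mtopology U} \<subseteq> lambda_system M (Pow M) outer"
    using opM outer_caratheodory by (auto simp: lambda_system_def)
  have "sigma_algebra M (lambda_system M (Pow M) outer)" using ms by (simp add: measure_space_def)
  then have BL: "B \<subseteq> lambda_system M (Pow M) outer"
    unfolding B_def using sub sigma_algebra.sigma_sets_subset by blast
  have "measure_space M B outer"
    using ms BL sigma_algebra_sigma_sets[OF opM]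
    unfolding measure_space_def countably_additive_def B_def positive_def
    by (meson subset_iff order_trans)
  define \<mu> where "\<mu> = measure_of M B outer"
  have BM: "B \<subseteq> Pow M" using sigma_sets_into_sp[OF opM] by (auto simp: B_def)
  have sets: "sets \<mu> = B" and sp: "space \<mu> = M"
    using BM opM by (simp_all add: \<mu>_def B_def sigma_sets_sigma_sets_eq)
  have em: "emeasure \<mu> X = outer X" if "X \<in> B" for X
    using \<open>measure_space M B outer\<close> that sets unfolding measure_space_def
    by (intro emeasure_measure_of[OF \<mu>_def]) (auto simp: B_def dest: sigma_sets_into_sp[OF opM])
  have emo: "emeasure \<mu> U = inner_content U" if "openin mtopology U" for U
    using em[of U] that outer_open by (auto simp: B_def)
  show thesis
  proof (rule that)
    show "prob_space \<mu>" by (rule prob_spaceI) (metis emo sp inner_content_M openin_topspace topspace_mtopology)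
    show "sets \<mu> = sets (borel_of_topology mtopology)"
      unfolding sets borel_of_topology_def B_def using opM by simp
  qed (rule emo)
qed

end

section \<open>A criterion for unique ergodicity\<close>

locale compact_action = Metric_space M d for M :: "'a set" and d +
  fixes act :: "'g::ab_group_add \<Rightarrow> 'a \<Rightarrow> 'a"
  assumes compact: "compact_space mtopology"
    and nonempty: "M \<noteq> {}"
    and act_cont: "continuous_map mtopology mtopology (act g)"
    and act_zero: "x \<in> M \<Longrightarrow> act 0 x = x"
    and act_add: "x \<in> M \<Longrightarrow> act g (act h x) = act (g + h) x"
begin

abbreviation cont where "cont \<equiv> continuous_map mtopology euclideanreal"

text \<open>\<open>comb t N\<close>: \<open>N\<close> is a linear combination of translations with nonnegative
  coefficients of sum \<open>t\<close>.\<close>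

inductive comb :: "real \<Rightarrow> (('a \<Rightarrow> real) \<Rightarrow> 'a \<Rightarrow> real) \<Rightarrow> bool" where
  zero: "comb 0 (\<lambda>f x. 0)"
| shift: "comb 1 (\<lambda>f x. f (act g x))"
| scale: "comb t N \<Longrightarrow> 0 \<le> a \<Longrightarrow> comb (a * t) (\<lambda>f x. a * N f x)"
| add: "comb s L \<Longrightarrow> comb t N \<Longrightarrow> comb (s + t) (\<lambda>f x. L f x + N f x)"
| comp: "comb s L \<Longrightarrow> comb t N \<Longrightarrow> comb (s * t) (\<lambda>f. L (N f))"

lemma act_in: "x \<in> M \<Longrightarrow> act g x \<in> M"
  using act_cont[of g] by (auto simp: continuous_map_def)

lemma cont_shift: "cont f \<Longrightarrow> cont (\<lambda>x. f (act g x))"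
  using continuous_map_compose[OF act_cont, of euclideanreal f] by (simp add: o_def)

lemma comb_add: "comb t N \<Longrightarrow> N (\<lambda>x. f x + g x) = (\<lambda>x. N f x + N g x)"
  by (induction arbitrary: f g rule: comb.induct) (simp_all add: algebra_simps)

lemma comb_cmult: "comb t N \<Longrightarrow> N (\<lambda>x. c * f x) = (\<lambda>x. c * N f x)"
  by (induction arbitrary: f rule: comb.induct) (simp_all add: distrib_left mult.left_commute)

lemma comb_const: "comb t N \<Longrightarrow> N (\<lambda>_. c) = (\<lambda>_. t * c)"
  by (induction arbitrary: c rule: comb.induct) (simp_all add: distrib_right mult.assoc)

lemma comb_mono: "comb t N \<Longrightarrow> (\<And>x. x \<in> M \<Longrightarrow> f x \<le> g x) \<Longrightarrow> x \<in> M \<Longrightarrow> N f x \<le> N g x"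
proof (induction arbitrary: f g x rule: comb.induct)
  case (scale t N a) then show ?case by (intro mult_left_mono scale.IH)
next
  case (add s L t N) then show ?case by (intro add_mono add.IH)
next
  case (comp s L t N) then show ?case by (intro comp.IH(1)[of "N f" "N g"] comp.IH(2)[of f g])
qed (simp_all add: act_in)

lemma comb_cong: "comb t N \<Longrightarrow> (\<And>x. x \<in> M \<Longrightarrow> f x = g x) \<Longrightarrow> x \<in> M \<Longrightarrow> N f x = N g x"
  using comb_mono[of t N f g x] comb_mono[of t N g f x] by force

lemma comb_cont: "comb t N \<Longrightarrow> cont f \<Longrightarrow> cont (N f)"
proof (induction arbitrary: f rule: comb.induct)
  case (scale t N a) then show ?case by (intro continuous_map_real_mult_left scale.IH)
next
  case (add s L t N) then show ?case by (intro continuous_map_add add.IH)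
next
  case (comp s L t N) then show ?case by (intro comp.IH(1) comp.IH(2))
qed (simp_all add: cont_shift)

text \<open>Commutativity of the acting group enters here, through the case \<open>shift\<close>.
  Points are restricted to \<open>M\<close>, where \<open>act_add\<close> holds.\<close>

lemma comb_shift: "comb t N \<Longrightarrow> x \<in> M \<Longrightarrow> N (\<lambda>x. f (act g x)) x = N f (act g x)"
proof (induction arbitrary: f x rule: comb.induct)
  case (comp s L t N)
  have "L (N (\<lambda>x. f (act g x))) x = L (\<lambda>x. N f (act g x)) x"
    using comp by (intro comb_cong[of s L]) auto
  then show ?case using comp by simp
qed (simp_all add: act_add add.commute)

text \<open>Induction on \<open>L\<close>: linearity of \<open>N\<close> settles
  \<open>scale\<close> and \<open>add\<close>, and a single translation is
  \<open>comb_shift\<close>. Through \<open>avg_add\<close> this forces all constants reached from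
  one function to agree.\<close>

lemma comb_commute: "comb s L \<Longrightarrow> comb t N \<Longrightarrow> x \<in> M \<Longrightarrow> L (N f) x = N (L f) x"
proof (induction arbitrary: f x rule: comb.induct)
  case zero then show ?case using comb_const[of t N 0] by simp
next
  case shift then show ?case by (simp add: comb_shift)
next
  case (scale s L a) then show ?case using comb_cmult[OF scale.prems(1), of a "L f"] by simp
next
  case (add s L u K) then show ?case using comb_add[OF add.prems(1), of "L f" "K f"] by simp
next
  case (comp s L u K)
  have "L (K (N f)) x = L (N (K f)) x"
    using comp by (intro comb_cong[of s L]) auto
  then show ?case using comp by simp
qed

lemma comb_dist:
  assumes N: "comb 1 N" and f: "\<And>x. x \<in> M \<Longrightarrow> \<bar>f x - c\<bar> \<le> e" and x: "x \<in> M"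
  shows "\<bar>N f x - c\<bar> \<le> e"
proof -
  have f': "f x \<le> c + e" "c - e \<le> f x" if "x \<in> M" for x using f[OF that] by linarith+
  have "N f x \<le> N (\<lambda>_. c + e) x" using f' by (intro comb_mono[OF N] x)
  moreover have "N (\<lambda>_. c - e) x \<le> N f x" using f' by (intro comb_mono[OF N] x)
  ultimately show ?thesis using comb_const[OF N] by (simp add: abs_le_iff)
qed

section \<open>Integration against an invariant probability\<close>

lemma invariant_space:
  assumes "invariant_probability mtopology act \<mu>" shows "space \<mu> = M"
proof -
  have "sets \<mu> = sets (borel_of_topology mtopology)" using assms by (auto simp: invariant_probability_def)
  then have "space \<mu> = space (borel_of_topology mtopology)" by (rule sets_eq_imp_space_eq)
  moreover have "{U. openin mtopology U} \<subseteq> Pow M" using openin_subset by fastforce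
  ultimately show ?thesis by (simp add: borel_of_topology_def)
qed

lemma cont_measurable:
  assumes \<mu>: "invariant_probability mtopology act \<mu>" and f: "cont f"
  shows "f \<in> borel_measurable \<mu>"
proof (rule borel_measurableI)
  fix S :: "real set" assume "open S"
  then have "openin mtopology {x \<in> M. f x \<in> S}"
    using openin_continuous_map_preimage[OF f, of S] by simp
  moreover have "{U. openin mtopology U} \<subseteq> Pow M" using openin_subset by fastforce
  moreover have "f -` S \<inter> space \<mu> = {x \<in> M. f x \<in> S}" using invariant_space[OF \<mu>] by auto
  moreover have "sets \<mu> = sets (borel_of_topology mtopology)" using \<mu> by (auto simp: invariant_probability_def)
  ultimately show "f -` S \<inter> space \<mu> \<in> sets \<mu>" by (auto simp: borel_of_topology_def)
qed

lemma cont_bounded: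
  assumes f: "cont f" obtains b where "\<And>x. x \<in> M \<Longrightarrow> \<bar>f x\<bar> \<le> b"
proof -
  have "compactin euclideanreal (f ` M)"
    using image_compactin[OF _ f, of M] compact by (simp add: compact_space_def)
  then have "bounded (f ` M)" by (simp add: compact_imp_bounded)
  then show thesis using that by (force simp: bounded_iff)
qed

lemma cont_integrable:
  assumes \<mu>: "invariant_probability mtopology act \<mu>" and f: "cont f"
  shows "integrable \<mu> f"
proof -
  interpret prob_space \<mu> using \<mu> by (auto simp: invariant_probability_def)
  obtain b where "\<And>x. x \<in> M \<Longrightarrow> \<bar>f x\<bar> \<le> b" using cont_bounded[OF f] by blast
  then show ?thesis using invariant_space[OF \<mu>]
    by (intro integrable_const_bound[of _ b] cont_measurable[OF \<mu> f]) (auto intro!: AE_I2)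
qed

lemma comb_integral:
  assumes N: "comb t N" and f: "cont f" and \<mu>: "invariant_probability mtopology act \<mu>"
  shows "(\<integral>x. N f x \<partial>\<mu>) = t * (\<integral>x. f x \<partial>\<mu>)"
  using N f
proof (induction arbitrary: f rule: comb.induct)
  case (shift g)
  have "act g \<in> measurable \<mu> \<mu>" "distr \<mu> \<mu> (act g) = \<mu>" using \<mu> by (auto simp: invariant_probability_def)
  moreover have "f \<in> borel_measurable \<mu>" by (rule cont_measurable[OF \<mu> shift])
  ultimately have "(\<integral>x. f x \<partial>\<mu>) = (\<integral>x. f (act g x) \<partial>\<mu>)"
    using integral_distr[of "act g" \<mu> \<mu> f] by metis
  then show ?case by simp
next
  case (add s L t N)
  have "integrable \<mu> (L f)" "integrable \<mu> (N f)"
    by (intro cont_integrable \<mu> comb_cont[OF add.hyps(1)] comb_cont[OF add.hyps(2)] add.prems)+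
  then show ?case using add by (simp add: distrib_right)
next
  case (comp s L t N)
  then show ?case using comb_cont[OF comp.hyps(2) comp.prems] by simp
qed simp_all

section \<open>The invariant mean\<close>

text \<open>On \<open>M\<close>, the constant \<open>c\<close> lies in the uniform closure of the
  convex hull of the translates of \<open>f\<close>. Some averages have to approach it, not
  all.\<close>

definition avg :: "('a \<Rightarrow> real) \<Rightarrow> real \<Rightarrow> bool" where
  "avg f c \<longleftrightarrow> (\<forall>e>0. \<exists>N. comb 1 N \<and> (\<forall>x\<in>M. \<bar>N f x - c\<bar> < e))"

text \<open>Averaging with total weight 1 preserves the integral against an invariant measure, while
  suitable averages are uniformly close to \<open>c\<close>.\<close>

lemma integral_avg:
  assumes \<mu>: "invariant_probability mtopology act \<mu>" and f: "cont f" and c: "avg f c"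
  shows "(\<integral>x. f x \<partial>\<mu>) = c"
proof -
  interpret prob_space \<mu> using \<mu> by (auto simp: invariant_probability_def)
  have "\<bar>(\<integral>x. f x \<partial>\<mu>) - c\<bar> \<le> e" if e: "e > 0" for e
  proof -
    obtain N where N: "comb 1 N" "\<forall>x\<in>M. \<bar>N f x - c\<bar> < e" using c e by (auto simp: avg_def)
    have i: "integrable \<mu> (N f)" by (intro cont_integrable \<mu> comb_cont[OF N(1)] f)
    have "(\<integral>x. N f x - c \<partial>\<mu>) = (\<integral>x. N f x \<partial>\<mu>) - (\<integral>x. c \<partial>\<mu>)"
      by (rule Bochner_Integration.integral_diff[OF i]) (rule integrable_const)
    also have "(\<integral>x. c \<partial>\<mu>) = c" by (simp add: prob_space)
    also have "(\<integral>x. N f x \<partial>\<mu>) = (\<integral>x. f x \<partial>\<mu>)"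
      by (rule comb_integral[OF N(1) f \<mu>, unfolded mult_1])
    finally have "(\<integral>x. f x \<partial>\<mu>) - c = (\<integral>x. N f x - c \<partial>\<mu>)" ..
    also have "\<bar>\<dots>\<bar> \<le> (\<integral>x. \<bar>N f x - c\<bar> \<partial>\<mu>)" by (rule integral_abs_bound)
    also have "\<dots> \<le> (\<integral>x. e \<partial>\<mu>)"
    proof (rule integral_mono)
      show "integrable \<mu> (\<lambda>x. \<bar>N f x - c\<bar>)" using i by simp
      show "\<bar>N f x - c\<bar> \<le> e" if "x \<in> space \<mu>" for x
        using N(2) that invariant_space[OF \<mu>] by (simp add: less_imp_le)
    qed simp
    finally show ?thesis by (simp add: prob_space)
  qed
  then have "\<bar>(\<integral>x. f x \<partial>\<mu>) - c\<bar> \<le> 0" by (rule field_le_epsilon) simp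
  then show ?thesis by simp
qed

text \<open>One operator has to serve both functions. The composition of one good for
  \<open>f\<close> with one good for \<open>g\<close> does so, because they commute and a further
  average of a nearly constant function stays near the same constant.\<close>

lemma avg_add:
  assumes "avg f a" "avg g b" shows "avg (\<lambda>x. f x + g x) (a + b)"
  unfolding avg_def
proof (intro allI impI)
  fix e :: real assume "e > 0"
  then have e: "e/3 > 0" by simp
  from e assms obtain L N where L: "comb 1 L" "\<And>x. x \<in> M \<Longrightarrow> \<bar>L f x - a\<bar> < e/3"
    and N: "comb 1 N" "\<And>x. x \<in> M \<Longrightarrow> \<bar>N g x - b\<bar> < e/3" unfolding avg_def by metis
  have "comb (1 * 1) (\<lambda>f. L (N f))" by (rule comb.comp[OF L(1) N(1)])
  moreover have "\<bar>L (N (\<lambda>x. f x + g x)) x - (a + b)\<bar> < e" if x: "x \<in> M" for x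
  proof -
    have "\<bar>N (L f) x - a\<bar> \<le> e/3" using L(2) by (intro comb_dist[OF N(1)] x) (auto intro: less_imp_le)
    moreover have "\<bar>L (N g) x - b\<bar> \<le> e/3" using N(2) by (intro comb_dist[OF L(1)] x) (auto intro: less_imp_le)
    moreover have "L (N (\<lambda>x. f x + g x)) x = N (L f) x + L (N g) x"
      using comb_commute[OF L(1) N(1) x] comb_add[OF L(1)] comb_add[OF N(1)] by simp
    ultimately show ?thesis using e by linarith
  qed
  ultimately show "\<exists>N. comb 1 N \<and> (\<forall>x\<in>M. \<bar>N (\<lambda>x. f x + g x) x - (a + b)\<bar> < e)" by auto
qed

lemma avg_const: "avg (\<lambda>_. c) c"
  unfolding avg_def using comb.shift[of 0] by (intro allI impI exI[of _ "\<lambda>f x. f (act 0 x)"]) simp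

lemma avg_uminus:
  assumes "avg f c" shows "avg (\<lambda>x. - f x) (- c)"
  unfolding avg_def
proof (intro allI impI)
  fix e :: real assume "e > 0"
  then obtain N where N: "comb 1 N" "\<forall>x\<in>M. \<bar>N f x - c\<bar> < e" using assms by (auto simp: avg_def)
  have "\<bar>N (\<lambda>x. - f x) x - - c\<bar> < e" if "x \<in> M" for x
    using N(2) that comb_cmult[OF N(1), of "-1" f] by (simp add: abs_minus_commute)
  then show "\<exists>N. comb 1 N \<and> (\<forall>x\<in>M. \<bar>N (\<lambda>x. - f x) x - - c\<bar> < e)" using N(1) by blast
qed

lemma avg_nonneg:
  assumes "avg f c" "\<And>x. x \<in> M \<Longrightarrow> 0 \<le> f x" shows "0 \<le> c"
proof (rule ccontr)
  assume "\<not> 0 \<le> c"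
  then obtain N where N: "comb 1 N" "\<And>x. x \<in> M \<Longrightarrow> \<bar>N f x - c\<bar> < - c"
    using assms(1) unfolding avg_def by (metis neg_0_less_iff_less not_le)
  obtain x where x: "x \<in> M" using nonempty by auto
  have "0 \<le> N f x" using comb_mono[OF N(1), of "\<lambda>_. 0" f x] comb_const[OF N(1), of 0] assms(2) x by simp
  then show False using N(2)[OF x] by linarith
qed

lemma avg_mono:
  assumes "avg f a" "avg g b" "\<And>x. x \<in> M \<Longrightarrow> f x \<le> g x" shows "a \<le> b"
  using avg_nonneg[OF avg_add[OF assms(2) avg_uminus[OF assms(1)]]] assms(3) by simp

lemma avg_unique: "avg f a \<Longrightarrow> avg f b \<Longrightarrow> a = b"
  by (intro antisym avg_mono[of f a f b] avg_mono[of f b f a]) auto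

lemma avg_shift:
  assumes "avg f c" shows "avg (\<lambda>x. f (act g x)) c"
  unfolding avg_def
proof (intro allI impI)
  fix e :: real assume "e > 0"
  then obtain N where "comb 1 N" "\<forall>x\<in>M. \<bar>N f x - c\<bar> < e" using assms by (auto simp: avg_def)
  then show "\<exists>N. comb 1 N \<and> (\<forall>x\<in>M. \<bar>N (\<lambda>x. f (act g x)) x - c\<bar> < e)"
    by (intro exI[of _ N]) (auto simp: comb_shift act_in)
qed

text \<open>The values \<open>c n\<close> form a Cauchy sequence: the common value of N m (N n f)
  and N n (N m f) at \<open>x0\<close> is close to \<open>c n\<close> as well as to
  \<open>c m\<close>.\<close>

lemma avg_exists:
  assumes osc: "\<And>e. e > 0 \<Longrightarrow> \<exists>N. comb 1 N \<and> (\<forall>x\<in>M. \<forall>y\<in>M. \<bar>N f x - N f y\<bar> < e)"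
  shows "\<exists>c. avg f c"
proof -
  have "\<exists>N. comb 1 N \<and> (\<forall>x\<in>M. \<forall>y\<in>M. \<bar>N f x - N f y\<bar> < inverse (Suc n))" for n by (rule osc) simp
  then obtain N where N: "\<And>n. comb 1 (N n)"
    and o: "\<And>n x y. x \<in> M \<Longrightarrow> y \<in> M \<Longrightarrow> \<bar>N n f x - N n f y\<bar> < inverse (Suc n)" by metis
  obtain x0 where x0: "x0 \<in> M" using nonempty by auto
  define c where "c n = N n f x0" for n
  have cc: "\<bar>c n - c m\<bar> \<le> inverse (Suc n) + inverse (Suc m)" for n m
  proof -
    have "\<bar>N m (N n f) x0 - c n\<bar> \<le> inverse (Suc n)"
      unfolding c_def using o[of _ x0 n, THEN less_imp_le] x0 by (intro comb_dist[OF N, where f="N n f"])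
    moreover have "\<bar>N n (N m f) x0 - c m\<bar> \<le> inverse (Suc m)"
      unfolding c_def using o[of _ x0 m, THEN less_imp_le] x0 by (intro comb_dist[OF N, where f="N m f"])
    ultimately show ?thesis using comb_commute[OF N N x0, of n m f] by linarith
  qed
  have inv0: "(\<lambda>n. inverse (real (Suc n))) \<longlonglongrightarrow> 0" by (rule LIMSEQ_inverse_real_of_nat)
  have "Cauchy c"
  proof (rule metric_CauchyI)
    fix e :: real assume "e > 0"
    then obtain K where K: "inverse (real (Suc K)) < e/2" using reals_Archimedean[of "e/2"] by auto
    show "\<exists>K. \<forall>m\<ge>K. \<forall>n\<ge>K. dist (c m) (c n) < e"
    proof (intro exI allI impI)
      fix m n assume mn: "K \<le> m" "K \<le> n"
      then have "inverse (real (Suc m)) \<le> inverse (real (Suc K))" "inverse (real (Suc n)) \<le> inverse (real (Suc K))"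
        by (auto intro!: le_imp_inverse_le)
      then show "dist (c m) (c n) < e" using cc[of m n] K unfolding dist_real_def by linarith
    qed
  qed
  then obtain l where l: "c \<longlonglongrightarrow> l" using Cauchy_convergent convergent_def by metis
  have "avg f l"
    unfolding avg_def
  proof (intro allI impI)
    fix e :: real assume e: "e > 0"
    have "eventually (\<lambda>n. inverse (real (Suc n)) < e/2) sequentially"
      using inv0 e by (intro order_tendstoD(2)) auto
    moreover have "eventually (\<lambda>n. \<bar>c n - l\<bar> < e/2) sequentially"
      using tendstoD[OF l, of "e/2"] e by (simp add: dist_real_def)
    ultimately have "eventually (\<lambda>n. inverse (real (Suc n)) < e/2 \<and> \<bar>c n - l\<bar> < e/2) sequentially"
      by eventually_elim simp
    then obtain n where n: "inverse (real (Suc n)) < e/2" "\<bar>c n - l\<bar> < e/2"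
      by (auto dest: eventually_happens)
    have "\<bar>N n f x - l\<bar> < e" if "x \<in> M" for x
      using o[OF that x0, of n] n unfolding c_def by linarith
    then show "\<exists>N. comb 1 N \<and> (\<forall>x\<in>M. \<bar>N f x - l\<bar> < e)" using N by blast
  qed
  then show ?thesis by blast
qed

text \<open>Vanishing oscillation gives every continuous function a mean. Uniqueness tests open sets
  with continuous functions, whose integrals are forced by \<open>integral_avg\<close>; existence
  takes the measure representing the mean.\<close>

theorem uniquely_ergodicI:
  assumes osc: "\<And>f e. cont f \<Longrightarrow> e > 0 \<Longrightarrow> \<exists>N. comb 1 N \<and> (\<forall>x\<in>M. \<forall>y\<in>M. \<bar>N f x - N f y\<bar> < e)"
  shows "uniquely_ergodic mtopology act"
proof -
  define \<Lambda> where "\<Lambda> f = (THE c. avg f c)" for f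
  have \<Lambda>: "avg f (\<Lambda> f)" if "cont f" for f
    unfolding \<Lambda>_def using avg_exists[OF osc[OF that]] avg_unique by (metis theI)
  have \<Lambda>_eq: "\<Lambda> f = c" if "avg f c" for f c
    unfolding \<Lambda>_def using that avg_unique by blast
  interpret R: normalised_functional M d \<Lambda>
  proof
    show "compact_space mtopology" by (rule compact)
    show "\<Lambda> (\<lambda>x. f x + g x) = \<Lambda> f + \<Lambda> g" if "cont f" "cont g" for f g
      using that by (intro \<Lambda>_eq avg_add \<Lambda>)
    show "\<Lambda> f \<le> \<Lambda> g" if "cont f" "cont g" "\<And>x. x \<in> M \<Longrightarrow> f x \<le> g x" for f g
      using avg_mono[OF \<Lambda> \<Lambda>] that by blast
    show "\<Lambda> (\<lambda>_. c) = c" for c by (intro \<Lambda>_eq avg_const)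
  qed
  have opM: "{U. openin mtopology U} \<subseteq> Pow M" using openin_subset by fastforce
  have agree: "\<mu> = \<nu>"
    if \<mu>: "prob_space \<mu>" "sets \<mu> = sets (borel_of_topology mtopology)"
      and \<nu>: "prob_space \<nu>" "sets \<nu> = sets (borel_of_topology mtopology)"
      and eq: "\<And>U. openin mtopology U \<Longrightarrow> emeasure \<mu> U = emeasure \<nu> U" for \<mu> \<nu>
  proof (rule measure_eqI_generator_eq[OF _ opM, where A="\<lambda>_::nat. M"])
    show "Int_stable {U. openin mtopology U}" by (auto simp: Int_stable_def)
    show "sets \<mu> = sigma_sets M {U. openin mtopology U}" "sets \<nu> = sigma_sets M {U. openin mtopology U}"
      using \<mu> \<nu> opM by (auto simp: borel_of_topology_def)
    show "emeasure \<mu> M \<noteq> \<infinity>" for i :: nat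
      using \<mu>(1) by (simp add: prob_space.finite_measure finite_measure.emeasure_finite)
  qed (use eq in auto)
  obtain \<mu> where \<mu>: "prob_space \<mu>" "sets \<mu> = sets (borel_of_topology mtopology)"
    "\<And>U. openin mtopology U \<Longrightarrow> emeasure \<mu> U = R.inner_content U" by (rule R.representing_measure) blast
  have sp: "space \<mu> = M" using sets_eq_imp_space_eq[OF \<mu>(2)] opM by (simp add: borel_of_topology_def)
  have am: "act g \<in> measurable \<mu> \<mu>" for g
  proof (rule measurable_sigma_sets[where A="{U. openin mtopology U}" and \<Omega>=M])
    show "sets \<mu> = sigma_sets M {U. openin mtopology U}"
      using \<mu>(2) opM by (simp add: borel_of_topology_def)
    show "act g \<in> space \<mu> \<rightarrow> M" using sp act_in by auto
    fix U assume "U \<in> {U. openin mtopology U}"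
    then have "openin mtopology {x \<in> M. act g x \<in> U}"
      using openin_continuous_map_preimage[OF act_cont, of U g] by simp
    moreover have "act g -` U \<inter> space \<mu> = {x \<in> M. act g x \<in> U}" using sp by auto
    ultimately show "act g -` U \<inter> space \<mu> \<in> sets \<mu>"
      using \<mu>(2) opM by (auto simp: borel_of_topology_def)
  qed (rule opM)
  \<comment> \<open>Composition with a translation maps \<open>R.below U\<close> into the
    corresponding set for the preimage and keeps the mean. The opposite inequality comes later from
    the same fact for -g.\<close>
  have inner_shift: "R.inner_content {x \<in> M. act g x \<in> U} \<ge> R.inner_content U" for g U
    unfolding R.inner_content_def
  proof (rule SUP_least)
    fix f assume f: "f \<in> R.below U"
    then have "cont f" by (auto simp: R.below_def)
    have "(\<lambda>x. f (act g x)) \<in> R.below {x \<in> M. act g x \<in> U}"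
      using f cont_shift[of f g] act_in by (auto simp: R.below_def)
    moreover have "\<Lambda> (\<lambda>x. f (act g x)) = \<Lambda> f" using \<open>cont f\<close> by (intro \<Lambda>_eq avg_shift \<Lambda>)
    ultimately show "ennreal (\<Lambda> f) \<le> (SUP f\<in>R.below {x \<in> M. act g x \<in> U}. ennreal (\<Lambda> f))"
      by (metis (no_types, lifting) SUP_upper)
  qed
  have inv: "distr \<mu> \<mu> (act g) = \<mu>" for g
  proof (rule agree)
    show "prob_space (distr \<mu> \<mu> (act g))" by (rule prob_space.prob_space_distr[OF \<mu>(1) am])
    fix U assume U: "openin mtopology U"
    have pre: "openin mtopology {x \<in> M. act g x \<in> U}" for g
      using openin_continuous_map_preimage[OF act_cont U, of g] by simp
    have "U = {x \<in> M. act (-g) x \<in> {x \<in> M. act g x \<in> U}}"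
      using openin_subset[OF U] act_in act_add act_zero by (auto simp: act_add)
    then have "R.inner_content {x \<in> M. act g x \<in> U} \<le> R.inner_content U"
      using inner_shift[of "{x \<in> M. act g x \<in> U}" "-g"] by simp
    then have "R.inner_content {x \<in> M. act g x \<in> U} = R.inner_content U" using inner_shift[of U g] by simp
    moreover have "act g -` U \<inter> space \<mu> = {x \<in> M. act g x \<in> U}" using sp by auto
    moreover have "U \<in> sets \<mu>" using \<mu>(2) opM U by (auto simp: borel_of_topology_def)
    ultimately show "emeasure (distr \<mu> \<mu> (act g)) U = emeasure \<mu> U"
      using \<mu>(3) U pre am by (simp add: emeasure_distr)
  qed (use \<mu> in auto)
  have exists: "invariant_probability mtopology act \<mu>"
    using \<mu> am inv by (auto simp: invariant_probability_def)
  have unique: "emeasure \<nu> U = emeasure \<nu>' U"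
    if \<nu>: "invariant_probability mtopology act \<nu>" and \<nu>': "invariant_probability mtopology act \<nu>'"
      and U: "openin mtopology U" for \<nu> \<nu>' U
  proof -
    \<comment> \<open>These functions increase to the indicator of \<open>U\<close> on
      \<open>M\<close>: at a point of \<open>U\<close> the distance to M - U is positive, so the
      product eventually exceeds 1.\<close>
    define f where "f n x = min 1 (real n * setdistance (M - U) x)" for n x
    have cf: "cont (f n)" for n unfolding f_def
      by (intro continuous_map_real_min continuous_map_real_mult continuous_map_setdistance) auto
    have lim: "(\<lambda>n. f n x) \<longlonglongrightarrow> indicator U x" if x: "x \<in> M" for x
    proof (cases "x \<in> U")
      case True
      have p: "0 < setdistance (M - U) x" using x True U by (intro setdistance_pos) auto
      have "eventually (\<lambda>n. f n x = indicator U x) sequentially"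
      proof -
        obtain k :: nat where k: "1 < real k * setdistance (M - U) x" using p reals_Archimedean3 by blast
        have "f n x = 1" if "n \<ge> k" for n
        proof -
          have "real k * setdistance (M - U) x \<le> real n * setdistance (M - U) x"
            using p that by (intro mult_right_mono) auto
          then show ?thesis using k by (simp add: f_def)
        qed
        then show ?thesis using True by (auto simp: eventually_sequentially)
      qed
      then show ?thesis by (rule tendsto_eventually)
    next
      case False
      then have "setdistance (M - U) x = 0" using x by (intro setdistance_eq_0) auto
      then show ?thesis using False by (simp add: f_def)
    qed
    have "(\<lambda>n. \<integral>x. f n x \<partial>\<nu>) \<longlonglongrightarrow> measure \<nu> U" if \<nu>: "invariant_probability mtopology act \<nu>" for \<nu>
    proof -
      interpret prob_space \<nu> using \<nu> by (auto simp: invariant_probability_def)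
      have s: "space \<nu> = M" by (rule invariant_space[OF \<nu>])
      have "U \<in> sets \<nu>" using \<nu> opM U by (auto simp: invariant_probability_def borel_of_topology_def)
      have "(\<lambda>n. \<integral>x. f n x \<partial>\<nu>) \<longlonglongrightarrow> (\<integral>x. indicator U x \<partial>\<nu>)"
      proof (rule integral_dominated_convergence[where w="\<lambda>_. 1"])
        show "f n \<in> borel_measurable \<nu>" for n by (rule cont_measurable[OF \<nu> cf])
        show "AE x in \<nu>. norm (f n x) \<le> 1" for n
          using setdistance_nonneg[of _ "M - U"] s by (intro AE_I2) (auto simp: f_def)
      qed (use \<open>U \<in> sets \<nu>\<close> lim s in auto)
      then show ?thesis using \<open>U \<in> sets \<nu>\<close> by simp
    qed
    from LIMSEQ_unique[OF this[OF \<nu>]] this[OF \<nu>']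
    have "measure \<nu> U = measure \<nu>' U" using integral_avg[OF \<nu> cf \<Lambda>[OF cf]] integral_avg[OF \<nu>' cf \<Lambda>[OF cf]] by simp
    then show ?thesis using \<nu> \<nu>' unfolding invariant_probability_def
      by (metis finite_measure.emeasure_eq_measure prob_space.finite_measure)
  qed
  show ?thesis unfolding uniquely_ergodic_def
  proof (rule ex1I)
    show "invariant_probability mtopology act \<mu>" by (rule exists)
    show "\<nu> = \<mu>" if "invariant_probability mtopology act \<nu>" for \<nu>
      using that exists unique[OF that exists] by (intro agree) (auto simp: invariant_probability_def)
  qed
qed

end

section \<open>Tilings and their coloured sets\<close>

definition tile :: "('k \<Rightarrow> (real ^ 'n) set) \<Rightarrow> real ^ 'n \<Rightarrow> 'k \<Rightarrow> ('n, 'k) tile" where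
  "tile A x i = translate_tile x (prototile A i)"

definition tiles_of :: "('k \<Rightarrow> (real ^ 'n) set) \<Rightarrow> ((real ^ 'n) \<times> 'k) set \<Rightarrow> ('n, 'k) tile set" where
  "tiles_of A L = {tile A x i | x i. (x, i) \<in> L}"

definition covering :: "('k \<Rightarrow> (real ^ 'n) set) \<Rightarrow> ((real ^ 'n) \<times> 'k) set \<Rightarrow> bool" where
  "covering A L \<longleftrightarrow> (\<forall>p. \<exists>(x, i)\<in>L. p - x \<in> A i)"

definition packing :: "('k \<Rightarrow> (real ^ 'n) set) \<Rightarrow> ((real ^ 'n) \<times> 'k) set \<Rightarrow> bool" where
  "packing A L \<longleftrightarrow> (\<forall>x i y j p. (x, i) \<in> L \<longrightarrow> (y, j) \<in> L \<longrightarrow>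
     p - x \<in> interior (A i) \<longrightarrow> p - y \<in> interior (A j) \<longrightarrow> x = y \<and> i = j)"

text \<open>One of the two inclusions in the definition of \<open>tiling_dist\<close>, spelled out
  for points: 1/e is the radius of the window and \<open>e\<close> the allowed displacement.\<close>

definition near :: "real \<Rightarrow> ((real ^ 'n) \<times> 'k) set \<Rightarrow> ((real ^ 'n) \<times> 'k) set \<Rightarrow> bool" where
  "near e L L' \<longleftrightarrow> (\<forall>x i. (x, i) \<in> L \<longrightarrow> norm x < 1/e \<longrightarrow> (\<exists>y. (y, i) \<in> L' \<and> norm (x - y) < e))"

lemma nearD: "near e L L' \<Longrightarrow> (x, i) \<in> L \<Longrightarrow> norm x < 1/e \<Longrightarrow> \<exists>y. (y, i) \<in> L' \<and> norm (x - y) < e"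
  by (auto simp: near_def)

lemma mem_translation_iff: "(p :: 'a::ab_group_add) \<in> (+) x ` S \<longleftrightarrow> p - x \<in> S"
proof
  assume "p - x \<in> S" then have "x + (p - x) \<in> (+) x ` S" by blast
  then show "p \<in> (+) x ` S" by simp
qed auto

lemma mem_interior_translation: "(p :: 'a::real_normed_vector) \<in> interior ((+) x ` S) \<longleftrightarrow> p - x \<in> interior S"
  by (simp add: interior_translation mem_translation_iff)

lemma fst_tile: "fst (tile A x i) = (+) x ` A i" and snd_tile: "snd (tile A x i) = i"
  by (simp_all add: tile_def translate_tile_def prototile_def)

lemma translate_tile_add: "translate_tile g (translate_tile h t) = translate_tile (g + h) t"
  by (simp add: translate_tile_def image_image add.assoc)

lemma translate_tile_0: "translate_tile 0 t = t"
  by (simp add: translate_tile_def)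

lemma translate_tile: "translate_tile g (tile A x i) = tile A (g + x) i"
  by (simp add: tile_def translate_tile_add)

lemma mem_coloured_set: "(x, i) \<in> coloured_set A S \<longleftrightarrow> tile A x i \<in> S"
  by (simp add: coloured_set_def tile_def)

lemma coloured_set_shift: "(x, i) \<in> coloured_set A (tiling_shift g S) \<longleftrightarrow> (x + g, i) \<in> coloured_set A S"
proof
  assume "(x, i) \<in> coloured_set A (tiling_shift g S)"
  then obtain t where t: "t \<in> S" "tile A x i = translate_tile (-g) t"
    by (auto simp: mem_coloured_set tiling_shift_def)
  have "t = translate_tile g (tile A x i)" unfolding t(2) by (simp add: translate_tile_add translate_tile_0)
  then show "(x + g, i) \<in> coloured_set A S" using t(1) by (simp add: mem_coloured_set translate_tile add.commute)
next
  assume "(x + g, i) \<in> coloured_set A S"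
  then have "translate_tile (-g) (tile A (x + g) i) \<in> tiling_shift g S"
    by (simp add: mem_coloured_set tiling_shift_def)
  then show "(x, i) \<in> coloured_set A (tiling_shift g S)" by (simp add: mem_coloured_set translate_tile)
qed

lemma tiling_shift_add: "tiling_shift g (tiling_shift h S) = tiling_shift (g + h) S"
  by (simp add: tiling_shift_def image_image translate_tile_add)

lemma tiling_shift_0: "tiling_shift 0 S = S"
  by (simp add: tiling_shift_def translate_tile_0)

lemma covering_shift: "covering A {(x, i). (x + g, i) \<in> L} \<longleftrightarrow> covering A L"
proof -
  have *: "covering A {(x, i). (x + g, i) \<in> L}" if "covering A L" for g L
    unfolding covering_def
  proof
    fix p
    from that obtain x i where "(x, i) \<in> L" "p + g - x \<in> A i" unfolding covering_def by force
    then show "\<exists>(x, i)\<in>{(x, i). (x + g, i) \<in> L}. p - x \<in> A i"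
      by (intro bexI[of _ "(x - g, i)"]) (auto simp: algebra_simps)
  qed
  show ?thesis using *[of L g] *[of "{(x, i). (x + g, i) \<in> L}" "-g"] by auto
qed

lemma packing_shift: "packing A L \<Longrightarrow> packing A {(x, i). (x + g, i) \<in> L}"
  unfolding packing_def
proof (intro allI impI, goal_cases)
  case (1 x i y j p)
  have "x + g = y + g \<and> i = j"
    using 1(2-5) by (intro 1(1)[rule_format, of "x + g" i "y + g" j "p + g"]) simp_all
  then show ?case by simp
qed

locale prototiles =
  fixes A :: "'k::finite \<Rightarrow> (real ^ 'n::finite) set"
  assumes supports: "prototile_supports A"
begin

lemma A_nonempty: "A i \<noteq> {}" and A_compact: "compact (A i)" and A_closure: "closure (interior (A i)) = A i"
  using supports by (auto simp: prototile_supports_def)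

text \<open>A nonempty compact set is not its own translate by z \<noteq> 0: the maximum over it of
  the linear functional given by \<open>z\<close> would grow by z \<bullet> z.\<close>

lemma tile_inj: "tile A x i = tile A y j \<longleftrightarrow> x = y \<and> i = j"
proof
  assume eq: "tile A x i = tile A y j"
  then have ij: "i = j" using snd_tile by metis
  have im: "(+) x ` A i = (+) y ` A i" using eq fst_tile ij by metis
  define z where "z = x - y"
  have "continuous_on (A i) (\<lambda>b. z \<bullet> b)" by (intro continuous_intros)
  then obtain a where a: "a \<in> A i" "\<And>b. b \<in> A i \<Longrightarrow> z \<bullet> b \<le> z \<bullet> a"
    using continuous_attains_sup[OF A_compact A_nonempty] by blast
  have "x + a \<in> (+) y ` A i" using a(1) im by blast
  then have "z + a \<in> A i" by (auto simp: z_def algebra_simps)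
  then have "z \<bullet> (z + a) \<le> z \<bullet> a" by (rule a(2))
  then have "z \<bullet> z \<le> 0" by (simp add: inner_add_right)
  then have "z = 0" using inner_ge_zero[of z] inner_eq_zero_iff[of z] by linarith
  then show "x = y \<and> i = j" using ij by (simp add: z_def)
qed simp

lemma tilings_byI:
  assumes "covering A L" "packing A L"
  shows "tiles_of A L \<in> tilings_by A" "coloured_set A (tiles_of A L) = L"
proof -
  show "coloured_set A (tiles_of A L) = L"
  proof (rule set_eqI, clarify)
    fix x i
    show "(x, i) \<in> coloured_set A (tiles_of A L) \<longleftrightarrow> (x, i) \<in> L"
      by (simp add: mem_coloured_set tile_inj tiles_of_def)
  qed
  have "(\<Union>t\<in>tiles_of A L. fst t) = UNIV"
  proof -
    have "p \<in> (\<Union>t\<in>tiles_of A L. fst t)" for p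
    proof -
      obtain x i where "(x, i) \<in> L" "p - x \<in> A i" using assms(1) unfolding covering_def by blast
      then have "tile A x i \<in> tiles_of A L" "p \<in> fst (tile A x i)"
        by (auto simp: tiles_of_def fst_tile mem_translation_iff)
      then show ?thesis by blast
    qed
    then show ?thesis by blast
  qed
  moreover have "pairwise (\<lambda>s t. interior (fst s) \<inter> interior (fst t) = {}) (tiles_of A L)"
    unfolding pairwise_def
  proof (intro ballI impI)
    fix s t assume "s \<in> tiles_of A L" "t \<in> tiles_of A L" "s \<noteq> t"
    then obtain x i y j where st: "s = tile A x i" "t = tile A y j"
      and *: "(x, i) \<in> L" "(y, j) \<in> L" "tile A x i \<noteq> tile A y j" unfolding tiles_of_def by blast
    have False if "p \<in> interior ((+) x ` A i)" "p \<in> interior ((+) y ` A j)" for p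
    proof -
      have "x = y \<and> i = j" using assms(2) * that unfolding packing_def mem_interior_translation by blast
      then show False using * by simp
    qed
    then show "interior (fst s) \<inter> interior (fst t) = {}" unfolding st fst_tile by blast
  qed
  ultimately show "tiles_of A L \<in> tilings_by A"
    unfolding tilings_by_def tiling_def tiles_of_def tile_def by blast
qed

lemma tilings_byD:
  assumes "S \<in> tilings_by A"
  shows "covering A (coloured_set A S)" "packing A (coloured_set A S)"
    "S = tiles_of A (coloured_set A S)"
proof -
  have S: "\<Union>(fst ` S) = UNIV" "pairwise (\<lambda>s t. interior (fst s) \<inter> interior (fst t) = {}) S"
    "\<And>t. t \<in> S \<Longrightarrow> \<exists>x i. t = tile A x i"
    using assms unfolding tilings_by_def tiling_def tile_def by blast+
  show "covering A (coloured_set A S)" unfolding covering_def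
  proof
    fix p
    obtain t where t: "t \<in> S" "p \<in> fst t" using S(1) by blast
    then obtain x i where "t = tile A x i" using S(3) by blast
    then show "\<exists>(x, i)\<in>coloured_set A S. p - x \<in> A i"
      using t by (intro bexI[of _ "(x, i)"]) (auto simp: mem_coloured_set fst_tile)
  qed
  show "packing A (coloured_set A S)" unfolding packing_def
  proof (intro allI impI)
    fix x i y j p
    assume *: "(x, i) \<in> coloured_set A S" "(y, j) \<in> coloured_set A S"
      "p - x \<in> interior (A i)" "p - y \<in> interior (A j)"
    have "tile A x i = tile A y j"
    proof (rule ccontr)
      assume "tile A x i \<noteq> tile A y j"
      then have "interior (fst (tile A x i)) \<inter> interior (fst (tile A y j)) = {}"
        using S(2) * unfolding pairwise_def mem_coloured_set by blast
      moreover have "p \<in> interior (fst (tile A x i))" "p \<in> interior (fst (tile A y j))"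
        using * by (simp_all add: fst_tile mem_interior_translation)
      ultimately show False by blast
    qed
    then show "x = y \<and> i = j" by (simp add: tile_inj)
  qed
  show "S = tiles_of A (coloured_set A S)"
    using S(3) unfolding tiles_of_def mem_coloured_set by blast
qed

lemma coloured_set_inj: "S \<in> tilings_by A \<Longrightarrow> S' \<in> tilings_by A \<Longrightarrow> coloured_set A S = coloured_set A S' \<Longrightarrow> S = S'"
  using tilings_byD(3) by metis

lemma tiling_shift_in:
  assumes "S \<in> tilings_by A" shows "tiling_shift g S \<in> tilings_by A"
proof -
  let ?L = "{(x, i). (x + g, i) \<in> coloured_set A S}"
  have "tiling_shift g S = tiles_of A ?L"
  proof -
    have "t \<in> tiling_shift g S \<longleftrightarrow> t \<in> tiles_of A ?L" for t
    proof
      assume "t \<in> tiling_shift g S"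
      then obtain s where s: "s \<in> S" "t = translate_tile (-g) s" unfolding tiling_shift_def by blast
      then obtain x i where "s = tile A x i" "(x, i) \<in> coloured_set A S"
        using tilings_byD(3)[OF assms] unfolding tiles_of_def by blast
      with s have "t = translate_tile (-g) (tile A x i)" "(x, i) \<in> coloured_set A S" by simp_all
      then have "t = tile A (x - g) i" "(x - g, i) \<in> ?L" by (simp_all add: translate_tile)
      then show "t \<in> tiles_of A ?L" unfolding tiles_of_def by blast
    next
      assume "t \<in> tiles_of A ?L"
      then obtain x i where "t = tile A x i" "(x + g, i) \<in> coloured_set A S" unfolding tiles_of_def by blast
      then have "t = translate_tile (-g) (tile A (x + g) i)" "tile A (x + g) i \<in> S"
        by (simp_all add: translate_tile mem_coloured_set)
      then show "t \<in> tiling_shift g S" unfolding tiling_shift_def by blast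
    qed
    then show ?thesis by blast
  qed
  moreover have "covering A ?L" "packing A ?L"
    using tilings_byD[OF assms] by (simp_all add: covering_shift packing_shift)
  ultimately show ?thesis using tilings_byI by metis
qed

subsection \<open>Separation and local finiteness\<close>

lemma inradius:
  obtains r a where "r > 0" "\<And>i. ball (a i) r \<subseteq> interior (A i)"
proof -
  have "\<exists>a r. r > 0 \<and> ball a r \<subseteq> interior (A i)" for i
  proof -
    have "interior (A i) \<noteq> {}" using A_closure[of i] A_nonempty[of i] by (metis closure_empty)
    then show ?thesis by (metis ex_in_conv open_contains_ball open_interior)
  qed
  then obtain a r where ar: "\<And>i. r i > 0 \<and> ball (a i) (r i) \<subseteq> interior (A i)" by metis
  define s where "s = Min (range r)"
  have "s > 0" "\<And>i. s \<le> r i" using ar by (auto simp: s_def)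
  have "ball (a i) s \<subseteq> interior (A i)" for i
    using ar[of i] subset_ball[OF \<open>s \<le> r i\<close>, of "a i"] by blast
  with \<open>s > 0\<close> show thesis by (rule that)
qed

lemma outradius:
  obtains R where "R > 0" "\<And>i x. x \<in> A i \<Longrightarrow> norm x \<le> R"
proof -
  have "bounded (\<Union>i. A i)" using A_compact by (intro bounded_UN) (auto simp: compact_imp_bounded)
  then show thesis using that by (auto simp: bounded_pos)
qed

text \<open>A common inradius of all prototiles, fixed once so that it can serve as a
  constant.\<close>

definition sep :: real where
  "sep = (SOME r. r > 0 \<and> (\<exists>a. \<forall>i. ball (a i) r \<subseteq> interior (A i)))"

lemma sep: "sep > 0" "\<exists>a. \<forall>i. ball (a i) sep \<subseteq> interior (A i)"
proof -
  have "\<exists>r. r > 0 \<and> (\<exists>a. \<forall>i. ball (a i) r \<subseteq> interior (A i))" using inradius by metis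
  from someI_ex[OF this] show "sep > 0" "\<exists>a. \<forall>i. ball (a i) sep \<subseteq> interior (A i)"
    by (auto simp: sep_def)
qed

text \<open>If two tiles of one type are closer than the common inradius, the centre of the inner
  ball of one lies in the interior of both.\<close>

lemma separated:
  assumes "packing A L" "(x, i) \<in> L" "(y, i) \<in> L" "norm (x - y) < sep" shows "x = y"
proof -
  obtain a where a: "\<And>i. ball (a i) sep \<subseteq> interior (A i)" using sep by blast
  have "a i \<in> ball (a i) sep" "a i + (x - y) \<in> ball (a i) sep"
    using assms sep(1) by (auto simp: dist_norm norm_minus_commute)
  then have "x + a i - x \<in> interior (A i)" "x + a i - y \<in> interior (A i)"
    using a[of i] by (auto simp: algebra_simps)
  then show ?thesis using assms unfolding packing_def by blast
qed

lemma locally_finite: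
  fixes L :: "((real ^ 'n) \<times> 'k) set"
  assumes sepL: "\<And>x y i. (x, i) \<in> L \<Longrightarrow> (y, i) \<in> L \<Longrightarrow> norm (x - y) < sep \<Longrightarrow> x = y"
  shows "finite {(x, i) \<in> L. norm x \<le> r}"
proof -
  have "finite {x. (x, i) \<in> L \<and> norm x \<le> r}" for i
  proof -
    let ?X = "{x. (x, i) \<in> L \<and> norm x \<le> r}"
    have u: "uniform_discrete ?X"
      using sep(1) sepL by (intro uniformI1[of sep]) (auto simp: dist_norm)
    have "bounded ?X" by (auto simp: bounded_iff)
    moreover have "closed ?X" using u by (rule uniform_discrete_imp_closed)
    ultimately have "compact ?X" by (simp add: compact_eq_bounded_closed)
    then show ?thesis using uniform_discrete_imp_discrete[OF u] discrete_compact_finite_iff by blast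
  qed
  then have "finite (\<Union>i. (\<lambda>x. (x, i)) ` {x. (x, i) \<in> L \<and> norm x \<le> r})" by auto
  moreover have "{(x, i) \<in> L. norm x \<le> r} \<subseteq> (\<Union>i. (\<lambda>x. (x, i)) ` {x. (x, i) \<in> L \<and> norm x \<le> r})" by auto
  ultimately show ?thesis by (rule rev_finite_subset)
qed

subsection \<open>The tiling metric\<close>

lemma tiling_dist_altdef:
  "tiling_dist A S S' = Inf (insert (2 powr (-1/2))
     {e. e > 0 \<and> near e (coloured_set A S) (coloured_set A S') \<and> near e (coloured_set A S') (coloured_set A S)})"
proof -
  have "coloured_restrict (1/e) L \<subseteq> coloured_thicken e L' \<longleftrightarrow> near e L L'" for e and L L' :: "((real^'n) \<times> 'k) set"
  proof -
    have "(x, i) \<in> coloured_thicken e L' \<longleftrightarrow> (\<exists>y. (y, i) \<in> L' \<and> norm (x - y) < e)" for x i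
    proof
      assume "\<exists>y. (y, i) \<in> L' \<and> norm (x - y) < e"
      then obtain y where "(y, i) \<in> L'" "norm (x - y) < e" by blast
      then show "(x, i) \<in> coloured_thicken e L'" unfolding coloured_thicken_def mem_Collect_eq
        by (intro exI[of _ y] exI[of _ "x - y"] exI[of _ i]) auto
    qed (auto simp: coloured_thicken_def)
    then show ?thesis by (auto simp: near_def coloured_restrict_def subset_iff)
  qed
  then show ?thesis unfolding tiling_dist_def by (metis (no_types, lifting))
qed

lemma near_mono:
  assumes "near e L L'" "0 < e" "e \<le> e'" shows "near e' L L'"
  unfolding near_def
proof (intro allI impI)
  fix x i assume x: "(x, i) \<in> L" "norm x < 1/e'"
  have "1/e' \<le> 1/e" using assms by (simp add: frac_le)
  then show "\<exists>y. (y, i) \<in> L' \<and> norm (x - y) < e'" using nearD[OF assms(1) x(1)] x(2) assms(3) by fastforce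
qed

definition cap :: real where "cap = 2 powr (-1/2)"

lemma cap: "0 < cap" "cap * cap = 1/2" "cap < 1"
proof -
  show "0 < cap" by (simp add: cap_def)
  show c2: "cap * cap = 1/2" unfolding cap_def powr_add[symmetric] by (simp add: powr_minus_divide)
  show "cap < 1" using c2 \<open>0 < cap\<close> mult_mono[of 1 cap 1 cap] by (cases "1 \<le> cap") auto
qed

text \<open>For e \<le> cap the value inserted into the set cannot be what brings the infimum below
  \<open>e\<close>, so a genuine witness smaller than \<open>e\<close> exists.\<close>

lemma tiling_dist_less:
  assumes "tiling_dist A S S' < e" "e \<le> cap"
  shows "near e (coloured_set A S) (coloured_set A S')" "near e (coloured_set A S') (coloured_set A S)"
proof -
  obtain e' where "e' \<in> insert cap {e. e > 0 \<and> near e (coloured_set A S) (coloured_set A S') \<and> near e (coloured_set A S') (coloured_set A S)}"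
    "e' < e"
    using cInf_lessD[OF _ assms(1)[unfolded tiling_dist_altdef]] by (auto simp: cap_def)
  then show "near e (coloured_set A S) (coloured_set A S')" "near e (coloured_set A S') (coloured_set A S)"
    using assms(2) near_mono by fastforce+
qed

lemma tiling_dist_bdd: "bdd_below (insert (2 powr (-1/2)) {e::real. e > 0 \<and> P e})"
  by (rule bdd_belowI[of _ 0]) auto

lemma tiling_dist_le:
  assumes "0 < e" "near e (coloured_set A S) (coloured_set A S')" "near e (coloured_set A S') (coloured_set A S)"
  shows "tiling_dist A S S' \<le> e"
  unfolding tiling_dist_altdef by (rule cInf_lower[OF _ tiling_dist_bdd]) (use assms in auto)

lemma tiling_dist_le_cap: "tiling_dist A S S' \<le> cap"
  unfolding tiling_dist_altdef by (rule cInf_lower[OF _ tiling_dist_bdd]) (auto simp: cap_def)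

lemma tiling_dist_nonneg: "0 \<le> tiling_dist A S S'"
  unfolding tiling_dist_altdef by (rule cInf_greatest) auto

lemma tiling_dist_commute: "tiling_dist A S S' = tiling_dist A S' S"
  unfolding tiling_dist_altdef by (simp add: conj_commute)

text \<open>The cap \<open>2 powr (-1/2)\<close> is what makes the triangle inequality hold: it gives
  \<open>b * (a + b) \<le> 1\<close>.\<close>

lemma near_trans:
  assumes "near a L1 L2" "near b L2 L3" "0 < a" "0 < b" "a \<le> cap" "b \<le> cap"
  shows "near (a + b) L1 L3"
  unfolding near_def
proof (intro allI impI)
  fix x i assume x: "(x, i) \<in> L1" "norm x < 1/(a+b)"
  have "1/(a+b) < 1/a" using assms by (simp add: frac_less2)
  then obtain y where y: "(y, i) \<in> L2" "norm (x - y) < a" using nearD[OF assms(1) x(1)] x(2) by auto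
  have "b * (a + b) \<le> cap * (cap + cap)" using assms by (intro mult_mono add_mono) auto
  also have "\<dots> = 1" using cap by (simp add: distrib_left)
  finally have "b * (a + b) \<le> 1" .
  then have "a \<le> a / (b * (a + b))" using assms by (simp add: le_divide_eq)
  also have "\<dots> = 1/b - 1/(a+b)" using assms by (simp add: field_simps)
  finally have "1/(a+b) + a \<le> 1/b" by simp
  moreover have "norm y \<le> norm x + norm (x - y)" by (metis norm_minus_commute norm_triangle_sub)
  ultimately have "norm y < 1/b" using x(2) y(2) by linarith
  then obtain z where z: "(z, i) \<in> L3" "norm (y - z) < b" using nearD[OF assms(2) y(1)] by auto
  have "norm (x - z) < a + b" using y(2) z(2) norm_triangle_ineq[of "x - y" "y - z"] by simp
  then show "\<exists>y. (y, i) \<in> L3 \<and> norm (x - y) < a + b" using z by blast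
qed

text \<open>A point of \<open>L\<close> is a limit of points of \<open>L'\<close> of its colour.
  Separation allows only one such point nearby, so the approximation is already exact.\<close>

lemma near_all_subset:
  assumes L': "packing A L'" and n: "\<And>e. 0 < e \<Longrightarrow> e < d \<Longrightarrow> near e L L'" and d: "0 < d"
  shows "L \<subseteq> L'"
proof clarify
  fix x i assume x: "(x, i) \<in> L"
  \<comment> \<open>The three terms ensure that \<open>n\<close> applies, that any two approximants
    of \<open>x\<close> are closer than \<open>sep\<close>, and that \<open>x\<close> lies in the
    window of radius 1/f.\<close>
  define f where "f = min (min (d/2) (sep/2)) (1/(norm x + 1))"
  have f: "0 < f" "f < d" "f \<le> sep/2" "f \<le> 1/(norm x + 1)" using d sep
    by (auto simp: f_def add_nonneg_pos)
  have close: "\<exists>y. (y, i) \<in> L' \<and> norm (x - y) < e" if e: "0 < e" "e \<le> f" for e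
  proof -
    have "norm x < norm x + 1" by simp
    also have "\<dots> \<le> 1/f" using f(1) frac_le[of 1 1 f "1/(norm x + 1)"] f(4) by simp
    also have "\<dots> \<le> 1/e" using e f(1) by (simp add: frac_le)
    finally show ?thesis using nearD[OF n x] e f by auto
  qed
  obtain y where y: "(y, i) \<in> L'" "norm (x - y) < f" using close[of f] f by auto
  have "norm (x - y) = 0"
  proof (rule ccontr)
    assume nz: "norm (x - y) \<noteq> 0"
    obtain z where z: "(z, i) \<in> L'" "norm (x - z) < norm (x - y)"
      using close[of "norm (x - y)"] nz y by auto
    have "norm (y - z) \<le> norm (x - y) + norm (x - z)"
      using norm_triangle_ineq4[of "x - z" "x - y"] by simp
    then have "norm (y - z) < sep" using y(2) z(2) f by linarith
    then show False using separated[OF L' y(1) z(1)] z(2) by simp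
  qed
  then show "(x, i) \<in> L'" using y by simp
qed

lemma tiling_metric: "Metric_space (tilings_by A) (tiling_dist A)"
proof
  fix S S' S'' assume S: "S \<in> tilings_by A" "S' \<in> tilings_by A"
  show "tiling_dist A S S' = 0 \<longleftrightarrow> S = S'"
  proof
    assume 0: "tiling_dist A S S' = 0"
    have "near e (coloured_set A S) (coloured_set A S')" "near e (coloured_set A S') (coloured_set A S)"
      if "0 < e" "e < cap" for e using tiling_dist_less[of S S' e] that 0 by auto
    then have "coloured_set A S = coloured_set A S'"
      using near_all_subset[OF tilings_byD(2)[OF S(2)] _ cap(1), of "coloured_set A S"]
        near_all_subset[OF tilings_byD(2)[OF S(1)] _ cap(1), of "coloured_set A S'"] by blast
    then show "S = S'" using coloured_set_inj S by blast
  next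
    assume "S = S'"
    have n: "near e L L" if "0 < e" for e and L :: "((real^'n) \<times> 'k) set" using that by (auto simp: near_def)
    have le: "tiling_dist A S S \<le> e" if "0 < e" for e using that by (intro tiling_dist_le n)
    have "tiling_dist A S S \<le> 0"
    proof (rule field_le_epsilon)
      fix e :: real assume "0 < e"
      then show "tiling_dist A S S \<le> 0 + e" using le[of e] by simp
    qed
    then show "tiling_dist A S S' = 0" using tiling_dist_nonneg[of S S] \<open>S = S'\<close> by simp
  qed
  show "tiling_dist A S S'' \<le> tiling_dist A S S' + tiling_dist A S' S''"
  proof (rule field_le_epsilon)
    fix e :: real assume e: "0 < e"
    define a where "a = tiling_dist A S S' + e/2"
    define b where "b = tiling_dist A S' S'' + e/2"
    have ab: "0 < a" "0 < b" using e tiling_dist_nonneg by (simp_all add: a_def b_def add_nonneg_pos)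
    have "tiling_dist A S S'' \<le> a + b"
    proof (cases "a \<le> cap \<and> b \<le> cap")
      case True
      have "tiling_dist A S S' < a" "tiling_dist A S' S'' < b" using e by (simp_all add: a_def b_def)
      with True have n: "near a (coloured_set A S) (coloured_set A S')" "near a (coloured_set A S') (coloured_set A S)"
        "near b (coloured_set A S') (coloured_set A S'')" "near b (coloured_set A S'') (coloured_set A S')"
        by (blast intro: tiling_dist_less)+
      show ?thesis
      proof (rule tiling_dist_le)
        show "0 < a + b" using ab by simp
        show "near (a + b) (coloured_set A S) (coloured_set A S'')"
          using near_trans[OF n(1,3)] ab True by blast
        show "near (a + b) (coloured_set A S'') (coloured_set A S)"
          using near_trans[OF n(4,2)] ab True by (simp add: add.commute)
      qed
    next
      case False
      then show ?thesis using tiling_dist_le_cap[of S S''] ab by linarith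
    qed
    then show "tiling_dist A S S'' \<le> tiling_dist A S S' + tiling_dist A S' S'' + e"
      by (simp add: a_def b_def)
  qed
qed (rule tiling_dist_nonneg tiling_dist_commute)+

lemma tiling_dist_less_near:
  assumes "0 < e" "near e (coloured_set A S) (coloured_set A S')" "near e (coloured_set A S') (coloured_set A S)" "e < e'"
  shows "tiling_dist A S S' < e'"
  using tiling_dist_le[OF assms(1-3)] assms(4) by linarith

subsection \<open>Compactness\<close>

text \<open>The lower Kuratowski limit, taken colour by colour.\<close>

definition limit_set :: "(nat \<Rightarrow> ((real ^ 'n) \<times> 'k) set) \<Rightarrow> ((real ^ 'n) \<times> 'k) set" where
  "limit_set L = {(x, i). \<forall>e>0. eventually (\<lambda>n. \<exists>y. (y, i) \<in> L n \<and> norm (x - y) < e) sequentially}"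

lemma limit_setD:
  "(x, i) \<in> limit_set L \<Longrightarrow> 0 < e \<Longrightarrow> eventually (\<lambda>n. \<exists>y. (y, i) \<in> L n \<and> norm (x - y) < e) sequentially"
  by (auto simp: limit_set_def)

text \<open>Interiors are open, so a common interior point of two limit tiles is still common to
  their approximants in some \<open>L n\<close>. These coincide, and the limits are then arbitrarily
  close.\<close>

lemma packing_limit_set:
  assumes L: "\<And>n. packing A (L n)" shows "packing A (limit_set L)"
  unfolding packing_def
proof (intro allI impI)
  fix x i y j p
  assume xy: "(x, i) \<in> limit_set L" "(y, j) \<in> limit_set L"
    and p: "p - x \<in> interior (A i)" "p - y \<in> interior (A j)"
  obtain r where r: "r > 0" "ball (p - x) r \<subseteq> interior (A i)" "ball (p - y) r \<subseteq> interior (A j)"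
  proof -
    obtain r1 r2 where "r1 > 0" "ball (p - x) r1 \<subseteq> interior (A i)" "r2 > 0" "ball (p - y) r2 \<subseteq> interior (A j)"
      using p open_contains_ball open_interior by meson
    then show thesis by (intro that[of "min r1 r2"]) auto
  qed
  have eq: "i = j \<and> norm (x - y) \<le> 2 * e" if e: "0 < e" "e \<le> r" for e
  proof -
    have "eventually (\<lambda>n. (\<exists>z. (z, i) \<in> L n \<and> norm (x - z) < e) \<and> (\<exists>z. (z, j) \<in> L n \<and> norm (y - z) < e)) sequentially"
      using limit_setD[OF xy(1) e(1)] limit_setD[OF xy(2) e(1)] by (rule eventually_conj)
    then obtain n where "(\<exists>z. (z, i) \<in> L n \<and> norm (x - z) < e) \<and> (\<exists>z. (z, j) \<in> L n \<and> norm (y - z) < e)"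
      using eventually_happens trivial_limit_sequentially by blast
    then obtain z w where z: "(z, i) \<in> L n" "norm (x - z) < e" and w: "(w, j) \<in> L n" "norm (y - w) < e" by blast
    have "p - z \<in> ball (p - x) r" "p - w \<in> ball (p - y) r"
      using z(2) w(2) e by (simp_all add: dist_norm norm_minus_commute)
    then have "p - z \<in> interior (A i)" "p - w \<in> interior (A j)" using r by blast+
    then have "z = w \<and> i = j" using L[of n] z(1) w(1) unfolding packing_def by blast
    then show ?thesis using norm_triangle_ineq4[of "x - z" "y - w"] z(2) w(2) by simp
  qed
  have "norm (x - y) \<le> 0"
  proof (rule field_le_epsilon)
    fix e :: real assume e: "0 < e"
    show "norm (x - y) \<le> 0 + e" using eq[of "min r (e/2)"] r(1) e min.cobounded2[of r "e/2"] by simp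
  qed
  then show "x = y \<and> i = j" using eq[of r] r(1) by simp
qed

lemma packing_locally_finite:
  "packing A L \<Longrightarrow> finite {(x, i) \<in> L. norm x \<le> r}"
  by (rule locally_finite) (rule separated)

text \<open>Tiles of \<open>L\<close> come arbitrarily close to \<open>p\<close>, and only the
  finitely many in \<open>F\<close> can do so. A finite union of compact supports is closed, hence
  contains \<open>p\<close>.\<close>

lemma covering_limit:
  assumes L: "packing A L" and S: "\<And>n. covering A (S n)"
    and n: "\<And>e. 0 < e \<Longrightarrow> e < cap \<Longrightarrow> \<exists>n. near e (S n) L"
  shows "covering A L"
  unfolding covering_def
proof
  fix p :: "real ^ 'n"
  obtain R where R: "R > 0" "\<And>i x. x \<in> A i \<Longrightarrow> norm x \<le> R" using outradius by blast
  \<comment> \<open>\<open>R\<close> bounds the supports, and the extra 1 allows for the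
    displacement between matched tiles, which is below \<open>cap\<close> and thus below 1.\<close>
  define F where "F = {(x, i) \<in> L. norm x \<le> norm p + R + 1}"
  have F: "finite F" unfolding F_def by (rule packing_locally_finite[OF L])
  have approx: "\<exists>(z, i)\<in>F. \<exists>a\<in>A i. norm (p - z - a) < e" if e: "0 < e" for e
  proof -
    define f where "f = min (min e (cap/2)) (1/(norm p + R + 1))"
    have f: "0 < f" "f \<le> e" "f < cap" "f \<le> 1/(norm p + R + 1)"
      using e cap R by (auto simp: f_def add_nonneg_pos)
    obtain n where n: "near f (S n) L" using n f by blast
    obtain x i where x: "(x, i) \<in> S n" "p - x \<in> A i" using S[of n] unfolding covering_def by blast
    have nx: "norm x \<le> norm p + R" using R(2)[OF x(2)] norm_triangle_ineq4[of p "p - x"] by simp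
    have pos: "0 < norm p + R + 1" using R by (simp add: add_nonneg_pos)
    have "norm p + R + 1 \<le> 1/f" using frac_le[of 1 1 f "1/(norm p + R + 1)"] f by simp
    then obtain z where z: "(z, i) \<in> L" "norm (x - z) < f" using nearD[OF n x(1)] nx by auto
    have "norm z \<le> norm x + norm (x - z)" by (metis norm_minus_commute norm_triangle_sub)
    then have "(z, i) \<in> F" using z f cap nx by (auto simp: F_def)
    moreover have "norm (p - z - (p - x)) < e" using z f by simp
    ultimately show ?thesis using x(2) by blast
  qed
  have "\<exists>(z, i)\<in>F. p - z \<in> A i"
  proof (rule ccontr)
    assume "\<not> ?thesis"
    then have no: "p - z \<notin> A i" if "(z, i) \<in> F" for z i using that by blast
    have "\<exists>e>0. \<forall>a\<in>A i. e \<le> norm (p - z - a)" if zi: "(z, i) \<in> F" for z i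
    proof -
      have "closed (A i)" by (rule compact_imp_closed[OF A_compact])
      then obtain e where "e > 0" "\<And>a. a \<in> A i \<Longrightarrow> e \<le> dist (p - z) a"
        using no[OF zi] separate_point_closed by metis
      then show ?thesis by (auto simp: dist_norm)
    qed
    then obtain e where e: "\<And>z i. (z, i) \<in> F \<Longrightarrow> e (z, i) > 0"
      "\<And>z i a. (z, i) \<in> F \<Longrightarrow> a \<in> A i \<Longrightarrow> e (z, i) \<le> norm (p - z - a)"
      by (metis old.prod.case)
    define m where "m = Min (insert 1 (e ` F))"
    have "m > 0" "\<And>z i. (z, i) \<in> F \<Longrightarrow> m \<le> e (z, i)" using e(1) F by (auto simp: m_def)
    then show False using approx[of m] e(2) by (fastforce dest: order_trans)
  qed
  then show "\<exists>(x, i)\<in>L. p - x \<in> A i" by (auto simp: F_def)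
qed

sublocale TM: Metric_space "tilings_by A" "tiling_dist A" by (rule tiling_metric)

text \<open>Inside a window each tile of a late member is followed by a unique nearby tile in all
  later members, and these positions converge. \<open>limit_set\<close> collects the limits.\<close>

lemma tilings_complete: "TM.mcomplete"
  unfolding TM.mcomplete_def
proof (intro allI impI)
  fix \<sigma> assume "TM.MCauchy \<sigma>"
  then have \<sigma>: "\<And>n. \<sigma> n \<in> tilings_by A"
    and C: "\<And>e. e > 0 \<Longrightarrow> \<exists>N. \<forall>n n'. N \<le> n \<longrightarrow> N \<le> n' \<longrightarrow> tiling_dist A (\<sigma> n) (\<sigma> n') < e"
    unfolding TM.MCauchy_def by auto
  define S where "S n = coloured_set A (\<sigma> n)" for n
  have S: "covering A (S n)" "packing A (S n)" for n using tilings_byD[OF \<sigma>] by (simp_all add: S_def)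
  have C': "\<exists>N. \<forall>n\<ge>N. \<forall>n'\<ge>N. near e (S n) (S n')" if e: "0 < e" "e \<le> cap" for e
    using C[OF e(1)] tiling_dist_less(1)[OF _ e(2)] unfolding S_def by blast
  define L where "L = limit_set S"
  have pL: "packing A L" unfolding L_def by (rule packing_limit_set) (rule S)
  \<comment> \<open>The bound sep/4 makes the tile that follows a given one unique: two candidates
    are less than 2 * e apart, which is below \<open>sep\<close>.\<close>
  have conv: "\<exists>N. \<forall>n\<ge>N. near e (S n) L \<and> near e L (S n)"
    if e: "0 < e" "e \<le> cap" "e \<le> sep/4" for e
  proof -
    have e2: "0 < e/2" "e/2 \<le> cap" using e by auto
    obtain N where N: "\<And>n n'. n \<ge> N \<Longrightarrow> n' \<ge> N \<Longrightarrow> near (e/2) (S n) (S n')" using C'[OF e2] by blast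
    have "near e L (S n)" if n: "n \<ge> N" for n
      unfolding near_def
    proof (intro allI impI)
      fix x i assume x: "(x, i) \<in> L" "norm x < 1/e"
      have "eventually (\<lambda>m. (\<exists>y. (y, i) \<in> S m \<and> norm (x - y) < e/2) \<and> m \<ge> N) sequentially"
        using limit_setD[OF x(1)[unfolded L_def] e2(1)] eventually_ge_at_top by (rule eventually_conj)
      then obtain m where "(\<exists>y. (y, i) \<in> S m \<and> norm (x - y) < e/2) \<and> m \<ge> N"
        using eventually_happens trivial_limit_sequentially by blast
      then obtain y where m: "m \<ge> N" and y: "(y, i) \<in> S m" "norm (x - y) < e/2" by blast
      have "norm y \<le> norm x + norm (x - y)" by (metis norm_minus_commute norm_triangle_sub)
      \<comment> \<open>Passing from \<open>e\<close> to e/2 doubles the radius of the window, which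
        leaves room for the move from \<open>x\<close> to \<open>y\<close>.\<close>
      moreover have "e * e \<le> 1" using e(1,2) cap mult_mono[of e cap e cap] by simp
      then have "1/e + e/2 \<le> 1/(e/2)" using e by (simp add: field_simps)
      ultimately have "norm y < 1/(e/2)" using x(2) y(2) by linarith
      then obtain z where "(z, i) \<in> S n" "norm (y - z) < e/2" using nearD[OF N[OF m n] y(1)] by blast
      then show "\<exists>z. (z, i) \<in> S n \<and> norm (x - z) < e"
        using y(2) norm_triangle_ineq[of "x - y" "y - z"] by (intro exI[of _ z]) auto
    qed
    moreover have "near e (S n) L" if n: "n \<ge> N" for n
      unfolding near_def
    proof (intro allI impI)
      fix x i assume x: "(x, i) \<in> S n" "norm x < 1/e"
      have "1/e \<le> 1/(e/2)" using e by (simp add: field_simps)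
      then have "\<exists>y. (y, i) \<in> S m \<and> norm (x - y) < e/2" if "m \<ge> N" for m
        using nearD[OF N[OF n that] x(1)] x(2) by auto
      then obtain y where y: "\<And>m. m \<ge> N \<Longrightarrow> (y m, i) \<in> S m" "\<And>m. m \<ge> N \<Longrightarrow> norm (x - y m) < e/2" by metis
      define z where "z m = y (m + N)" for m
      have z: "(z m, i) \<in> S (m + N)" "norm (x - z m) < e/2" for m using y[of "m + N"] by (simp_all add: z_def)
      have zb: "norm (z m) \<le> norm x + 1" for m
      proof -
        have "norm (z m) \<le> norm x + norm (x - z m)" by (metis norm_minus_commute norm_triangle_sub)
        then show ?thesis using z(2)[of m] e(2) cap by linarith
      qed
      \<comment> \<open>\<open>near\<close> only provides some \<open>w\<close> close to
        \<open>z m\<close>. Separation identifies it with \<open>z m'\<close>, so the chosen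
        positions themselves are close.\<close>
      have cau: "\<exists>K. \<forall>m\<ge>K. \<forall>m'\<ge>K. norm (z m - z m') < f" if f: "0 < f" for f
      proof -
        define g where "g = min (min f e) (1/(norm x + 2))"
        have g: "0 < g" "g \<le> f" "g \<le> e" "g \<le> 1/(norm x + 2)" using f e by (auto simp: g_def add_nonneg_pos)
        obtain K where K: "\<And>n n'. n \<ge> K \<Longrightarrow> n' \<ge> K \<Longrightarrow> near g (S n) (S n')" using C'[of g] g e by auto
        have "norm (z m - z m') < f" if m: "m \<ge> K" "m' \<ge> K" for m m'
        proof -
          have "norm x + 2 \<le> 1/g" using frac_le[of 1 1 g "1/(norm x + 2)"] g by simp
          then have "norm (z m) < 1/g" using zb[of m] by linarith
          then obtain w where w: "(w, i) \<in> S (m' + N)" "norm (z m - w) < g"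
            using nearD[OF K z(1)[of m], of "m' + N"] m by auto
          have "norm (w - z m') \<le> norm (z m - w) + norm (x - z m) + norm (x - z m')"
            using norm_triangle_ineq4[of "x - z m'" "x - z m + (z m - w)"] norm_triangle_ineq[of "x - z m" "z m - w"] by simp
          also have "\<dots> < sep" using w(2) z(2)[of m] z(2)[of m'] g e sep by linarith
          finally have "w = z m'" using separated[OF S(2) w(1) z(1)[of m']] by blast
          then show ?thesis using w g by simp
        qed
        then show ?thesis by blast
      qed
      then have "Cauchy z" unfolding Cauchy_def dist_norm by blast
      then obtain l where l: "z \<longlonglongrightarrow> l" using Cauchy_convergent convergent_def by metis
      have "(l, i) \<in> L" unfolding L_def limit_set_def
      proof (clarify)
        fix f :: real assume "0 < f"
        then have "eventually (\<lambda>m. dist (z m) l < f) sequentially" using l by (simp add: tendsto_iff)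
        then obtain K where K: "\<And>m. m \<ge> K \<Longrightarrow> dist (z m) l < f" by (auto simp: eventually_sequentially)
        show "eventually (\<lambda>n. \<exists>y. (y, i) \<in> S n \<and> norm (l - y) < f) sequentially"
          unfolding eventually_sequentially
        proof (rule exI[of _ "K + N"], intro allI impI)
          fix n assume n: "K + N \<le> n"
          then have "(z (n - N), i) \<in> S n" "norm (l - z (n - N)) < f"
            using z(1)[of "n - N"] K[of "n - N"] by (simp_all add: dist_norm norm_minus_commute)
          then show "\<exists>y. (y, i) \<in> S n \<and> norm (l - y) < f" by blast
        qed
      qed
      moreover have "norm (x - l) \<le> e/2"
      proof -
        have "(\<lambda>m. norm (x - z m)) \<longlonglongrightarrow> norm (x - l)" by (intro tendsto_intros l)
        then show ?thesis by (rule LIMSEQ_le_const2) (use z(2) less_imp_le in blast)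
      qed
      then have "norm (x - l) < e" using e by simp
      ultimately show "\<exists>y. (y, i) \<in> L \<and> norm (x - y) < e" by blast
    qed
    ultimately show ?thesis by blast
  qed
  have conv': "\<exists>N. \<forall>n\<ge>N. near e (S n) L \<and> near e L (S n)" if e: "0 < e" for e
  proof -
    define f where "f = min (min e cap) (sep/4)"
    have f: "0 < f" "f \<le> cap" "f \<le> sep/4" "f \<le> e" using e cap sep by (auto simp: f_def)
    show ?thesis using conv[OF f(1,2,3)] near_mono[OF _ f(1,4)] by blast
  qed
  have "\<exists>n. near e (S n) L" if "0 < e" for e using conv'[OF that] by blast
  then have cL: "covering A L" by (rule covering_limit[OF pL S(1)])
  have "limitin TM.mtopology \<sigma> (tiles_of A L) sequentially"
    unfolding TM.limitin_metric
  proof (intro conjI allI impI)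
    show "tiles_of A L \<in> tilings_by A" by (rule tilings_byI[OF cL pL])
    fix e :: real assume e: "0 < e"
    then obtain N where "\<And>n. n \<ge> N \<Longrightarrow> near (e/2) (S n) L \<and> near (e/2) L (S n)" using conv'[of "e/2"] by auto
    then have "\<sigma> n \<in> tilings_by A \<and> tiling_dist A (\<sigma> n) (tiles_of A L) < e" if "n \<ge> N" for n
      using \<sigma> that e by (auto simp: S_def tilings_byI(2)[OF cL pL] intro!: tiling_dist_less_near[of "e/2"])
    then show "eventually (\<lambda>n. \<sigma> n \<in> tilings_by A \<and> tiling_dist A (\<sigma> n) (tiles_of A L) < e) sequentially"
      by (auto simp: eventually_sequentially)
  qed
  then show "\<exists>x. limitin TM.mtopology \<sigma> x sequentially" by blast
qed

text \<open>Finite resolution stands in for finite local complexity: record which points of a finite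
  net of the window have a position of which type within f/2. There are finitely many records, and
  tilings with equal records are \<open>near\<close> each other.\<close>

lemma tilings_totally_bounded: "TM.mtotally_bounded (tilings_by A)"
  unfolding TM.mtotally_bounded_def
proof (intro allI impI)
  fix e :: real assume e: "0 < e"
  define f where "f = e/2"
  have f: "0 < f" "f < e" using e by (auto simp: f_def)
  have "compact (cball 0 (1/f) :: (real^'n) set)" by simp
  then obtain C where C: "finite C" "cball 0 (1/f) \<subseteq> (\<Union>c\<in>C. ball (c :: real^'n) (f/2))"
    using f by (metis compact_eq_totally_bounded half_gt_zero)
  define pat where "pat S = {(c, i). c \<in> C \<and> (\<exists>x. (x, i) \<in> coloured_set A S \<and> norm (x - c) < f/2)}" for S
  have "pat ` tilings_by A \<subseteq> Pow (C \<times> UNIV)" by (auto simp: pat_def)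
  then have fin: "finite (pat ` tilings_by A)" by (rule finite_subset) (simp add: C(1))
  then obtain K where K: "finite K" "K \<subseteq> tilings_by A" "pat ` tilings_by A = pat ` K"
    using finite_subset_image[OF fin subset_refl] by metis
  have close: "near f (coloured_set A S) (coloured_set A S')" if "pat S = pat S'" for S S'
    unfolding near_def
  proof (intro allI impI)
    fix x i assume x: "(x, i) \<in> coloured_set A S" "norm x < 1/f"
    then obtain c where c: "c \<in> C" "norm (x - c) < f/2" using C(2) by (force simp: dist_norm norm_minus_commute)
    then have "(c, i) \<in> pat S'" using x unfolding that[symmetric] by (auto simp: pat_def)
    then obtain y where y: "(y, i) \<in> coloured_set A S'" "norm (y - c) < f/2" by (auto simp: pat_def)
    then have "norm (x - y) < f" using c(2) norm_triangle_ineq4[of "x - c" "y - c"] by simp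
    then show "\<exists>y. (y, i) \<in> coloured_set A S' \<and> norm (x - y) < f" using y by blast
  qed
  have "tilings_by A \<subseteq> (\<Union>x\<in>K. TM.mball x e)"
  proof
    fix S assume S: "S \<in> tilings_by A"
    then obtain S' where "S' \<in> K" "pat S = pat S'" using K(3) by blast
    moreover have "tiling_dist A S' S < e"
      using close \<open>pat S = pat S'\<close> f by (intro tiling_dist_less_near[of f]) simp_all
    ultimately show "S \<in> (\<Union>x\<in>K. TM.mball x e)" using S K(2) by auto
  qed
  then show "\<exists>K. finite K \<and> K \<subseteq> tilings_by A \<and> tilings_by A \<subseteq> (\<Union>x\<in>K. TM.mball x e)" using K by blast
qed

lemma tilings_compact: "compact_space TM.mtopology"
  using TM.compact_space_eq_mcomplete_mtotally_bounded tilings_complete tilings_totally_bounded by blast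

subsection \<open>The translation action\<close>

lemma near_shift:
  assumes n: "near e (coloured_set A S) (coloured_set A S')" and e: "e \<le> e'" "1/e' + norm g \<le> 1/e"
  shows "near e' (coloured_set A (tiling_shift g S)) (coloured_set A (tiling_shift g S'))"
  unfolding near_def coloured_set_shift
proof (intro allI impI)
  fix x i assume x: "(x + g, i) \<in> coloured_set A S" "norm x < 1/e'"
  have "norm (x + g) < 1/e" using x(2) e(2) norm_triangle_ineq[of x g] by linarith
  then obtain y where y: "(y, i) \<in> coloured_set A S'" "norm (x + g - y) < e" using nearD[OF n x(1)] by blast
  then show "\<exists>y. (y + g, i) \<in> coloured_set A S' \<and> norm (x - y) < e'"
    using e by (intro exI[of _ "y - g"]) (auto simp: algebra_simps)
qed

lemma tiling_dist_shift:
  assumes e: "0 < e"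
  shows "\<exists>d>0. \<forall>S S'. tiling_dist A S S' < d \<longrightarrow> tiling_dist A (tiling_shift g S) (tiling_shift g S') < e"
proof -
  define f where "f = e/2"
  \<comment> \<open>The window of radius 1/d still contains the window of radius 1/f after a
    translation by \<open>g\<close>; the term \<open>cap\<close> makes
    \<open>tiling_dist_less\<close> applicable.\<close>
  define d where "d = min (min f cap) (1/(1/f + norm g))"
  have f: "0 < f" "f < e" using e by (auto simp: f_def)
  have d: "0 < d" "d \<le> f" "d \<le> cap" "d \<le> 1/(1/f + norm g)" using f cap by (auto simp: d_def add_pos_nonneg)
  have "1/f + norm g \<le> 1/d" using frac_le[of 1 1 d "1/(1/f + norm g)"] d by simp
  then have "tiling_dist A (tiling_shift g S) (tiling_shift g S') < e" if "tiling_dist A S S' < d" for S S'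
    using tiling_dist_less[OF that d(3)] d f by (intro tiling_dist_less_near[of f] near_shift[of d])
  then show ?thesis using d(1) by blast
qed

lemma tiling_dist_shift_le:
  assumes "norm (g - h) < e"
  shows "tiling_dist A (tiling_shift g S) (tiling_shift h S) \<le> e"
proof -
  have *: "near e (coloured_set A (tiling_shift g S)) (coloured_set A (tiling_shift h S))"
    if "norm (g - h) < e" for g h
    unfolding near_def coloured_set_shift
    using that by (auto intro!: exI[of _ "_ + g - h"] simp: norm_minus_commute)
  have "0 < e" using assms norm_ge_zero le_less_trans by blast
  then show ?thesis using * assms by (intro tiling_dist_le) (auto simp: norm_minus_commute)
qed

lemma tiling_shift_continuous: "continuous_map TM.mtopology TM.mtopology (tiling_shift g)"
  unfolding TM.continuous_map_to_metric
proof (intro ballI allI impI)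
  fix S and e :: real assume S: "S \<in> topspace TM.mtopology" and e: "0 < e"
  then have S: "S \<in> tilings_by A" by simp
  obtain d where d: "d > 0" "\<And>S S'. tiling_dist A S S' < d \<Longrightarrow> tiling_dist A (tiling_shift g S) (tiling_shift g S') < e"
    using tiling_dist_shift[OF e] by blast
  show "\<exists>U. openin TM.mtopology U \<and> S \<in> U \<and> (\<forall>y\<in>U. tiling_shift g y \<in> TM.mball (tiling_shift g S) e)"
    using S d tiling_shift_in by (intro exI[of _ "TM.mball S d"]) auto
qed

end

section \<open>Powers of a contraction\<close>

text \<open>The vector p(N) v, computed by Horner's scheme. Evaluation at a vector keeps the
  argument away from an algebra of operators.\<close>

definition poly_apply :: "(complex ^ 'n \<Rightarrow> complex ^ 'n) \<Rightarrow> complex poly \<Rightarrow> complex ^ 'n \<Rightarrow> complex ^ 'n" where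
  "poly_apply N p v = fold_coeffs (\<lambda>a w. a *s v + N w) p 0"

locale complex_operator =
  fixes N :: "complex ^ 'n \<Rightarrow> complex ^ 'n"
  assumes N_add: "N (v + w) = N v + N w" and N_scale: "N (c *s v) = c *s N v"
begin

lemma N_0: "N 0 = 0" using N_scale[of 0 0] by simp

lemma N_diff: "N (v - w) = N v - N w"
  using N_add[of "v - w" w] by (simp add: algebra_simps)

lemma poly_apply_0: "poly_apply N 0 v = 0"
  by (simp add: poly_apply_def)

lemma poly_apply_pCons: "poly_apply N (pCons a p) v = a *s v + N (poly_apply N p v)"
  by (cases "p = 0 \<and> a = 0") (auto simp: poly_apply_def N_0)

lemma poly_apply_add: "poly_apply N (p + q) v = poly_apply N p v + poly_apply N q v"
proof (induction p q rule: poly_induct2)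
  case (pCons a p b q)
  then show ?case by (simp add: poly_apply_pCons N_add vec.scale_left_distrib)
qed (simp add: poly_apply_0)

lemma poly_apply_smult: "poly_apply N (smult c p) v = c *s poly_apply N p v"
  by (induction p) (simp_all add: poly_apply_0 poly_apply_pCons N_scale vec.scale_right_distrib)

lemma poly_apply_N: "poly_apply N p (N v) = N (poly_apply N p v)"
  by (induction p) (simp_all add: poly_apply_0 poly_apply_pCons N_add N_scale N_0)

lemma poly_apply_arg: "poly_apply N p (v - c *s w) = poly_apply N p v - c *s poly_apply N p w"
proof (induction p)
  case (pCons a p)
  have "c *s (a *s w) = a *s (c *s w)" by (rule vec.scale_left_commute)
  then show ?case
    by (simp only: poly_apply_pCons pCons.IH N_diff N_scale vec.scale_right_diff_distrib vec.scale_right_distrib) simp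
qed (simp add: poly_apply_0)

lemma poly_apply_linear_factor: "poly_apply N ([:-l, 1:] * q) v = poly_apply N q (N v - l *s v)"
proof -
  have "[:-l, 1:] * q = smult (-l) q + pCons 0 q" by simp
  then have "poly_apply N ([:-l, 1:] * q) v = (-l) *s poly_apply N q v + N (poly_apply N q v)"
    by (simp only: poly_apply_add poly_apply_smult poly_apply_pCons) simp
  then show ?thesis by (simp add: poly_apply_arg poly_apply_N)
qed

lemma poly_apply_monom: "poly_apply N (monom a k) v = a *s (N ^^ k) v"
  by (induction k) (simp_all add: monom_0 monom_Suc poly_apply_pCons poly_apply_0 N_0 N_scale)

lemma poly_apply_sum: "poly_apply N (\<Sum>i\<in>I. f i) v = (\<Sum>i\<in>I. poly_apply N (f i) v)"
  by (induction I rule: infinite_finite_induct) (simp_all add: poly_apply_0 poly_apply_add)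

text \<open>More iterates of \<open>v\<close> than the real dimension are linearly dependent over
  the reals. Dependence is a property of sets and does not see repeated iterates, so a repetition is
  a case of its own.\<close>

lemma annihilating_poly: "\<exists>p. p \<noteq> 0 \<and> poly_apply N p v = 0"
proof -
  define d where "d = DIM(complex ^ 'n)"
  define f where "f k = (N ^^ k) v" for k
  show ?thesis
  proof (cases "inj_on f {..d}")
    case False
    then obtain i j where ij: "f i = f j" "i \<noteq> j" by (auto simp: inj_on_def)
    have "poly_apply N (monom 1 i + smult (-1) (monom 1 j)) v = 0"
      unfolding poly_apply_add poly_apply_smult poly_apply_monom using ij by (simp add: f_def)
    moreover have "coeff (monom 1 i + smult (-1) (monom 1 j)) i = (1 :: complex)" using ij by simp
    then have "monom 1 i + smult (-1) (monom 1 j) \<noteq> (0 :: complex poly)" by (metis coeff_0 zero_neq_one)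
    ultimately show ?thesis by blast
  next
    case True
    have "card (f ` {..d}) > DIM(complex ^ 'n)" using card_image[OF True] by (simp add: d_def)
    then have "dependent (f ` {..d})" by (intro dependent_biggerset) auto
    then obtain u where u: "\<exists>x\<in>f ` {..d}. u x \<noteq> 0" "(\<Sum>x\<in>f ` {..d}. u x *\<^sub>R x) = 0"
      using dependent_finite[of "f ` {..d}"] by auto
    define p where "p = (\<Sum>k\<le>d. monom (complex_of_real (u (f k))) k)"
    have "poly_apply N p v = (\<Sum>k\<le>d. u (f k) *\<^sub>R f k)"
      unfolding p_def poly_apply_sum poly_apply_monom f_def
      by (intro sum.cong refl) (simp add: vec_eq_iff scaleR_conv_of_real[where 'a=complex])
    also have "\<dots> = 0" using u(2) sum.reindex[OF True, of "\<lambda>x. u x *\<^sub>R x"] by simp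
    finally have "poly_apply N p v = 0" .
    obtain k where k: "k \<le> d" "u (f k) \<noteq> 0" using u(1) by auto
    have "coeff p k = (\<Sum>j\<le>d. if j = k then complex_of_real (u (f j)) else 0)" by (simp add: p_def coeff_sum)
    also have "\<dots> = complex_of_real (u (f k))" using k by simp
    finally have "p \<noteq> 0" using k by auto
    with \<open>poly_apply N p v = 0\<close> show ?thesis by blast
  qed
qed

text \<open>The sequence satisfies x (n + 1) = l x n + y n with y tending to 0. Boundedness comes
  first; after that, old contributions decay geometrically and late errors sum to a small
  amount.\<close>

lemma recurrence_tendsto_0:
  fixes x :: "nat \<Rightarrow> complex ^ 'n"
  assumes y: "(\<lambda>n. x (Suc n) - l *s x n) \<longlonglongrightarrow> 0" and l: "cmod l < 1"
  shows "x \<longlonglongrightarrow> 0"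
proof -
  have ns: "norm (l *s w) = cmod l * norm w" for w :: "complex ^ 'n"
    by (simp add: norm_vec_def norm_mult L2_set_right_distrib)
  obtain b where b: "b > 0" "\<And>n. norm (x (Suc n) - l *s x n) \<le> b"
    using convergent_imp_Bseq[OF convergentI[OF y]] by (auto simp: Bseq_def)
  \<comment> \<open>Chosen so that b + cmod l * c \<le> c, which makes the bound \<open>c\<close>
    reproduce itself.\<close>
  define c where "c = max (norm (x 0)) (b / (1 - cmod l))"
  have xb: "norm (x n) \<le> c" for n
  proof (induction n)
    case (Suc n)
    have "norm (x (Suc n)) \<le> norm (x (Suc n) - l *s x n) + cmod l * norm (x n)"
      using norm_triangle_ineq[of "x (Suc n) - l *s x n" "l *s x n"] by (simp add: ns)
    also have "\<dots> \<le> b + cmod l * c" using b(2) Suc by (intro add_mono mult_left_mono) auto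
    also have "b \<le> (1 - cmod l) * c"
      using l pos_divide_le_eq[of "1 - cmod l" b c] by (simp add: c_def mult.commute)
    finally show ?case by (simp add: algebra_simps)
  qed (simp add: c_def)
  show ?thesis
  proof (rule tendstoI)
    fix e :: real assume e: "0 < e"
    \<comment> \<open>Chosen so that e/2 is the fixed point of t \<mapsto> f + cmod l * t.\<close>
    define f where "f = (1 - cmod l) * (e/2)"
    have f: "0 < f" using l e by (simp add: f_def)
    have "eventually (\<lambda>n. norm (x (Suc n) - l *s x n) < f) sequentially"
      using y f by (simp add: tendsto_iff)
    then obtain K where K: "\<And>n. n \<ge> K \<Longrightarrow> norm (x (Suc n) - l *s x n) < f" by (auto simp: eventually_sequentially)
    have dec: "norm (x (K + n)) \<le> e/2 + cmod l ^ n * c" for n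
    proof (induction n)
      case 0 then show ?case using xb[of K] e by simp
    next
      case (Suc n)
      have "norm (x (Suc (K + n))) \<le> norm (x (Suc (K + n)) - l *s x (K + n)) + cmod l * norm (x (K + n))"
        using norm_triangle_ineq[of "x (Suc (K + n)) - l *s x (K + n)" "l *s x (K + n)"] by (simp add: ns)
      also have "\<dots> \<le> f + cmod l * (e/2 + cmod l ^ n * c)"
        using K[of "K + n"] Suc by (intro add_mono mult_left_mono) auto
      also have "\<dots> = e/2 + cmod l ^ Suc n * c" by (simp add: f_def field_simps)
      finally show ?case by simp
    qed
    have "(\<lambda>n. cmod l ^ n * c) \<longlonglongrightarrow> 0 * c" using l by (intro tendsto_intros LIMSEQ_power_zero) simp
    then have "eventually (\<lambda>n. cmod l ^ n * c < e/2) sequentially" using e by (intro order_tendstoD(2)) auto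
    then obtain J where J: "\<And>n. n \<ge> J \<Longrightarrow> cmod l ^ n * c < e/2" by (auto simp: eventually_sequentially)
    show "eventually (\<lambda>n. dist (x n) 0 < e) sequentially"
      unfolding eventually_sequentially
    proof (rule exI[of _ "K + J"], intro allI impI)
      fix n assume "K + J \<le> n"
      then have "J \<le> n - K" "K + (n - K) = n" by auto
      then show "dist (x n) 0 < e" using dec[of "n - K"] J[of "n - K"] by simp
    qed
  qed
qed

lemma power_commute: "(N ^^ k) (N v) = N ((N ^^ k) v)"
  by (metis funpow_swap1)

lemma power_diff: "(N ^^ k) (v - c *s w) = (N ^^ k) v - c *s (N ^^ k) w"
  by (induction k) (simp_all add: N_diff N_scale)

text \<open>Split an annihilating polynomial of \<open>v\<close> into linear factors \<open>N - l\<close>; a factor with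
  \<open>|l| \<ge> 1\<close> is injective and can be cancelled.\<close>

lemma powers_tendsto_0:
  assumes ev: "\<And>l v. v \<noteq> 0 \<Longrightarrow> N v = l *s v \<Longrightarrow> cmod l < 1"
  shows "(\<lambda>n. (N ^^ n) v) \<longlonglongrightarrow> 0"
proof -
  have "p \<noteq> 0 \<Longrightarrow> poly_apply N p v = 0 \<Longrightarrow> (\<lambda>n. (N ^^ n) v) \<longlonglongrightarrow> 0" for p v
  proof (induction "degree p" arbitrary: p v rule: less_induct)
    case less
    show ?case
    proof (cases "degree p = 0")
      case True
      then obtain a where "p = [:a:]" by (rule degree_eq_zeroE)
      then have "a \<noteq> 0" "a *s v = 0" using less.prems by (auto simp: poly_apply_pCons poly_apply_0 N_0)
      then have "v = 0" by simp
      moreover have "(N ^^ n) 0 = 0" for n by (induction n) (simp_all add: N_0)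
      ultimately show ?thesis by simp
    next
      case False
      then obtain l where "poly p l = 0"
        using fundamental_theorem_of_algebra[of p] constant_degree[of p] by auto
      then obtain q where q: "p = [:-l, 1:] * q" by (metis dvd_def poly_eq_0_iff_dvd)
      have q0: "q \<noteq> 0" using q less.prems by auto
      have "degree p = degree [:-l, 1:] + degree q" unfolding q by (rule degree_mult_eq) (use q0 in auto)
      then have dq: "degree q < degree p" by simp
      have qa: "poly_apply N q (N v - l *s v) = 0" using less.prems(2) unfolding q poly_apply_linear_factor .
      show ?thesis
      proof (cases "cmod l < 1")
        case True
        have "(\<lambda>n. (N ^^ n) (N v - l *s v)) \<longlonglongrightarrow> 0" by (rule less.hyps[OF dq q0 qa])
        then have "(\<lambda>n. (N ^^ Suc n) v - l *s (N ^^ n) v) \<longlonglongrightarrow> 0"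
          by (simp add: power_diff power_commute)
        then show ?thesis using True by (rule recurrence_tendsto_0)
      next
        case False
        have "N (poly_apply N q v) = l *s poly_apply N q v"
          using qa by (simp add: poly_apply_arg poly_apply_N)
        then have "poly_apply N q v = 0" using ev False by blast
        then show ?thesis by (rule less.hyps[OF dq q0])
      qed
    qed
  qed
  then show ?thesis using annihilating_poly[of v] by blast
qed

end

section \<open>Inverse of an expansive map\<close>

text \<open>The eigenvalues of the inverse of the complexified matrix are the reciprocals of the
  original ones, so their moduli are below 1 and the powers tend to 0 pointwise. Real vectors embed
  isometrically, and the real inverse inherits the convergence.\<close>

lemma expansive_inverse:
  fixes Q :: "real ^ 'n \<Rightarrow> real ^ 'n"
  assumes Q: "expansive Q"
  obtains P where "linear P" "\<And>v. P (Q v) = v" "\<And>v. Q (P v) = v"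
    "\<And>e. 0 < e \<Longrightarrow> \<exists>K. \<forall>k\<ge>K. \<forall>v. norm ((P ^^ k) v) \<le> e * norm v"
proof -
  have lin: "linear Q" using Q by (simp add: expansive_def)
  define B where "B = map_matrix complex_of_real (matrix Q)"
  define emb where "emb v = (\<chi> i. complex_of_real (v $ i))" for v :: "real ^ 'n"
  have ev: "cmod c > 1" if "v \<noteq> 0" "B *v v = c *s v" for c v using Q that unfolding expansive_def B_def by blast
  have norm_emb: "norm (emb v) = norm v" for v by (simp add: norm_vec_def emb_def)
  have B_emb: "B *v emb v = emb (Q v)" for v
  proof -
    have "Q v = matrix Q *v v" using lin by (simp add: matrix_works)
    then show ?thesis by (simp add: vec_eq_iff B_def emb_def matrix_vector_mult_def)
  qed
  \<comment> \<open>A nonzero kernel vector would be an eigenvector for 0, and expansiveness would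
    give 0 > 1.\<close>
  have Binj: "v = 0" if "B *v v = 0" for v using ev[of v 0] that by fastforce
  then obtain C where C: "C ** B = mat 1" using matrix_left_invertible_ker[of B] by blast
  then have C': "B ** C = mat 1" using matrix_left_right_inverse by blast
  interpret N: complex_operator "(*v) C"
    by unfold_locales (rule matrix_vector_right_distrib, rule vector_scalar_commute)
  have N_small: "(\<lambda>n. (((*v) C) ^^ n) v) \<longlonglongrightarrow> 0" for v
  proof (rule N.powers_tendsto_0)
    fix l v assume v: "v \<noteq> 0" "C *v v = l *s v"
    have BC: "B *v (C *v v) = v" using C' by (simp add: matrix_vector_mul_assoc)
    then have lB: "l *s (B *v v) = v" unfolding v(2) vector_scalar_commute .
    then have l0: "l \<noteq> 0" using v(1) by auto
    have "(1/l) *s v = (1/l) *s (l *s (B *v v))" unfolding lB ..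
    also have "\<dots> = B *v v" using l0 by (simp add: vector_smult_assoc)
    finally have "B *v v = (1/l) *s v" ..
    then have "cmod (1/l) > 1" using ev v(1) by blast
    then show "cmod l < 1" using l0 by (simp add: norm_divide field_simps)
  qed
  have "inj Q"
  proof -
    have "v = 0" if "Q v = 0" for v
    proof -
      have "B *v emb v = 0" using B_emb[of v] that by (simp add: emb_def vec_eq_iff)
      then have "norm (emb v) = 0" using Binj by simp
      then show ?thesis by (simp add: norm_emb)
    qed
    then show ?thesis using linear_injective_0[OF lin] by blast
  qed
  then obtain P where P: "linear P" "\<And>v. P (Q v) = v" "\<And>v. Q (P v) = v"
    using linear_injective_isomorphism[OF lin] by blast
  have CP: "C *v emb v = emb (P v)" for v
  proof -
    have "C *v emb v = C *v (B *v emb (P v))" by (simp only: B_emb P(3))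
    also have "\<dots> = emb (P v)" by (simp only: matrix_vector_mul_assoc C matrix_vector_mul_lid)
    finally show ?thesis .
  qed
  have CPk: "(((*v) C) ^^ k) (emb v) = emb ((P ^^ k) v)" for k v by (induction k) (simp_all add: CP)
  have P0: "(\<lambda>k. norm ((P ^^ k) v)) \<longlonglongrightarrow> 0" for v
    using tendsto_norm[OF N_small[of "emb v"]] by (simp add: CPk norm_emb)
  have linP: "linear (P ^^ k)" for k
  proof (induction k)
    case 0 show ?case by (simp add: linear_iff)
  next
    case (Suc k) show ?case using linear_compose[OF Suc P(1)] by (simp add: o_def)
  qed
  \<comment> \<open>Evaluation on a basis turns pointwise convergence of the powers into an estimate
    uniform in \<open>v\<close>.\<close>
  have bound: "norm ((P ^^ k) v) \<le> (\<Sum>b\<in>Basis. norm ((P ^^ k) b)) * norm v" for k v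
  proof -
    have "(P ^^ k) v = (P ^^ k) (\<Sum>b\<in>Basis. (v \<bullet> b) *\<^sub>R b)" by (simp add: euclidean_representation)
    also have "\<dots> = (\<Sum>b\<in>Basis. (v \<bullet> b) *\<^sub>R (P ^^ k) b)"
      by (simp only: linear_sum[OF linP] linear_cmul[OF linP])
    also have "norm \<dots> \<le> (\<Sum>b\<in>Basis. norm ((v \<bullet> b) *\<^sub>R (P ^^ k) b))" by (rule norm_sum)
    also have "\<dots> \<le> (\<Sum>b\<in>Basis. norm v * norm ((P ^^ k) b))"
      by (intro sum_mono) (auto intro!: mult_right_mono Basis_le_norm)
    finally show ?thesis by (simp add: sum_distrib_left mult.commute)
  qed
  show thesis
  proof (rule that[OF P])
    fix e :: real assume e: "0 < e"
    have "(\<lambda>k. \<Sum>b\<in>Basis. norm ((P ^^ k) b)) \<longlonglongrightarrow> (\<Sum>b\<in>(Basis :: (real^'n) set). 0)"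
      by (intro tendsto_sum P0)
    then have "eventually (\<lambda>k. (\<Sum>b\<in>Basis. norm ((P ^^ k) b)) < e) sequentially"
      using e by (intro order_tendstoD(2)) auto
    then obtain K where "\<And>k. k \<ge> K \<Longrightarrow> (\<Sum>b\<in>Basis. norm ((P ^^ k) b)) < e" by (auto simp: eventually_sequentially)
    then have "norm ((P ^^ k) v) \<le> e * norm v" if "k \<ge> K" for k v
      using bound[of k v] that mult_right_mono[of "\<Sum>b\<in>Basis. norm ((P ^^ k) b)" e "norm v"]
      by (meson less_imp_le norm_ge_zero order_trans)
    then show "\<exists>K. \<forall>k\<ge>K. \<forall>v. norm ((P ^^ k) v) \<le> e * norm v" by blast
  qed
qed

section \<open>Linear maps scale Lebesgue measure by a constant\<close>

lemma nn_integral_lborel_translation: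
  fixes f :: "'a::euclidean_space \<Rightarrow> ennreal"
  assumes [measurable]: "f \<in> borel_measurable borel"
  shows "(\<integral>\<^sup>+x. f (a + x) \<partial>lborel) = (\<integral>\<^sup>+x. f x \<partial>lborel)"
proof -
  have "(\<integral>\<^sup>+x. f x \<partial>lborel) = (\<integral>\<^sup>+x. f x \<partial>distr lborel borel ((+) a))" by (simp add: lborel_distr_plus)
  also have "\<dots> = (\<integral>\<^sup>+x. f (a + x) \<partial>lborel)" by (rule nn_integral_distr) auto
  finally show ?thesis ..
qed

lemma nn_integral_lborel_reflection:
  fixes f :: "'a::euclidean_space \<Rightarrow> ennreal"
  assumes [measurable]: "f \<in> borel_measurable borel"
  shows "(\<integral>\<^sup>+x. f (a - x) \<partial>lborel) = (\<integral>\<^sup>+x. f x \<partial>lborel)"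
proof -
  have "lborel = density (distr lborel borel (\<lambda>x. a + (-1) *\<^sub>R x)) (\<lambda>_. \<bar>-1::real\<bar> ^ DIM('a))"
    by (rule lborel_affine) simp
  then have "lborel = distr lborel borel (\<lambda>x. a - x)" by (simp add: density_1)
  then have "(\<integral>\<^sup>+x. f x \<partial>lborel) = (\<integral>\<^sup>+x. f x \<partial>distr lborel borel (\<lambda>x. a - x))" by simp
  also have "\<dots> = (\<integral>\<^sup>+x. f (a - x) \<partial>lborel)" by (rule nn_integral_distr) auto
  finally show ?thesis ..
qed

text \<open>Uniqueness of translation invariant measures by Tonelli: both sides are
  \<open>\<integral>\<integral> f (x + y) g y d\<nu> dx\<close>.\<close>

lemma translation_invariant_unique:
  fixes f g :: "'a::euclidean_space \<Rightarrow> ennreal" and \<nu> :: "'a measure"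
  assumes [measurable]: "f \<in> borel_measurable borel" "g \<in> borel_measurable borel"
    and \<nu>: "sets \<nu> = sets borel" "sigma_finite_measure \<nu>"
    and inv: "\<And>h a. h \<in> borel_measurable borel \<Longrightarrow> (\<integral>\<^sup>+x. h (a + x) \<partial>\<nu>) = (\<integral>\<^sup>+x. (h x :: ennreal) \<partial>\<nu>)"
  shows "(\<integral>\<^sup>+x. f x \<partial>lborel) * (\<integral>\<^sup>+y. g y \<partial>\<nu>) = (\<integral>\<^sup>+y. f y \<partial>\<nu>) * (\<integral>\<^sup>+x. g x \<partial>lborel)"
proof -
  interpret \<nu>: sigma_finite_measure \<nu> by (rule \<nu>)
  interpret P: pair_sigma_finite lborel \<nu> ..
  note [measurable_cong] = \<nu>(1)
  have "(\<integral>\<^sup>+x. f x \<partial>lborel) * (\<integral>\<^sup>+y. g y \<partial>\<nu>) = (\<integral>\<^sup>+y. (\<integral>\<^sup>+x. f (y + x) \<partial>lborel) * g y \<partial>\<nu>)"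
    by (simp add: nn_integral_lborel_translation nn_integral_cmult)
  also have "\<dots> = (\<integral>\<^sup>+y. (\<integral>\<^sup>+x. f (y + x) * g y \<partial>lborel) \<partial>\<nu>)"
    by (simp add: nn_integral_multc)
  also have "\<dots> = (\<integral>\<^sup>+x. (\<integral>\<^sup>+y. f (y + x) * g y \<partial>\<nu>) \<partial>lborel)"
    by (rule P.Fubini') measurable
  also have "\<dots> = (\<integral>\<^sup>+x. (\<integral>\<^sup>+y. f y * g (y - x) \<partial>\<nu>) \<partial>lborel)"
  proof (rule nn_integral_cong)
    fix x
    show "(\<integral>\<^sup>+y. f (y + x) * g y \<partial>\<nu>) = (\<integral>\<^sup>+y. f y * g (y - x) \<partial>\<nu>)"
      using inv[of "\<lambda>y. f y * g (y - x)" x] by (simp add: add.commute)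
  qed
  also have "\<dots> = (\<integral>\<^sup>+y. (\<integral>\<^sup>+x. f y * g (y - x) \<partial>lborel) \<partial>\<nu>)"
    by (rule P.Fubini'[symmetric]) measurable
  also have "\<dots> = (\<integral>\<^sup>+y. f y * (\<integral>\<^sup>+x. g x \<partial>lborel) \<partial>\<nu>)"
    by (simp add: nn_integral_cmult nn_integral_lborel_reflection)
  also have "\<dots> = (\<integral>\<^sup>+y. f y \<partial>\<nu>) * (\<integral>\<^sup>+x. g x \<partial>lborel)"
    by (simp add: nn_integral_multc)
  finally show ?thesis .
qed

lemma open_measure_pos:
  fixes U :: "'a::euclidean_space set"
  assumes "open U" "bounded U" "U \<noteq> {}"
  shows "measure lborel U > 0"
proof -
  have "emeasure lborel U \<noteq> 0"
  proof
    assume "emeasure lborel U = 0"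
    then have "U \<in> null_sets lborel" using assms(1) by (simp add: null_sets_def)
    then have "negligible U" unfolding negligible_iff_null_sets by (rule null_sets_completionI)
    then show False using open_not_negligible assms by blast
  qed
  then show ?thesis using emeasure_bounded_finite[OF assms(2)]
    by (simp add: measure_def enn2real_positive_iff zero_less_iff_neq_zero)
qed

lemma linear_image_measure:
  fixes Q P :: "'a::euclidean_space \<Rightarrow> 'a"
  assumes lin: "linear Q" "linear P" and inv: "\<And>v. P (Q v) = v" "\<And>v. Q (P v) = v"
  obtains q :: real where "q > 0"
    "\<And>S. S \<in> sets borel \<Longrightarrow> Q ` S \<in> sets borel"
    "\<And>S. S \<in> sets borel \<Longrightarrow> measure lborel (Q ` S) = q * measure lborel S"
proof -
  have im: "Q ` S = P -` S" for S
  proof (rule set_eqI)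
    fix x show "x \<in> Q ` S \<longleftrightarrow> x \<in> P -` S" using inv(1) inv(2)[of x] by (auto intro: image_eqI[of x Q "P x"])
  qed
  have mQ: "Q \<in> borel_measurable borel" and mP[measurable]: "P \<in> borel_measurable borel"
    using lin linear_continuous_on linear_conv_bounded_linear by (auto intro!: borel_measurable_continuous_onI)
  have bor: "Q ` S \<in> sets borel" if "S \<in> sets borel" for S
    using measurable_sets[OF mP that] by (simp add: im)
  define \<nu> where "\<nu> = distr lborel borel P"
  have em: "emeasure \<nu> S = emeasure lborel (Q ` S)" if "S \<in> sets borel" for S
    using that by (simp add: \<nu>_def emeasure_distr im)
  have bddim: "bounded (Q ` S)" if "bounded S" for S
    using that lin bounded_linear_image linear_conv_bounded_linear by blast
  have sf: "sigma_finite_measure \<nu>"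
  proof
    have "emeasure \<nu> (ball 0 (real n)) \<noteq> \<infinity>" for n
      using em[of "ball 0 (real n)"] emeasure_bounded_finite[OF bddim[OF bounded_ball[of 0 "real n"]]] by auto
    moreover have "(\<Union>n. ball 0 (real n)) = (UNIV :: 'a set)"
      using reals_Archimedean2 by (auto simp: dist_norm)
    ultimately show "\<exists>A. countable A \<and> A \<subseteq> sets \<nu> \<and> \<Union>A = space \<nu> \<and> (\<forall>a\<in>A. emeasure \<nu> a \<noteq> \<infinity>)"
      by (intro exI[of _ "range (\<lambda>n. ball 0 (real n))"]) (auto simp: \<nu>_def)
  qed
  have tr: "(\<integral>\<^sup>+x. h (a + x) \<partial>\<nu>) = (\<integral>\<^sup>+x. h x \<partial>\<nu>)" if [measurable]: "h \<in> borel_measurable borel"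
    for h :: "'a \<Rightarrow> ennreal" and a
  proof -
    have "(\<integral>\<^sup>+x. h (a + x) \<partial>\<nu>) = (\<integral>\<^sup>+x. h (P (Q a + x)) \<partial>lborel)"
      unfolding \<nu>_def using lin inv by (subst nn_integral_distr) (auto simp: linear_add)
    also have "\<dots> = (\<integral>\<^sup>+x. h (P x) \<partial>lborel)"
      by (rule nn_integral_lborel_translation[where f="\<lambda>x. h (P x)"]) measurable
    also have "\<dots> = (\<integral>\<^sup>+x. h x \<partial>\<nu>)" unfolding \<nu>_def by (subst nn_integral_distr) auto
    finally show ?thesis .
  qed
  define B where "B = (ball 0 1 :: 'a set)"
  have eq: "emeasure lborel S * emeasure lborel (Q ` B) = emeasure lborel (Q ` S) * emeasure lborel B"
    if [measurable]: "S \<in> sets borel" for S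
  proof -
    have [measurable]: "B \<in> sets borel" by (simp add: B_def)
    have s: "sets \<nu> = sets borel" by (simp add: \<nu>_def)
    have "(\<integral>\<^sup>+x. indicator S x \<partial>lborel) * (\<integral>\<^sup>+y. indicator B y \<partial>\<nu>)
      = (\<integral>\<^sup>+y. indicator S y \<partial>\<nu>) * (\<integral>\<^sup>+x. indicator B x \<partial>lborel)"
      by (rule translation_invariant_unique[OF _ _ s sf]) (use tr in auto)
    then show ?thesis using s em[of S] em[of B] by (subst (asm) (1 2 3 4) nn_integral_indicator) auto
  qed
  have Bopen: "open (Q ` B)"
  proof -
    have "continuous_on UNIV P" using lin by (simp add: linear_continuous_on linear_conv_bounded_linear)
    then show ?thesis unfolding im B_def by (simp add: open_vimage)
  qed
  define q where "q = measure lborel (Q ` B) / measure lborel B"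
  have Bpos: "measure lborel B > 0" "measure lborel (Q ` B) > 0"
    using open_measure_pos[of B] open_measure_pos[OF Bopen] bddim[of B] by (auto simp: B_def)
  show thesis
  proof (rule that[of q])
    show "q > 0" using Bpos by (simp add: q_def)
    show "measure lborel (Q ` S) = q * measure lborel S" if "S \<in> sets borel" for S
    proof -
      have "measure lborel S * measure lborel (Q ` B) = measure lborel (Q ` S) * measure lborel B"
        using arg_cong[OF eq[OF that], of enn2real] by (simp add: measure_def enn2real_mult)
      then show ?thesis using Bpos by (simp add: q_def field_simps)
    qed
  qed (rule bor)
qed

section \<open>Iterated substitution\<close>

text \<open>\<open>Dpow Q D m i j\<close> is the set of positions of the tiles of type \<open>i\<close> in
  \<open>\<omega>\<^sup>m(T\<^sub>j)\<close>.\<close>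

primrec Dpow :: "(real ^ 'n \<Rightarrow> real ^ 'n) \<Rightarrow> ('k \<Rightarrow> 'k \<Rightarrow> (real ^ 'n) set) \<Rightarrow> nat \<Rightarrow> 'k \<Rightarrow> 'k \<Rightarrow> (real ^ 'n) set" where
  "Dpow Q D 0 i j = (if i = j then {0} else {})"
| "Dpow Q D (Suc m) i j = (\<Union>k. \<Union>u\<in>Dpow Q D m k j. (\<lambda>w. Q u + w) ` D i k)"

text \<open>Only nonvanishing is transferred from the matrix power. Equality with cardinalities
  would also require that different chains of substitutions lead to different positions.\<close>

lemma matrix_power_Dpow:
  fixes D :: "'k::finite \<Rightarrow> 'k \<Rightarrow> (real ^ 'n) set"
  shows "(((**) (subst_matrix D) ^^ m) (mat 1)) $ i $ j \<noteq> 0 \<Longrightarrow> Dpow Q D m i j \<noteq> {}"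
proof (induction m arbitrary: i)
  case 0 then show ?case by (auto simp: mat_def split: if_splits)
next
  case (Suc m)
  let ?X = "((**) (subst_matrix D) ^^ m) (mat 1)"
  have "(subst_matrix D ** ?X) $ i $ j = (\<Sum>k\<in>UNIV. card (D i k) * ?X $ k $ j)"
    by (subst matrix_matrix_mult_def) (simp add: subst_matrix_def)
  moreover have "(subst_matrix D ** ?X) $ i $ j \<noteq> 0" using Suc.prems by simp
  ultimately have "(\<Sum>k\<in>UNIV. card (D i k) * ?X $ k $ j) \<noteq> 0" by argo
  then obtain k where "card (D i k) * ?X $ k $ j \<noteq> 0" by (meson sum.not_neutral_contains_not_neutral)
  then have "D i k \<noteq> {}" "Dpow Q D m k j \<noteq> {}" using Suc.IH[of k] by auto
  then show ?case by auto
qed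

lemma bounded_borel_fmeasurable:
  fixes S :: "'a::euclidean_space set"
  shows "bounded S \<Longrightarrow> S \<in> sets borel \<Longrightarrow> S \<in> fmeasurable lborel"
  using emeasure_bounded_finite[of S] by (intro fmeasurableI) auto

lemma translation_measure:
  fixes S :: "'a::euclidean_space set"
  assumes [measurable]: "S \<in> sets borel"
  shows "(+) a ` S \<in> sets borel" "measure lborel ((+) a ` S) = measure lborel S"
proof -
  have eq: "(+) a ` S = (\<lambda>x. x - a) -` S" by (auto simp: mem_translation_iff)
  show b: "(+) a ` S \<in> sets borel"
    unfolding eq using measurable_sets[of "\<lambda>x. x - a" borel borel S] by simp
  have "measure lborel ((+) a ` S) = measure (distr lborel borel ((+) a)) ((+) a ` S)" by (simp add: lborel_distr_plus)
  also have "\<dots> = measure lborel ((+) a -` ((+) a ` S))" using b by (subst measure_distr) auto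
  also have "(+) a -` ((+) a ` S) = S" by auto
  finally show "measure lborel ((+) a ` S) = measure lborel S" .
qed

lemma bounded_frontier: "bounded S \<Longrightarrow> bounded (frontier S)"
  by (auto simp: frontier_def intro: bounded_subset[OF bounded_closure])

text \<open>The erosion of \<open>S\<close> by open balls. With open balls it is closed, hence
  Borel, for every \<open>S\<close>.\<close>

definition core :: "real \<Rightarrow> 'a::metric_space set \<Rightarrow> 'a set" where
  "core r S = {x. ball x r \<subseteq> S}"

lemma closed_core: "closed (core r S)"
proof -
  have "- core r S = (\<Union>y\<in>-S. ball y r)" by (auto simp: core_def dist_commute)
  moreover have "open (\<Union>y\<in>-S. ball y r)" by (intro open_UN ballI open_ball)
  ultimately show ?thesis by (simp only: closed_def)
qed

lemma core_subset: "0 < r \<Longrightarrow> core r S \<subseteq> S"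
  by (auto simp: core_def)

text \<open>Prepared for continuity of measure from below: the volumes of the cores converge to the
  volume of the interior.\<close>

lemma interior_eq_core: "interior S = (\<Union>n. core (inverse (real (Suc n))) S)"
proof (rule set_eqI)
  fix x
  have "x \<in> interior S \<longleftrightarrow> (\<exists>e>0. ball x e \<subseteq> S)" by (rule mem_interior)
  also have "\<dots> \<longleftrightarrow> (\<exists>n. ball x (inverse (real (Suc n))) \<subseteq> S)"
  proof
    assume "\<exists>e>0. ball x e \<subseteq> S"
    then obtain e n where "ball x e \<subseteq> S" "inverse (real (Suc n)) < e" using reals_Archimedean by blast
    then show "\<exists>n. ball x (inverse (real (Suc n))) \<subseteq> S" using subset_ball[of "inverse (real (Suc n))" e x] by auto
  next
    assume "\<exists>n. ball x (inverse (real (Suc n))) \<subseteq> S"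
    then obtain n where "ball x (inverse (real (Suc n))) \<subseteq> S" by blast
    then show "\<exists>e>0. ball x e \<subseteq> S" by (intro exI[of _ "inverse (real (Suc n))"]) simp
  qed
  finally show "x \<in> interior S \<longleftrightarrow> x \<in> (\<Union>n. core (inverse (real (Suc n))) S)" by (simp add: core_def)
qed

text \<open>\<open>P\<close> is the inverse of \<open>Q\<close>, \<open>q\<close> the factor by
  which \<open>Q\<close> scales volume, and \<open>l\<close> a primitivity exponent.
  \<open>L_fixed\<close> is the fixed point equation written for the coloured set of the tiling, so
  that the geometry takes place on positions and types.\<close>

locale self_affine_tiling = prototiles A for A :: "'k::finite \<Rightarrow> (real ^ 'n::finite) set" +
  fixes Q P :: "real ^ 'n \<Rightarrow> real ^ 'n"
    and D :: "'k \<Rightarrow> 'k \<Rightarrow> (real ^ 'n) set"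
    and L :: "((real ^ 'n) \<times> 'k) set"
    and q :: real and l :: nat
  assumes linQ: "linear Q" and linP: "linear P" and PQ: "P (Q v) = v" and QP: "Q (P v) = v"
    and P_small: "0 < e \<Longrightarrow> \<exists>K. \<forall>k\<ge>K. \<forall>v. norm ((P ^^ k) v) \<le> e * norm v"
    and q_pos: "q > 0"
    and Q_borel: "S \<in> sets borel \<Longrightarrow> Q ` S \<in> sets borel"
    and Q_measure: "S \<in> sets borel \<Longrightarrow> measure lborel (Q ` S) = q * measure lborel S"
    and finite_D: "finite (D i j)"
    and QA: "Q ` A j = (\<Union>i. \<Union>u\<in>D i j. (+) u ` A i)"
    and L_covering: "covering A L" and L_packing: "packing A L"
    and L_fixed: "(x, i) \<in> L \<longleftrightarrow> (\<exists>y j u. (y, j) \<in> L \<and> u \<in> D i j \<and> x = Q y + u)"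
    and primitive: "Dpow Q D l i j \<noteq> {}"
begin

abbreviation vol where "vol \<equiv> measure (lborel :: (real ^ 'n) measure)"

abbreviation "QQ m \<equiv> Q ^^ m"

definition pieces :: "nat \<Rightarrow> 'k \<Rightarrow> ((real ^ 'n) \<times> 'k) set" where
  "pieces m j = {(u, i). u \<in> Dpow Q D m i j}"

lemma linQQ: "linear (QQ m)"
proof (induction m)
  case 0 show ?case by (simp add: linear_iff)
next
  case (Suc m) show ?case using linear_compose[OF Suc linQ] by (simp add: o_def)
qed

lemma PPQQ: "(P ^^ m) (QQ m v) = v"
proof (induction m)
  case (Suc m)
  have "(P ^^ Suc m) (QQ (Suc m) v) = (P ^^ m) (P (Q (QQ m v)))" by (simp add: funpow_swap1)
  then show ?case using Suc by (simp add: PQ)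
qed simp

lemma QQPP: "QQ m ((P ^^ m) v) = v"
proof (induction m)
  case (Suc m)
  have "(QQ (Suc m)) ((P ^^ Suc m) v) = (QQ m) (Q (P ((P ^^ m) v)))" by (simp add: funpow_swap1)
  then show ?case using Suc by (simp add: QP)
qed simp

lemma injQQ: "inj (QQ m)" by (rule inj_on_inverseI) (rule PPQQ)

lemma QQ_image: "p \<in> QQ m ` S \<longleftrightarrow> (P ^^ m) p \<in> S"
  using inj_image_mem_iff[OF injQQ[of m], of "(P ^^ m) p" S] by (simp only: QQPP)

lemma QQ_translation: "QQ m ` ((+) x ` S) = (+) (QQ m x) ` (QQ m ` S)"
  by (simp add: image_image linear_add[OF linQQ])

lemma QQ_borel: "S \<in> sets borel \<Longrightarrow> QQ m ` S \<in> sets borel"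
proof (induction m)
  case (Suc m)
  have "QQ (Suc m) ` S = Q ` (QQ m ` S)" by (simp only: funpow.simps(2) image_comp)
  then show ?case using Q_borel[OF Suc.IH[OF Suc.prems]] by (simp only:)
qed simp

lemma QQ_measure: "S \<in> sets borel \<Longrightarrow> vol (QQ m ` S) = q ^ m * vol S"
proof (induction m)
  case (Suc m)
  have "QQ (Suc m) ` S = Q ` (QQ m ` S)" by (simp only: funpow.simps(2) image_comp)
  then show ?case using Q_measure[OF QQ_borel[OF Suc.prems, of m]] Suc by simp
qed simp

lemma finite_Dpow: "finite (Dpow Q D m i j)"
  by (induction m arbitrary: i) (simp_all add: finite_D)

lemma finite_pieces: "finite (pieces m j)"
proof -
  have "pieces m j = (\<Union>i. (\<lambda>u. (u, i)) ` Dpow Q D m i j)" by (auto simp: pieces_def)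
  then show ?thesis by (simp add: finite_Dpow)
qed

text \<open>\<open>L\<close> is fixed by every power of the substitution. Hence it also lists the
  supertiles of every level: each tile has a parent of level \<open>m\<close> in \<open>L\<close>,
  and all children of a member of \<open>L\<close> lie in \<open>L\<close>.\<close>

lemma L_pow: "(x, i) \<in> L \<longleftrightarrow> (\<exists>y j u. (y, j) \<in> L \<and> u \<in> Dpow Q D m i j \<and> x = QQ m y + u)"
proof (induction m arbitrary: x i)
  case 0 then show ?case by auto
next
  case (Suc m)
  have Qadd: "Q (QQ m y + u) + w = QQ (Suc m) y + (Q u + w)" for y u w
    by (simp add: linear_add[OF linQ] add.assoc)
  show ?case
  proof
    assume "(x, i) \<in> L"
    then obtain z k w where "(z, k) \<in> L" "w \<in> D i k" "x = Q z + w" using L_fixed by blast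
    moreover from this obtain y j u where "(y, j) \<in> L" "u \<in> Dpow Q D m k j" "z = QQ m y + u" using Suc.IH by blast
    ultimately have "(y, j) \<in> L" "Q u + w \<in> Dpow Q D (Suc m) i j" "x = QQ (Suc m) y + (Q u + w)"
      using Qadd by auto
    then show "\<exists>y j u. (y, j) \<in> L \<and> u \<in> Dpow Q D (Suc m) i j \<and> x = QQ (Suc m) y + u" by blast
  next
    assume "\<exists>y j u. (y, j) \<in> L \<and> u \<in> Dpow Q D (Suc m) i j \<and> x = QQ (Suc m) y + u"
    then obtain y j u k w where *: "(y, j) \<in> L" "u \<in> Dpow Q D m k j" "w \<in> D i k" "x = QQ (Suc m) y + (Q u + w)"
      by auto
    then have "(QQ m y + u, k) \<in> L" using Suc.IH by blast
    moreover have "x = Q (QQ m y + u) + w" using *(4) Qadd by simp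
    ultimately show "(x, i) \<in> L" using *(3) L_fixed by blast
  qed
qed

lemma L_child: "(y, j) \<in> L \<Longrightarrow> (u, i) \<in> pieces m j \<Longrightarrow> (QQ m y + u, i) \<in> L"
  by (subst L_pow[of _ _ m]) (auto simp: pieces_def)

lemma L_parent: "(x, i) \<in> L \<Longrightarrow> \<exists>y j u. (y, j) \<in> L \<and> (u, i) \<in> pieces m j \<and> x = QQ m y + u"
  by (subst (asm) L_pow[of _ _ m]) (auto simp: pieces_def)

lemma all_types: "\<exists>x. (x, j) \<in> L"
proof -
  obtain y k where "(y, k) \<in> L" using L_covering unfolding covering_def by fast
  moreover obtain u where "(u, j) \<in> pieces l k" using primitive by (auto simp: pieces_def)
  ultimately show ?thesis using L_child by blast
qed

section \<open>Inflated prototiles and supertiles: geometry, volume, null boundary\<close>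

definition inflated :: "nat \<Rightarrow> 'k \<Rightarrow> (real ^ 'n) set" where
  "inflated m j = QQ m ` A j"

text \<open>The set \<open>Q^m (x + A j)\<close>. For (x, j) in \<open>L\<close> it is the union of
  the supports of the tiles that the tile (x, j) turns into after \<open>m\<close> substitutions,
  all of them members of the same \<open>L\<close>.\<close>

definition supertile :: "nat \<Rightarrow> real ^ 'n \<Rightarrow> 'k \<Rightarrow> (real ^ 'n) set" where
  "supertile m x j = (+) (QQ m x) ` inflated m j"

lemma inflated_eq_tiles: "inflated m j = (\<Union>(u, i)\<in>pieces m j. (+) u ` A i)"
proof (induction m)
  case 0 show ?case by (auto simp: inflated_def pieces_def split: if_splits)
next
  case (Suc m)
  have "inflated (Suc m) j = Q ` inflated m j" by (simp only: inflated_def funpow.simps(2) image_comp)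
  also have "\<dots> = (\<Union>(u, k)\<in>pieces m j. (+) (Q u) ` (Q ` A k))"
    unfolding Suc.IH by (simp add: image_UN image_image linear_add[OF linQ] case_prod_unfold)
  also have "\<dots> = (\<Union>(u, k)\<in>pieces m j. \<Union>i. \<Union>w\<in>D i k. (+) (Q u + w) ` A i)"
    unfolding QA by (simp add: image_UN image_image add.assoc)
  also have "\<dots> = (\<Union>(u, i)\<in>pieces (Suc m) j. (+) u ` A i)"
  proof (rule set_eqI)
    fix p
    have "p \<in> (\<Union>(u, k)\<in>pieces m j. \<Union>i. \<Union>w\<in>D i k. (+) (Q u + w) ` A i) \<longleftrightarrow>
      (\<exists>k u i w. u \<in> Dpow Q D m k j \<and> w \<in> D i k \<and> p \<in> (+) (Q u + w) ` A i)"
      unfolding pieces_def by blast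
    also have "\<dots> \<longleftrightarrow> p \<in> (\<Union>(u, i)\<in>pieces (Suc m) j. (+) u ` A i)"
      unfolding pieces_def Dpow.simps by blast
    finally show "p \<in> (\<Union>(u, k)\<in>pieces m j. \<Union>i. \<Union>w\<in>D i k. (+) (Q u + w) ` A i) \<longleftrightarrow>
      p \<in> (\<Union>(u, i)\<in>pieces (Suc m) j. (+) u ` A i)" .
  qed
  finally show ?case .
qed

lemma inflated_add: "inflated (m + k) j = QQ m ` inflated k j"
  by (simp add: inflated_def funpow_add image_comp)

lemma inflated_pieces: "inflated (m + k) j = (\<Union>(u, i)\<in>pieces k j. (+) (QQ m u) ` inflated m i)"
proof -
  have "inflated (m + k) j = QQ m ` (\<Union>(u, i)\<in>pieces k j. (+) u ` A i)" using inflated_add inflated_eq_tiles by simp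
  then show ?thesis by (simp add: image_UN case_prod_unfold QQ_translation inflated_def)
qed

lemma inflated_compact: "compact (inflated m j)"
  unfolding inflated_def using linQQ A_compact
  by (intro compact_continuous_image linear_continuous_on) (auto simp: linear_conv_bounded_linear)

lemma inflated_closed: "closed (inflated m j)" by (rule compact_imp_closed[OF inflated_compact])
lemma inflated_bounded: "bounded (inflated m j)" by (rule compact_imp_bounded[OF inflated_compact])
lemma inflated_borel: "inflated m j \<in> sets borel" by (rule borel_closed[OF inflated_closed])

lemma inflated_interior: "interior (inflated m j) = QQ m ` interior (A j)"
  unfolding inflated_def by (rule interior_injective_linear_image[OF linQQ injQQ])

lemma inflated_frontier: "frontier (inflated m j) = QQ m ` frontier (A j)"
proof -
  have "frontier (inflated m j) = QQ m ` A j - QQ m ` interior (A j)"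
    using closure_closed[OF inflated_closed, of m j] by (simp only: frontier_def inflated_interior) (simp only: inflated_def)
  also have "\<dots> = QQ m ` (A j - interior (A j))" by (rule image_set_diff[OF injQQ, symmetric])
  finally show ?thesis using closure_closed[OF compact_imp_closed[OF A_compact]] by (simp only: frontier_def)
qed

lemma inflated_vol: "vol (inflated m j) = q ^ m * vol (A j)"
  unfolding inflated_def by (rule QQ_measure) (simp add: A_compact borel_compact)

lemma A_interior_vol: "0 < vol (interior (A i))"
proof -
  have "interior (A i) \<noteq> {}" using A_closure[of i] A_nonempty[of i] by (metis closure_empty)
  then show ?thesis using A_compact[of i]
    by (intro open_measure_pos) (auto intro: bounded_interior compact_imp_bounded)
qed

lemma A_interior_vol_le: "vol (interior (A i)) \<le> vol (A i)"
proof (rule measure_mono_fmeasurable[OF interior_subset])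
  show "A i \<in> fmeasurable lborel" using A_compact[of i]
    by (intro bounded_borel_fmeasurable compact_imp_bounded borel_compact)
qed auto

lemma A_vol: "0 < vol (A i)"
  using A_interior_vol[of i] A_interior_vol_le[of i] by linarith

lemma inflated_vol_pos: "0 < vol (inflated m i)" using inflated_vol A_vol q_pos by simp

lemma supertile_iff: "p \<in> supertile m x j \<longleftrightarrow> p - QQ m x \<in> inflated m j"
  by (simp add: supertile_def mem_translation_iff)

lemma supertile_vol: "vol (supertile m x j) = vol (inflated m j)"
  unfolding supertile_def by (rule translation_measure(2)[OF inflated_borel])

lemma supertile_borel: "supertile m x j \<in> sets borel"
  unfolding supertile_def by (rule translation_measure(1)[OF inflated_borel])

lemma supertile_bounded: "bounded (supertile m x j)"
  unfolding supertile_def by (rule bounded_translation[OF inflated_bounded])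

lemma supertile_pieces: "supertile (m + k) x j = (\<Union>(u, i)\<in>pieces k j. supertile m (QQ k x + u) i)"
  by (simp add: supertile_def inflated_pieces image_UN case_prod_unfold image_image linear_add[OF linQQ] funpow_add add.assoc)

lemma supertile_cover: "\<exists>(x, j)\<in>L. p \<in> supertile m x j"
proof -
  obtain x j where x: "(x, j) \<in> L" "(P ^^ m) p - x \<in> A j" using L_covering unfolding covering_def by fast
  have "QQ m ((P ^^ m) p - x) = p - QQ m x" by (simp add: linear_diff[OF linQQ] QQPP)
  then have "p \<in> supertile m x j" using x(2) unfolding supertile_iff inflated_def by (metis imageI)
  with x show ?thesis by blast
qed

lemma supertile_packing:
  assumes "(x, i) \<in> L" "(y, j) \<in> L" "p \<in> interior (supertile m x i)" "p \<in> interior (supertile m y j)"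
  shows "x = y \<and> i = j"
proof -
  have "(P ^^ m) p - x \<in> interior (A i)" if "p \<in> interior (supertile m x i)" for x i
  proof -
    have "p - QQ m x \<in> QQ m ` interior (A i)"
      using that unfolding supertile_def mem_interior_translation inflated_interior .
    then obtain a where a: "a \<in> interior (A i)" "p - QQ m x = QQ m a" by blast
    then have "p = QQ m (x + a)" by (simp add: linear_add[OF linQQ] algebra_simps)
    then show ?thesis using a by (simp add: PPQQ)
  qed
  then show ?thesis using assms L_packing unfolding packing_def by blast
qed

text \<open>\<open>P ^^ m\<close> maps a ball of radius \<open>s\<close> into one of radius
  \<open>r\<close> once \<open>m\<close> is large, so \<open>QQ m\<close> blows up an inner ball of
  the prototile to contain a ball of radius \<open>s\<close>.\<close>

lemma supertile_large:
  assumes s: "0 < s"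
  shows "\<exists>m a. ball a s \<subseteq> inflated m j"
proof -
  have "interior (A j) \<noteq> {}" using A_closure[of j] A_nonempty[of j] by (metis closure_empty)
  then obtain a r where r: "r > 0" "ball a r \<subseteq> A j" by (meson mem_interior ex_in_conv)
  then obtain m where m: "\<And>v. norm ((P ^^ m) v) \<le> r / s * norm v" using P_small[of "r / s"] s by auto
  have "ball (QQ m a) s \<subseteq> inflated m j"
  proof
    fix p assume p: "p \<in> ball (QQ m a) s"
    have PP: "(P ^^ m) (p - QQ m a) = (P ^^ m) p - a"
      by (rule injD[OF injQQ[of m]]) (simp add: QQPP linear_diff[OF linQQ])
    have "norm ((P ^^ m) p - a) \<le> r / s * norm (p - QQ m a)" using m[of "p - QQ m a"] PP by simp
    also have "\<dots> < r / s * s" using p r s by (intro mult_strict_left_mono) (auto simp: dist_norm norm_minus_commute)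
    finally have "(P ^^ m) p \<in> ball a r" using s by (simp add: dist_norm norm_minus_commute)
    then show "p \<in> inflated m j" using r(2) unfolding inflated_def QQ_image by blast
  qed
  then show ?thesis by blast
qed

text \<open>The boundary ratio \<open>c\<close> is not increased by passing to a supertile; a tile in the interior
  of the supertile contributes volume but no boundary, forcing \<open>c = 0\<close>.\<close>

lemma pieces_interior_sum:
  "(\<Sum>(u, i)\<in>pieces m j. vol (interior (A i))) \<le> q ^ m * vol (interior (A j))"
proof -
  let ?T = "\<lambda>(u, i). (+) u ` interior (A i)"
  obtain x where x: "(x, j) \<in> L" using all_types by blast
  have T_fm: "?T t \<in> fmeasurable lborel" for t
    using A_compact by (auto simp: case_prod_unfold bounded_interior compact_imp_bounded
        intro!: bounded_borel_fmeasurable bounded_translation translation_measure(1))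
  \<comment> \<open>Disjointness is read off from \<open>L_packing\<close>, after the pieces have
    been placed in \<open>L\<close> as children of a tile of type \<open>j\<close>.\<close>
  have disj: "disjoint_family_on ?T (pieces m j)"
    unfolding disjoint_family_on_def
  proof (intro ballI impI)
    fix s t assume st: "s \<in> pieces m j" "t \<in> pieces m j" "s \<noteq> t"
    obtain u i v k where [simp]: "s = (u, i)" "t = (v, k)" by (cases s, cases t) auto
    have False if "p \<in> (+) u ` interior (A i)" "p \<in> (+) v ` interior (A k)" for p
    proof -
      have "QQ m x + p - (QQ m x + u) \<in> interior (A i)" "QQ m x + p - (QQ m x + v) \<in> interior (A k)"
        using that by (simp_all add: mem_translation_iff)
      then have "QQ m x + u = QQ m x + v \<and> i = k"
        using L_child[OF x st(1)[simplified]] L_child[OF x st(2)[simplified]] L_packing unfolding packing_def by blast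
      then show False using st by simp
    qed
    then show "?T s \<inter> ?T t = {}" by auto
  qed
  have sub: "(\<Union>t\<in>pieces m j. ?T t) \<subseteq> interior (inflated m j)"
  proof (rule UN_least)
    fix t assume t: "t \<in> pieces m j"
    have "?T t \<subseteq> inflated m j" using t interior_subset unfolding inflated_eq_tiles[of m j] by fastforce
    moreover have "open (?T t)" by (auto simp: case_prod_unfold open_translation)
    ultimately show "?T t \<subseteq> interior (inflated m j)" by (rule interior_maximal)
  qed
  have "(\<Sum>t\<in>pieces m j. vol (?T t)) = vol (\<Union>t\<in>pieces m j. ?T t)"
    using T_fm by (intro measure_finite_Union[symmetric] finite_pieces disj)
       (auto simp: fmeasurable_def less_top)
  also have "\<dots> \<le> vol (interior (inflated m j))"
  proof (rule measure_mono_fmeasurable[OF sub])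
    show "(\<Union>t\<in>pieces m j. ?T t) \<in> sets lborel"
      using fmeasurableD[OF T_fm] by (intro sets.finite_UN finite_pieces)
    show "interior (inflated m j) \<in> fmeasurable lborel"
      using inflated_bounded by (intro bounded_borel_fmeasurable bounded_interior) auto
  qed
  also have "\<dots> = q ^ m * vol (interior (A j))" unfolding inflated_interior by (rule QQ_measure) auto
  finally show ?thesis by (simp add: case_prod_unfold translation_measure(2))
qed

lemma frontier_null: "vol (frontier (A j)) = 0"
proof -
  define b where "b i = vol (frontier (A i))" for i
  define o' where "o' i = vol (interior (A i))" for i
  define c where "c = Max (range (\<lambda>i. b i / o' i))"
  have o: "0 < o' i" for i unfolding o'_def by (rule A_interior_vol)
  have c_ge: "b i \<le> c * o' i" for i
    using Max_ge[of "range (\<lambda>i. b i / o' i)" "b i / o' i"] o[of i] by (simp add: c_def divide_le_eq)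
  have "c \<in> range (\<lambda>i. b i / o' i)" unfolding c_def by (rule Max_in) auto
  \<comment> \<open>From here on \<open>j\<close> is a type of maximal ratio and shadows the type in
    the statement. The conclusion returns for every type through c = 0.\<close>
  then obtain j where j: "c = b j / o' j" by auto
  then have bj: "b j = c * o' j" using o[of j] by simp
  have "0 \<le> c" unfolding j using o[of j] by (simp add: b_def)
  obtain R where R: "R > 0" "\<And>i x. x \<in> A i \<Longrightarrow> norm x \<le> R" using outradius by blast
  \<comment> \<open>Supports lie within \<open>R\<close> of their positions, so a tile through
    \<open>a\<close> stays within 2 * R of \<open>a\<close> and thus in the interior of the inflated
    prototile.\<close>
  have "0 < 3 * R" using R by simp
  then obtain m a where a: "ball a (3 * R) \<subseteq> inflated m j" using supertile_large by blast
  then have "a \<in> inflated m j" using R(1) by auto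
  then obtain u i where ui: "(u, i) \<in> pieces m j" "a \<in> (+) u ` A i" unfolding inflated_eq_tiles[of m j] by blast
  have inner: "(+) u ` A i \<subseteq> interior (inflated m j)"
  proof -
    have "(+) u ` A i \<subseteq> ball a (3 * R)"
    proof
      fix p assume p: "p \<in> (+) u ` A i"
      have "norm (a - p) \<le> norm (a - u) + norm (p - u)" using norm_triangle_ineq4[of "a - u" "p - u"] by simp
      also have "\<dots> \<le> R + R" using ui(2) p R(2) by (intro add_mono) (auto simp: mem_translation_iff)
      finally show "p \<in> ball a (3 * R)" using R(1) by (simp add: dist_norm)
    qed
    also have "\<dots> \<subseteq> interior (inflated m j)" using a by (rule interior_maximal) simp
    finally show ?thesis .
  qed
  let ?I = "pieces m j - {(u, i)}"
  let ?T = "\<lambda>(u, i). (+) u ` frontier (A i)"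
  have T_fm: "?T t \<in> fmeasurable lborel" for t
    using A_compact by (auto simp: case_prod_unfold bounded_frontier compact_imp_bounded
        intro!: bounded_borel_fmeasurable bounded_translation translation_measure(1))
  \<comment> \<open>The tile (u, i) contributes nothing, and interior points of any tile are
    interior to the union; what remains are the frontiers of the other tiles.\<close>
  have "frontier (inflated m j) \<subseteq> (\<Union>t\<in>?I. ?T t)"
  proof
    fix p assume p: "p \<in> frontier (inflated m j)"
    then have "p \<in> inflated m j" "p \<notin> interior (inflated m j)" using inflated_closed[of m j] by (auto simp: frontier_def)
    then obtain v k where vk: "(v, k) \<in> pieces m j" "p \<in> (+) v ` A k" unfolding inflated_eq_tiles[of m j] by blast
    have ne: "(v, k) \<noteq> (u, i)" using inner \<open>p \<notin> interior (inflated m j)\<close> vk(2) by auto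
    have "(+) v ` A k \<subseteq> inflated m j" unfolding inflated_eq_tiles[of m j] using vk(1) by blast
    then have "p \<notin> interior ((+) v ` A k)" using interior_mono \<open>p \<notin> interior (inflated m j)\<close> by blast
    then have "p \<in> (+) v ` frontier (A k)" using vk(2) closure_subset[of "A k"]
      unfolding mem_interior_translation mem_translation_iff frontier_def by blast
    then show "p \<in> (\<Union>t\<in>?I. ?T t)" using vk(1) ne by blast
  qed
  then have "vol (frontier (inflated m j)) \<le> vol (\<Union>t\<in>?I. ?T t)"
    using T_fm finite_pieces by (intro measure_mono_fmeasurable fmeasurable.finite_UN) auto
  also have "\<dots> \<le> (\<Sum>t\<in>?I. vol (?T t))"
    using fmeasurableD[OF T_fm] finite_pieces by (intro measure_UNION_le) blast+
  also have "\<dots> = (\<Sum>(v, k)\<in>?I. b k)" by (simp add: case_prod_unfold translation_measure(2) b_def)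
  also have "\<dots> \<le> (\<Sum>(v, k)\<in>?I. c * o' k)" using c_ge by (intro sum_mono) auto
  also have "\<dots> = c * ((\<Sum>(v, k)\<in>pieces m j. o' k) - o' i)"
    using finite_pieces ui(1) by (simp add: sum_diff1 case_prod_unfold flip: sum_distrib_left)
  also have "\<dots> \<le> c * (q ^ m * o' j - o' i)"
    using pieces_interior_sum[of m j] \<open>0 \<le> c\<close> by (intro mult_left_mono) (auto simp: o'_def)
  finally have "q ^ m * b j \<le> c * (q ^ m * o' j - o' i)"
    unfolding inflated_frontier b_def by (subst (asm) QQ_measure) auto
  \<comment> \<open>Since the ratio \<open>c\<close> is attained at \<open>j\<close>, the terms with
    the factor q ^ m cancel.\<close>
  then have "c * o' i \<le> 0" unfolding bj by (simp add: algebra_simps)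
  then have "c = 0" using \<open>0 \<le> c\<close> o[of i] by (simp add: mult_le_0_iff)
  then have "b i \<le> 0" for i using c_ge[of i] by simp
  then show ?thesis unfolding b_def by (simp add: measure_le_0_iff)
qed

lemma supertile_frontier_null: "frontier (supertile m x j) \<in> null_sets lborel"
proof -
  have eq: "frontier (supertile m x j) = (+) (QQ m x) ` QQ m ` frontier (A j)"
    by (simp add: supertile_def frontier_translation inflated_frontier)
  have "vol (frontier (supertile m x j)) = vol (QQ m ` frontier (A j))"
    unfolding eq by (rule translation_measure(2)) (auto intro: QQ_borel)
  also have "\<dots> = 0" by (subst QQ_measure) (auto simp: frontier_null)
  finally have "vol (frontier (supertile m x j)) = 0" .
  moreover have fm: "frontier (supertile m x j) \<in> fmeasurable lborel"
    using supertile_bounded by (intro bounded_borel_fmeasurable bounded_frontier) auto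
  have "emeasure lborel (frontier (supertile m x j)) = ennreal (vol (frontier (supertile m x j)))"
    by (rule emeasure_eq_ennreal_measure[OF fmeasurableD2[OF fm]])
  ultimately show ?thesis using fmeasurableD[OF fm] by (intro null_setsI) simp_all
qed

lemma interior_vol: "vol (interior (A j)) = vol (A j)"
proof -
  have "vol (A j) = vol (interior (A j) \<union> frontier (A j))"
  proof -
    have "interior (A j) \<union> (A j - interior (A j)) = A j" using interior_subset by blast
    then show ?thesis using closure_closed[OF compact_imp_closed[OF A_compact]] by (simp only: frontier_def)
  qed
  also have "\<dots> \<le> vol (interior (A j)) + vol (frontier (A j))" by (rule measure_Un_le) auto
  finally have "vol (A j) \<le> vol (interior (A j))" using frontier_null by simp
  moreover have "vol (interior (A j)) \<le> vol (A j)" by (rule A_interior_vol_le)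
  ultimately show ?thesis by simp
qed

text \<open>Applying \<open>P ^^ m\<close> turns a boundary layer of width \<open>R\<close> at level
  \<open>m\<close> into one of width at most \<open>r\<close> in the prototile, whose volume is
  small because the boundary is null. The scaling factor q ^ m cancels in the ratio.\<close>

lemma core_ratio:
  assumes e: "0 < e" and R: "0 < R"
  shows "\<exists>K. \<forall>m\<ge>K. \<forall>j. vol (inflated m j) - vol (core R (inflated m j)) \<le> e * vol (inflated m j)"
proof -
  have "\<exists>K. \<forall>m\<ge>K. vol (inflated m j) - vol (core R (inflated m j)) \<le> e * vol (inflated m j)" for j
  proof -
    let ?C = "\<lambda>n. core (inverse (real (Suc n))) (A j)"
    have Afm: "A j \<in> fmeasurable lborel" using A_compact[of j]
      by (intro bounded_borel_fmeasurable) (auto intro: compact_imp_bounded borel_compact)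
    have sub: "?C n \<subseteq> A j" for n by (rule core_subset) simp
    have Cb: "?C n \<in> sets borel" for n by (rule borel_closed[OF closed_core])
    have "incseq ?C"
    proof (rule incseq_SucI)
      fix n
      have "inverse (real (Suc (Suc n))) \<le> inverse (real (Suc n))" by (rule le_imp_inverse_le) auto
      then show "?C n \<subseteq> ?C (Suc n)" unfolding core_def using subset_ball by blast
    qed
    moreover have "emeasure lborel (\<Union>n. ?C n) \<noteq> \<infinity>"
    proof -
      have "bounded (\<Union>n. ?C n)" using sub compact_imp_bounded[OF A_compact[of j]] by (meson UN_least bounded_subset)
      then show ?thesis using emeasure_bounded_finite by force
    qed
    ultimately have "(\<lambda>n. vol (?C n)) \<longlonglongrightarrow> vol (\<Union>n. ?C n)"
      using Cb by (intro Lim_measure_incseq) auto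
    then have "(\<lambda>n. vol (?C n)) \<longlonglongrightarrow> vol (A j)" unfolding interior_eq_core[symmetric] interior_vol .
    moreover have "(1 - e) * vol (A j) < vol (A j)" using A_vol[of j] e by simp
    ultimately have "eventually (\<lambda>n. (1 - e) * vol (A j) < vol (?C n)) sequentially" by (rule order_tendstoD)
    then obtain n where n: "(1 - e) * vol (A j) < vol (?C n)" using eventually_happens trivial_limit_sequentially by blast
    define r where "r = inverse (real (Suc n))"
    have r: "r > 0" by (simp add: r_def)
    obtain K where K: "\<And>m v. m \<ge> K \<Longrightarrow> norm ((P ^^ m) v) \<le> r / R * norm v" using P_small[of "r / R"] r R by auto
    have "vol (inflated m j) - vol (core R (inflated m j)) \<le> e * vol (inflated m j)" if m: "m \<ge> K" for m
    proof -
      have "QQ m ` ?C n \<subseteq> core R (inflated m j)"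
      proof -
        have "p \<in> inflated m j" if x: "ball x r \<subseteq> A j" and p: "dist (QQ m x) p < R" for x p
        proof -
        have PP: "(P ^^ m) (p - QQ m x) = (P ^^ m) p - x"
          by (rule injD[OF injQQ[of m]]) (simp add: QQPP linear_diff[OF linQQ])
        have "norm ((P ^^ m) p - x) \<le> r / R * norm (p - QQ m x)" using K[OF m, of "p - QQ m x"] PP by simp
        also have "\<dots> < r / R * R" using p r R by (intro mult_strict_left_mono) (auto simp: dist_norm norm_minus_commute)
        finally have "(P ^^ m) p \<in> ball x r" using R by (simp add: dist_norm norm_minus_commute)
          then show "p \<in> inflated m j" using x unfolding inflated_def QQ_image by blast
        qed
        then show ?thesis unfolding core_def r_def[symmetric] mem_ball subset_iff by blast
      qed
      then have "vol (QQ m ` ?C n) \<le> vol (core R (inflated m j))"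
        using Cb core_subset[OF R, of "inflated m j"] inflated_bounded[of m j]
        by (intro measure_mono_fmeasurable bounded_borel_fmeasurable)
          (auto intro: QQ_borel bounded_subset borel_closed[OF closed_core])
      moreover have "vol (QQ m ` ?C n) = q ^ m * vol (?C n)" by (rule QQ_measure[OF Cb])
      moreover have "q ^ m * ((1 - e) * vol (A j)) \<le> q ^ m * vol (?C n)"
        using n q_pos by (intro mult_left_mono) auto
      ultimately show ?thesis unfolding inflated_vol by (simp add: algebra_simps)
    qed
    then show ?thesis by blast
  qed
  then obtain K where K: "\<And>j m. m \<ge> K j \<Longrightarrow> vol (inflated m j) - vol (core R (inflated m j)) \<le> e * vol (inflated m j)" by metis
  have "vol (inflated m j) - vol (core R (inflated m j)) \<le> e * vol (inflated m j)" if "m \<ge> Max (range K)" for m j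
    using that by (intro K) (meson Max_ge finite finite_imageI le_trans rangeI)
  then show ?thesis by blast
qed

end

section \<open>Integrals over bounded sets\<close>

definition integral_over :: "('a::euclidean_space \<Rightarrow> real) \<Rightarrow> 'a set \<Rightarrow> real" where
  "integral_over f S = (\<integral>x. indicator S x * f x \<partial>lborel)"

locale bounded_function =
  fixes f :: "'a::euclidean_space \<Rightarrow> real" and b :: real
  assumes meas[measurable]: "f \<in> borel_measurable borel" and bdd: "\<bar>f x\<bar> \<le> b"
begin

lemma b_nonneg: "0 \<le> b" using bdd[of undefined] by linarith

lemma integrable_over:
  assumes "bounded S" and [measurable]: "S \<in> sets borel"
  shows "integrable lborel (\<lambda>x. indicator S x * f x)"
proof (rule Bochner_Integration.integrable_bound)
  show "integrable lborel (\<lambda>x. b * indicator S x)"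
    using emeasure_bounded_finite[OF assms(1)] by simp
  show "AE x in lborel. norm (indicator S x * f x) \<le> norm (b * indicator S x)"
    using bdd b_nonneg by (intro AE_I2) (auto simp: indicator_def)
qed measurable

lemma integral_over_bound:
  assumes S: "bounded S" and [measurable]: "S \<in> sets borel" and c: "\<And>x. x \<in> S \<Longrightarrow> \<bar>f x\<bar> \<le> c"
  shows "\<bar>integral_over f S\<bar> \<le> c * measure lborel S"
proof -
  have "\<bar>integral_over f S\<bar> \<le> (\<integral>x. \<bar>indicator S x * f x\<bar> \<partial>lborel)"
    unfolding integral_over_def by (rule integral_abs_bound)
  also have "\<dots> \<le> (\<integral>x. c * indicator S x \<partial>lborel)"
  proof (rule integral_mono)
    show "integrable lborel (\<lambda>x. \<bar>indicator S x * f x\<bar>)"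
      by (rule integrable_abs[OF integrable_over[OF S assms(2)]])
    show "integrable lborel (\<lambda>x. c * indicator S x)"
      using emeasure_bounded_finite[OF S] by simp
    show "\<bar>indicator S x * f x\<bar> \<le> c * indicator S x" for x using c by (auto simp: indicator_def)
  qed
  also have "\<dots> = c * measure lborel S" by simp
  finally show ?thesis .
qed

lemma integral_over_split:
  assumes "bounded T" "S \<subseteq> T" and [measurable]: "S \<in> sets borel" "T \<in> sets borel"
  shows "integral_over f T = integral_over f S + integral_over f (T - S)"
proof -
  have "integral_over f T = (\<integral>x. indicator S x * f x + indicator (T - S) x * f x \<partial>lborel)"
    unfolding integral_over_def using assms(2) by (intro Bochner_Integration.integral_cong) (auto simp: indicator_def)
  also have "\<dots> = integral_over f S + integral_over f (T - S)" unfolding integral_over_def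
    using assms(1,2) by (intro Bochner_Integration.integral_add integrable_over) (auto intro: bounded_subset)
  finally show ?thesis .
qed

lemma integral_over_Un:
  assumes S: "bounded S" "S \<in> sets borel" and T: "bounded T" "T \<in> sets borel" and null: "S \<inter> T \<in> null_sets lborel"
  shows "integral_over f (S \<union> T) = integral_over f S + integral_over f T"
proof -
  have "integral_over f (S \<union> T) = integral_over f S + integral_over f ((S \<union> T) - S)"
    using S T by (intro integral_over_split) auto
  also have "(S \<union> T) - S = T - S \<inter> T" by blast
  also have "integral_over f T = integral_over f (S \<inter> T) + integral_over f (T - S \<inter> T)"
    using S T by (intro integral_over_split) auto
  moreover have "\<bar>integral_over f (S \<inter> T)\<bar> \<le> b * measure lborel (S \<inter> T)"
    using S T bdd by (intro integral_over_bound) (auto intro: bounded_subset)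
  then have "integral_over f (S \<inter> T) = 0" using null by (simp add: measure_eq_0_null_sets)
  ultimately show ?thesis by simp
qed

lemma integral_over_UN:
  assumes "finite I" and T: "\<And>i. i \<in> I \<Longrightarrow> bounded (T i)" "\<And>i. i \<in> I \<Longrightarrow> T i \<in> sets borel"
    and null: "\<And>i j. i \<in> I \<Longrightarrow> j \<in> I \<Longrightarrow> i \<noteq> j \<Longrightarrow> T i \<inter> T j \<in> null_sets lborel"
  shows "integral_over f (\<Union>i\<in>I. T i) = (\<Sum>i\<in>I. integral_over f (T i))"
  using assms
proof (induction I rule: finite_induct)
  case empty show ?case by (simp add: integral_over_def)
next
  case (insert i I)
  have "T i \<inter> (\<Union>j\<in>I. T j) = (\<Union>j\<in>I. T i \<inter> T j)" by blast
  also have "\<dots> \<in> null_sets lborel"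
    using insert by (intro null_sets.finite_UN) auto
  finally have "integral_over f (T i \<union> (\<Union>j\<in>I. T j)) = integral_over f (T i) + integral_over f (\<Union>j\<in>I. T j)"
    using insert.prems insert.hyps(1) by (intro integral_over_Un bounded_UN) auto
  then show ?case using insert by simp
qed

lemma integral_over_translation:
  assumes [measurable]: "S \<in> sets borel"
  shows "integral_over f ((+) a ` S) = integral_over (\<lambda>x. f (a + x)) S"
proof -
  have [measurable]: "(+) a ` S \<in> sets borel" by (rule translation_measure(1)) fact
  have "integral_over f ((+) a ` S) = (\<integral>x. indicator ((+) a ` S) x * f x \<partial>distr lborel borel ((+) a))"
    unfolding integral_over_def by (simp add: lborel_distr_plus)
  also have "\<dots> = (\<integral>x. indicator ((+) a ` S) (a + x) * f (a + x) \<partial>lborel)"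
    by (rule integral_distr) measurable
  also have "\<dots> = integral_over (\<lambda>x. f (a + x)) S"
    unfolding integral_over_def by (intro Bochner_Integration.integral_cong) (auto simp: indicator_def)
  finally show ?thesis .
qed

end

lemma integral_over_diff:
  assumes f: "bounded_function f b" and g: "bounded_function g c" and S: "bounded S" "S \<in> sets borel"
  shows "integral_over (\<lambda>x. f x - g x) S = integral_over f S - integral_over g S"
  unfolding integral_over_def right_diff_distrib
  by (intro Bochner_Integration.integral_diff bounded_function.integrable_over[OF f S] bounded_function.integrable_over[OF g S])

lemma integral_over_const: "bounded S \<Longrightarrow> S \<in> sets borel \<Longrightarrow> integral_over (\<lambda>_. c) S = c * measure lborel S"
  by (simp add: integral_over_def mult.commute)

lemma bounded_function_diff: "bounded_function f b \<Longrightarrow> bounded_function g c \<Longrightarrow> bounded_function (\<lambda>x. f x - g x) (b + c)"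
proof (unfold bounded_function_def, intro conjI allI; elim conjE)
  fix x assume "\<forall>x. \<bar>f x\<bar> \<le> b" "\<forall>x. \<bar>g x\<bar> \<le> c"
  then have "\<bar>f x\<bar> \<le> b" "\<bar>g x\<bar> \<le> c" by auto
  then show "\<bar>f x - g x\<bar> \<le> b + c" by linarith
qed measurable

lemma bounded_function_const: "bounded_function (\<lambda>_. c) \<bar>c\<bar>"
  by (simp add: bounded_function_def)

section \<open>Contraction of convex combinations\<close>

text \<open>A coupling argument: with product weights on pairs, every pair contributes a difference
  of at most \<open>c\<close>, and the pair (i0, k0), of mass at least d * d, one of at most
  \<open>e\<close>.\<close>

lemma convex_combinations_close:
  fixes w v X Y :: "_ \<Rightarrow> real"
  assumes fin: "finite I" "finite K" and w: "\<And>i. i \<in> I \<Longrightarrow> 0 \<le> w i" "sum w I = 1"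
    and v: "\<And>k. k \<in> K \<Longrightarrow> 0 \<le> v k" "sum v K = 1"
    and c: "\<And>i k. i \<in> I \<Longrightarrow> k \<in> K \<Longrightarrow> \<bar>X i - Y k\<bar> \<le> c"
    and e: "i0 \<in> I" "k0 \<in> K" "\<bar>X i0 - Y k0\<bar> \<le> e" "e \<le> c"
    and d: "0 \<le> d" "d \<le> w i0" "d \<le> v k0"
  shows "\<bar>(\<Sum>i\<in>I. w i * X i) - (\<Sum>k\<in>K. v k * Y k)\<bar> \<le> c - d * d * (c - e)"
proof -
  let ?Z = "I \<times> K"
  have ww: "(\<Sum>(i, k)\<in>?Z. w i * v k) = 1"
    using w v by (simp add: sum_product[symmetric] flip: sum.cartesian_product)
  have "(\<Sum>i\<in>I. w i * X i) = (\<Sum>(i, k)\<in>?Z. w i * v k * X i)"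
  proof -
    have "(\<Sum>(i, k)\<in>?Z. w i * v k * X i) = (\<Sum>i\<in>I. \<Sum>k\<in>K. (w i * X i) * v k)"
      by (simp add: sum.cartesian_product[symmetric] mult_ac)
    also have "\<dots> = (\<Sum>i\<in>I. w i * X i)" by (simp add: v flip: sum_distrib_left)
    finally show ?thesis ..
  qed
  moreover have "(\<Sum>k\<in>K. v k * Y k) = (\<Sum>(i, k)\<in>?Z. w i * v k * Y k)"
  proof -
    have "(\<Sum>(i, k)\<in>?Z. w i * v k * Y k) = (\<Sum>i\<in>I. w i * (\<Sum>k\<in>K. v k * Y k))"
      by (simp add: sum.cartesian_product[symmetric] mult_ac sum_distrib_left)
    also have "\<dots> = (\<Sum>k\<in>K. v k * Y k)" using w by (simp flip: sum_distrib_right)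
    finally show ?thesis ..
  qed
  ultimately have "(\<Sum>i\<in>I. w i * X i) - (\<Sum>k\<in>K. v k * Y k) = (\<Sum>(i, k)\<in>?Z. w i * v k * (X i - Y k))"
    by (simp add: case_prod_unfold right_diff_distrib sum_subtractf)
  also have "\<bar>\<dots>\<bar> \<le> (\<Sum>(i, k)\<in>?Z. w i * v k * \<bar>X i - Y k\<bar>)"
    by (rule order_trans[OF sum_abs]) (use w v in \<open>auto intro!: sum_mono simp: abs_mult\<close>)
  also have "\<dots> \<le> (\<Sum>(i, k)\<in>?Z. w i * v k * (c - (if (i, k) = (i0, k0) then c - e else 0)))"
    using c e w v by (intro sum_mono) (auto intro!: mult_left_mono)
  also have "\<dots> = (\<Sum>(i, k)\<in>?Z. w i * v k) * c - (\<Sum>(i, k)\<in>?Z. w i * v k * (if (i, k) = (i0, k0) then c - e else 0))"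
    by (simp add: case_prod_unfold right_diff_distrib sum_subtractf sum_distrib_right)
  also have "(\<Sum>(i, k)\<in>?Z. w i * v k * (if (i, k) = (i0, k0) then c - e else 0)) = w i0 * v k0 * (c - e)"
  proof -
    have "(\<Sum>(i, k)\<in>?Z. w i * v k * (if (i, k) = (i0, k0) then c - e else 0))
      = (\<Sum>t\<in>?Z. if t = (i0, k0) then w (fst t) * v (snd t) * (c - e) else 0)"
      by (rule sum.cong) (auto split: if_splits)
    also have "\<dots> = w i0 * v k0 * (c - e)" using e(1,2) fin by (subst sum.delta) auto
    finally show ?thesis .
  qed
  also have "(\<Sum>(i, k)\<in>?Z. w i * v k) * c - w i0 * v k0 * (c - e) \<le> c - d * d * (c - e)"
  proof -
    have "d * d * (c - e) \<le> w i0 * v k0 * (c - e)" using d e(4) by (intro mult_right_mono mult_mono) auto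
    then show ?thesis using ww by simp
  qed
  finally show ?thesis .
qed

section \<open>Averages over supertiles\<close>

context self_affine_tiling
begin

lemma supertile_closed: "closed (supertile m x j)"
  unfolding supertile_def by (rule closed_translation[OF inflated_closed])

lemma supertile_overlap_null:
  assumes "(x, i) \<in> L" "(y, j) \<in> L" "(x, i) \<noteq> (y, j)"
  shows "supertile m x i \<inter> supertile m y j \<in> null_sets lborel"
proof (rule null_sets_subset)
  show "frontier (supertile m x i) \<union> frontier (supertile m y j) \<in> null_sets lborel"
    by (intro null_sets.Un supertile_frontier_null)
  show "supertile m x i \<inter> supertile m y j \<subseteq> frontier (supertile m x i) \<union> frontier (supertile m y j)"
    using supertile_packing[OF assms(1,2)] assms(3) closure_closed[OF supertile_closed] unfolding frontier_def by blast
qed (use supertile_borel in auto)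

lemma integral_over_children:
  assumes "bounded_function f b" "(x, j) \<in> L"
  shows "integral_over f (supertile (m + k) x j) = (\<Sum>(u, i)\<in>pieces k j. integral_over f (supertile m (QQ k x + u) i))"
proof -
  interpret bounded_function f b by fact
  have eq: "supertile (m + k) x j = (\<Union>t\<in>pieces k j. supertile m (QQ k x + fst t) (snd t))"
    unfolding supertile_pieces by (simp add: case_prod_unfold)
  show ?thesis unfolding eq case_prod_unfold
  proof (rule integral_over_UN[OF finite_pieces supertile_bounded supertile_borel])
    fix s t assume st: "s \<in> pieces k j" "t \<in> pieces k j" "s \<noteq> t"
    then have "(QQ k x + fst s, snd s) \<in> L" "(QQ k x + fst t, snd t) \<in> L"
      using L_child[OF assms(2)] by auto
    then show "supertile m (QQ k x + fst s) (snd s) \<inter> supertile m (QQ k x + fst t) (snd t) \<in> null_sets lborel"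
      using st(3) by (intro supertile_overlap_null) (auto simp: prod_eq_iff)
  qed
qed

text \<open>The integral of the constant 1 over a supertile. For m = 0 and k = 1 it says that the
  prototile volumes form a left eigenvector of the substitution matrix with eigenvalue
  \<open>q\<close>.\<close>

lemma vol_children: "vol (inflated (m + k) j) = (\<Sum>(u, i)\<in>pieces k j. vol (inflated m i))"
proof -
  obtain x where "(x, j) \<in> L" using all_types by blast
  from integral_over_children[OF bounded_function_const[of 1] this, of m k] show ?thesis
    by (simp add: integral_over_const supertile_bounded supertile_borel supertile_vol case_prod_unfold)
qed

text \<open>A tile seen within \<open>r\<close> of a point deep inside a supertile has an interior
  point in the interior of that supertile, so it is one of its children. The supertile at
  \<open>y\<close> has the same children, translated.\<close>

lemma core_patch:
  assumes xy: "(x, j) \<in> L" "(y, j) \<in> L" and R: "\<forall>i. \<forall>a\<in>A i. norm a \<le> R"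
    and h: "h \<in> core (r + R) (inflated m j)"
    and z: "norm z < r" "(z + (QQ m x + h), i) \<in> L"
  shows "(z + (QQ m y + h), i) \<in> L"
proof -
  obtain x' j' u where p: "(x', j') \<in> L" "(u, i) \<in> pieces m j'" "z + (QQ m x + h) = QQ m x' + u"
    using L_parent[OF z(2), of m] by blast
  obtain a where a: "a \<in> interior (A i)" using A_closure[of i] A_nonempty[of i] by (metis closure_empty ex_in_conv)
  \<comment> \<open>An interior point of the tile, which decides the supertile to which the tile
    belongs.\<close>
  define c where "c = z + (QQ m x + h) + a"
  have "norm (z + a) < r + R"
    using norm_triangle_ineq[of z a] z(1) R a interior_subset by fastforce
  then have "h + (z + a) \<in> ball h (r + R)"
    by (metis add_diff_cancel_left' dist_commute dist_norm mem_ball)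
  also have "ball h (r + R) \<subseteq> interior (inflated m j)"
    using h by (intro interior_maximal) (auto simp: core_def)
  finally have "c \<in> interior (supertile m x j)" unfolding supertile_def mem_interior_translation c_def by (simp add: algebra_simps)
  moreover have "c \<in> interior (supertile m x' j')"
  proof -
    have "(+) u ` A i \<subseteq> inflated m j'" using p(2) unfolding inflated_eq_tiles[of m j'] by blast
    then have "interior ((+) u ` A i) \<subseteq> interior (inflated m j')" by (rule interior_mono)
    moreover have "u + a \<in> interior ((+) u ` A i)" using a by (simp add: mem_interior_translation)
    ultimately have "u + a \<in> interior (inflated m j')" by blast
    then show ?thesis unfolding supertile_def mem_interior_translation c_def p(3) by (simp add: algebra_simps)
  qed
  ultimately have "x = x' \<and> j = j'" using supertile_packing[OF xy(1) p(1)] by blast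
  then have "(u, i) \<in> pieces m j" "u = z + h" using p by (auto simp: algebra_simps)
  then show ?thesis using L_child[OF xy(2), of u i m] by (simp add: algebra_simps)
qed

end

text \<open>\<open>\<phi>\<close> stands for \<open>h \<mapsto> f (\<T> - h)\<close>; up to a small error \<open>\<phi> g\<close> depends only on
  the patch of the tiling around \<open>g\<close>.\<close>

locale tiling_observable = self_affine_tiling A Q P D L q l
  for A :: "'k::finite \<Rightarrow> (real ^ 'n::finite) set" and Q P D L q l +
  fixes \<phi> :: "real ^ 'n \<Rightarrow> real" and B :: real
  assumes \<phi>_bdd: "\<bar>\<phi> x\<bar> \<le> B"
    and \<phi>_ucont: "0 < e \<Longrightarrow> \<exists>d>0. \<forall>g h. norm (g - h) < d \<longrightarrow> \<bar>\<phi> g - \<phi> h\<bar> < e"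
    and \<phi>_local: "0 < e \<Longrightarrow> \<exists>r>0. \<forall>g h.
      (\<forall>z i. norm z < r \<longrightarrow> ((z + g, i) \<in> L \<longleftrightarrow> (z + h, i) \<in> L)) \<longrightarrow> \<bar>\<phi> g - \<phi> h\<bar> < e"
begin

lemma \<phi>_continuous: "continuous_on UNIV \<phi>"
  unfolding continuous_on_iff
proof (intro ballI allI impI)
  fix x and e :: real assume "0 < e"
  then show "\<exists>d>0. \<forall>x'\<in>UNIV. dist x' x < d \<longrightarrow> dist (\<phi> x') (\<phi> x) < e"
    using \<phi>_ucont[of e] by (auto simp: dist_norm dist_real_def)
qed

lemma \<phi>_bf: "bounded_function (\<lambda>x. \<phi> (a + x)) B"
proof
  have "continuous_on UNIV (\<lambda>x. \<phi> (a + x))"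
    by (rule continuous_on_compose2[OF \<phi>_continuous]) (auto intro: continuous_intros)
  then show "(\<lambda>x. \<phi> (a + x)) \<in> borel_measurable borel" by (rule borel_measurable_continuous_onI)
qed (rule \<phi>_bdd)

lemma \<phi>_bf0: "bounded_function \<phi> B" using \<phi>_bf[of 0] by simp

definition Av :: "nat \<Rightarrow> real ^ 'n \<Rightarrow> 'k \<Rightarrow> real" where
  "Av m x j = integral_over \<phi> (supertile m x j) / vol (inflated m j)"

lemma integral_over_Av: "integral_over \<phi> (supertile m x j) = Av m x j * vol (inflated m j)"
  using inflated_vol_pos[of m j] by (simp add: Av_def)

lemma Av_children:
  assumes "(x, j) \<in> L"
  shows "Av (m + k) x j = (\<Sum>(u, i)\<in>pieces k j. vol (inflated m i) / vol (inflated (m + k) j) * Av m (QQ k x + u) i)"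
  unfolding Av_def[of "m + k"] integral_over_children[OF \<phi>_bf0 assms]
  by (simp add: integral_over_Av sum_divide_distrib case_prod_unfold mult.commute)

text \<open>On the core of the two supertiles the surrounding patches agree and \<phi> differs
  little. The remaining layer has small relative volume, and there the crude bound 2 * B
  suffices.\<close>

lemma Av_same_type:
  assumes e: "0 < e"
  shows "\<exists>K. \<forall>m\<ge>K. \<forall>x y j. (x, j) \<in> L \<longrightarrow> (y, j) \<in> L \<longrightarrow> \<bar>Av m x j - Av m y j\<bar> \<le> e"
proof -
  have B: "0 \<le> B" using \<phi>_bdd[of 0] by linarith
  have e2: "0 < e/2" using e by simp
  obtain r where r: "r > 0" "\<And>g h. (\<And>z i. norm z < r \<Longrightarrow> (z + g, i) \<in> L \<longleftrightarrow> (z + h, i) \<in> L) \<Longrightarrow> \<bar>\<phi> g - \<phi> h\<bar> < e/2"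
    using \<phi>_local[OF e2] by blast
  obtain R where R: "R > 0" "\<And>i x. x \<in> A i \<Longrightarrow> norm x \<le> R" using outradius by blast
  \<comment> \<open>With this choice the layer contributes at most 2 * B * d \<le> e/2, relative to
    the volume; the summand 1 covers B = 0.\<close>
  define d where "d = e / (4 * (B + 1))"
  have d: "0 < d" using e B by (simp add: d_def)
  have rR: "0 < r + R" using r R by simp
  obtain K where K: "\<And>m j. m \<ge> K \<Longrightarrow> vol (inflated m j) - vol (core (r + R) (inflated m j)) \<le> d * vol (inflated m j)"
    using core_ratio[OF d rR] by blast
  have "\<bar>Av m x j - Av m y j\<bar> \<le> e" if m: "m \<ge> K" and x: "(x, j) \<in> L" and y: "(y, j) \<in> L" for m x y j
  proof -
    let ?f = "\<lambda>h. \<phi> (QQ m x + h) - \<phi> (QQ m y + h)"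
    let ?C = "core (r + R) (inflated m j)"
    interpret bounded_function ?f "B + B" by (rule bounded_function_diff[OF \<phi>_bf \<phi>_bf])
    have Cb: "?C \<in> sets borel" by (rule borel_closed[OF closed_core])
    have CF: "?C \<subseteq> inflated m j" by (rule core_subset[OF rR])
    have bC: "bounded ?C" using CF inflated_bounded bounded_subset by blast
    have "integral_over \<phi> (supertile m x j) - integral_over \<phi> (supertile m y j) = integral_over ?f (inflated m j)"
      unfolding supertile_def bounded_function.integral_over_translation[OF \<phi>_bf0 inflated_borel]
      by (rule integral_over_diff[OF \<phi>_bf \<phi>_bf inflated_bounded inflated_borel, symmetric])
    also have "\<dots> = integral_over ?f ?C + integral_over ?f (inflated m j - ?C)"
      by (rule integral_over_split[OF inflated_bounded CF Cb inflated_borel])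
    finally have tri: "\<bar>integral_over \<phi> (supertile m x j) - integral_over \<phi> (supertile m y j)\<bar>
      \<le> \<bar>integral_over ?f ?C\<bar> + \<bar>integral_over ?f (inflated m j - ?C)\<bar>" by linarith
    have "\<bar>integral_over ?f ?C\<bar> \<le> e/2 * vol ?C"
    proof (rule integral_over_bound[OF bC Cb])
      fix h assume h: "h \<in> ?C"
      have "\<bar>\<phi> (QQ m x + h) - \<phi> (QQ m y + h)\<bar> < e/2"
      proof (rule r(2))
        have R': "\<forall>i. \<forall>a\<in>A i. norm a \<le> R" using R(2) by blast
        fix z :: "real ^ 'n" and i assume "norm z < r"
        then show "(z + (QQ m x + h), i) \<in> L \<longleftrightarrow> (z + (QQ m y + h), i) \<in> L"
          using core_patch[OF x y R' h] core_patch[OF y x R' h] by blast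
      qed
      then show "\<bar>\<phi> (QQ m x + h) - \<phi> (QQ m y + h)\<bar> \<le> e/2" by simp
    qed
    also have "\<dots> \<le> e/2 * vol (inflated m j)"
    proof (rule mult_left_mono)
      show "vol ?C \<le> vol (inflated m j)" using CF Cb inflated_bounded inflated_borel
        by (intro measure_mono_fmeasurable bounded_borel_fmeasurable) auto
    qed (use e in simp)
    finally have 1: "\<bar>integral_over ?f ?C\<bar> \<le> e/2 * vol (inflated m j)" .
    have "\<bar>integral_over ?f (inflated m j - ?C)\<bar> \<le> (B + B) * vol (inflated m j - ?C)"
      using bdd inflated_bounded inflated_borel Cb by (intro integral_over_bound bounded_diff) auto
    also have "vol (inflated m j - ?C) = vol (inflated m j) - vol ?C"
      using CF Cb inflated_bounded inflated_borel emeasure_bounded_finite[OF inflated_bounded, of m j]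
      by (intro measure_Diff) auto
    also have "(B + B) * (vol (inflated m j) - vol ?C) \<le> (B + B) * (d * vol (inflated m j))"
      using K[OF m] B by (intro mult_left_mono) auto
    also have "\<dots> \<le> e/2 * vol (inflated m j)"
    proof -
      have "(B + B) * d \<le> e/2" using e B by (simp add: d_def field_simps)
      then have "(B + B) * d * vol (inflated m j) \<le> e/2 * vol (inflated m j)" by (rule mult_right_mono) simp
      then show ?thesis by (simp only: mult.assoc)
    qed
    finally have "\<bar>integral_over \<phi> (supertile m x j) - integral_over \<phi> (supertile m y j)\<bar> \<le> e * vol (inflated m j)"
      using 1 tri by linarith
    then have "\<bar>integral_over \<phi> (supertile m x j) - integral_over \<phi> (supertile m y j)\<bar> / vol (inflated m j) \<le> e"
      using inflated_vol_pos[of m j] by (simp only: pos_divide_le_eq)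
    moreover have "\<bar>Av m x j - Av m y j\<bar> = \<bar>integral_over \<phi> (supertile m x j) - integral_over \<phi> (supertile m y j)\<bar> / vol (inflated m j)"
      unfolding Av_def diff_divide_distrib[symmetric] abs_divide using inflated_vol_pos[of m j] by simp
    ultimately show ?thesis by simp
  qed
  then show ?thesis by blast
qed

lemma Av_bdd: "\<bar>Av m x j\<bar> \<le> B"
proof -
  have "\<bar>integral_over \<phi> (supertile m x j)\<bar> \<le> B * vol (supertile m x j)"
    by (rule bounded_function.integral_over_bound[OF \<phi>_bf0 supertile_bounded supertile_borel]) (rule \<phi>_bdd)
  then show ?thesis using inflated_vol_pos[of m j] by (simp add: Av_def supertile_vol pos_divide_le_eq)
qed

lemma Av_osc:
  assumes e: "0 < e"
  shows "\<exists>m. \<forall>x i y j. (x, i) \<in> L \<longrightarrow> (y, j) \<in> L \<longrightarrow> \<bar>Av m x i - Av m y j\<bar> \<le> e"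
proof -
  \<comment> \<open>The share of volume that a child of type \<open>i\<close>, \<open>l\<close>
    levels down, has in a supertile of type \<open>j\<close>. The powers of \<open>q\<close> cancel,
    so it does not depend on the level.\<close>
  define w where "w i j = vol (A i) / (q ^ l * vol (A j))" for i j
  have wF: "vol (inflated m i) / vol (inflated (m + l) j) = w i j" for m i j
    using q_pos A_vol[of j] by (simp add: inflated_vol w_def power_add)
  have wpos: "0 < w i j" for i j using A_vol q_pos by (simp add: w_def)
  define d where "d = Min (range (\<lambda>(i, j). w i j))"
  have d: "d \<le> w i j" for i j unfolding d_def by (rule Min_le) auto
  have dpos: "0 < d" unfolding d_def using wpos by (subst Min_gr_iff) auto
  have wsum: "(\<Sum>(u, i)\<in>pieces l j. w i j) = 1" for j
  proof -
    have "(\<Sum>(u, i)\<in>pieces l j. w i j) = (\<Sum>(u, i)\<in>pieces l j. vol (inflated 0 i)) / vol (inflated (0 + l) j)"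
      unfolding sum_divide_distrib case_prod_unfold by (simp only: wF[of 0])
    then show ?thesis using vol_children[of 0 l j] inflated_vol_pos[of "0 + l" j] by simp
  qed
  have d1: "d \<le> 1"
  proof -
    fix j
    obtain u i where ui: "(u, i) \<in> pieces l j" using primitive by (fastforce simp: pieces_def)
    have "d \<le> w i j" by (rule d)
    also have "\<dots> \<le> (\<Sum>(u, i)\<in>pieces l j. w i j)"
      using member_le_sum[OF ui, of "\<lambda>(u, i). w i j"] wpos[THEN less_imp_le] finite_pieces by auto
    finally show ?thesis using wsum by simp
  qed
  obtain K where K: "\<And>m x y j. m \<ge> K \<Longrightarrow> (x, j) \<in> L \<Longrightarrow> (y, j) \<in> L \<Longrightarrow> \<bar>Av m x j - Av m y j\<bar> \<le> e/2"
    using Av_same_type[of "e/2"] e by (meson half_gt_zero)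
  \<comment> \<open>The solution of c (n + 1) = c n - d * d * (c n - e/2) with c 0 = e/2 + 2 * B.
    Its limit e/2 is the error left by \<open>Av_same_type\<close>.\<close>
  define c where "c n = e/2 + (1 - d * d) ^ n * (2 * B)" for n
  have B: "0 \<le> B" using \<phi>_bdd[of 0] by linarith
  have dd: "0 < d * d" "d * d \<le> 1" using dpos d1 by (auto intro: mult_le_one)
  have osc: "\<bar>Av (K + n * l) x i - Av (K + n * l) y j\<bar> \<le> c n" if "(x, i) \<in> L" "(y, j) \<in> L" for n x i y j
    using that
  proof (induction n arbitrary: x i y j)
    case 0
    have "\<bar>Av K x i - Av K y j\<bar> \<le> 2 * B" using Av_bdd[of K x i] Av_bdd[of K y j] by linarith
    then show ?case using e by (simp add: c_def)
  next
    case (Suc n)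
    let ?m = "K + n * l"
    have eq: "Av (K + Suc n * l) x j = (\<Sum>t\<in>pieces l j. w (snd t) j * Av ?m (QQ l x + fst t) (snd t))"
      if "(x, j) \<in> L" for x j
      using Av_children[OF that, of ?m l] unfolding case_prod_unfold wF by (simp add: add.commute add.left_commute)
    \<comment> \<open>Any type will do: by primitivity both supertiles have a child of type
      \<open>i0\<close>, and the averages over these two children are already within e/2 of each
      other.\<close>
    fix i0 :: 'k
    obtain u v where uv: "(u, i0) \<in> pieces l i" "(v, i0) \<in> pieces l j" using primitive by (fastforce simp: pieces_def)
    have "\<bar>Av (K + Suc n * l) x i - Av (K + Suc n * l) y j\<bar> \<le> c n - d * d * (c n - e/2)"
      unfolding eq[OF Suc.prems(1)] eq[OF Suc.prems(2)]
    proof (rule convex_combinations_close[OF finite_pieces finite_pieces _ _ _ _ _ uv])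
      show "sum (\<lambda>t. w (snd t) i) (pieces l i) = 1" "sum (\<lambda>t. w (snd t) j) (pieces l j) = 1"
        using wsum by (simp_all add: case_prod_unfold)
      show "\<bar>Av ?m (QQ l x + fst s) (snd s) - Av ?m (QQ l y + fst t) (snd t)\<bar> \<le> c n"
        if "s \<in> pieces l i" "t \<in> pieces l j" for s t
        using that L_child[OF Suc.prems(1), of "fst s" "snd s" l] L_child[OF Suc.prems(2), of "fst t" "snd t" l]
        by (intro Suc.IH) auto
      show "\<bar>Av ?m (QQ l x + fst (u, i0)) (snd (u, i0)) - Av ?m (QQ l y + fst (v, i0)) (snd (v, i0))\<bar> \<le> e/2"
        unfolding fst_conv snd_conv
        by (rule K[OF le_add1 L_child[OF Suc.prems(1) uv(1)] L_child[OF Suc.prems(2) uv(2)]])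
      show "e/2 \<le> c n" using B dd by (simp add: c_def)
    qed (use wpos d dpos in \<open>auto intro: less_imp_le\<close>)
    also have "c n - d * d * (c n - e/2) = c (Suc n)" by (simp add: c_def algebra_simps)
    finally show ?case .
  qed
  have "(\<lambda>n. (1 - d * d) ^ n * (2 * B)) \<longlonglongrightarrow> 0 * (2 * B)"
    using dd by (intro tendsto_intros LIMSEQ_power_zero) auto
  then have "eventually (\<lambda>n. (1 - d * d) ^ n * (2 * B) < e/2) sequentially" using e by (intro order_tendstoD(2)) auto
  then obtain n where "(1 - d * d) ^ n * (2 * B) < e/2" using eventually_happens trivial_limit_sequentially by blast
  then have "c n \<le> e" by (simp add: c_def)
  then show ?thesis using osc[of _ _ _ _ n] by (intro exI[of _ "K + n * l"]) (meson order_trans)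
qed

section \<open>From supertiles to arbitrary translates and to finite sums\<close>

text \<open>\<open>S\<close> is an inflated prototile much larger than the supertiles of the level
  \<open>m\<close> supplied by \<open>Av_osc\<close>. Any translate of it is filled by such
  supertiles up to a boundary layer, whether or not it is itself a supertile, so one
  \<open>S\<close> serves all \<open>h\<close>.\<close>

lemma averages_near_constant:
  assumes e: "0 < e"
  shows "\<exists>S c. bounded S \<and> S \<in> sets borel \<and> 0 < vol S \<and>
    (\<forall>h. \<bar>integral_over (\<lambda>x. \<phi> (h + x)) S - c * vol S\<bar> \<le> e * vol S)"
proof -
  have B: "0 \<le> B" using \<phi>_bdd[of 0] by linarith
  have e2: "0 < e/2" using e by simp
  obtain m where m: "\<And>x i y j. (x, i) \<in> L \<Longrightarrow> (y, j) \<in> L \<Longrightarrow> \<bar>Av m x i - Av m y j\<bar> \<le> e/2"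
    using Av_osc[OF e2] by blast
  fix j0 :: 'k
  obtain x0 where x0: "(x0, j0) \<in> L" using all_types by blast
  define c where "c = Av m x0 j0"
  have cB: "\<bar>c\<bar> \<le> B" unfolding c_def by (rule Av_bdd)
  obtain R where R: "R > 0" "\<And>j p. p \<in> inflated m j \<Longrightarrow> norm p \<le> R"
  proof -
    have "bounded (\<Union>j. inflated m j)" using inflated_bounded by (intro bounded_UN) auto
    then show thesis using that by (auto simp: bounded_pos)
  qed
  \<comment> \<open>Points of one level-\<open>m\<close> supertile are at most 2 * R apart, so a
    supertile that meets the translated core lies inside the translate of the whole set. Hence
    complete supertiles cover the core.\<close>
  have R3: "0 < 3 * R" using R by simp
  define d where "d = e / (4 * (B + 1))"
  have d: "0 < d" using e B by (simp add: d_def)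
  obtain M where M: "vol (inflated M j0) - vol (core (3 * R) (inflated M j0)) \<le> d * vol (inflated M j0)"
    using core_ratio[OF d R3] by blast
  let ?inflated = "inflated M j0" and ?C = "core (3 * R) (inflated M j0)"
  have "\<bar>integral_over (\<lambda>x. \<phi> (h + x)) ?inflated - c * vol ?inflated\<bar> \<le> e * vol ?inflated" for h
  proof -
    let ?G = "(+) h ` ?inflated"
    define I where "I = {(x, j) \<in> L. supertile m x j \<subseteq> ?G}"
    have Gb: "?G \<in> sets borel" "bounded ?G"
      by (rule translation_measure(1)[OF inflated_borel], rule bounded_translation[OF inflated_bounded])
    have volG: "vol ?G = vol ?inflated" by (rule translation_measure(2)[OF inflated_borel])
    have "finite I"
    proof -
      obtain r where r: "\<And>p. p \<in> ?G \<Longrightarrow> norm p \<le> r" using Gb(2) by (auto simp: bounded_iff)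
      have "bounded ((P ^^ m) ` cball 0 (r + R))"
      proof -
        have "linear (P ^^ m)"
        proof (induction m)
          case 0 show ?case by (simp add: linear_iff)
        next
          case (Suc m) show ?case using linear_compose[OF Suc linP] by (simp add: o_def)
        qed
        then show ?thesis by (intro bounded_linear_image) (auto simp: linear_conv_bounded_linear)
      qed
      then obtain s where s: "\<And>p. norm p \<le> r + R \<Longrightarrow> norm ((P ^^ m) p) \<le> s"
        unfolding bounded_iff by (meson imageI mem_cball_0)
      have "norm x \<le> s" if "(x, j) \<in> I" for x j
      proof -
        have sub: "supertile m x j \<subseteq> ?G" using that by (simp add: I_def)
        obtain a where a: "a \<in> inflated m j" using A_nonempty[of j] unfolding inflated_def by blast
        then have "QQ m x + a \<in> supertile m x j" by (simp add: supertile_def)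
        then have "norm (QQ m x + a) \<le> r" using r sub by blast
        then have "norm (QQ m x) \<le> r + R" using norm_triangle_ineq4[of "QQ m x + a" a] R(2)[OF a] by simp
        then show ?thesis using s[of "QQ m x"] by (simp add: PPQQ)
      qed
      then have "I \<subseteq> {(x, j) \<in> L. norm x \<le> s}" by (auto simp: I_def)
      then show ?thesis using packing_locally_finite[OF L_packing] finite_subset by blast
    qed
    define U where "U = (\<Union>t\<in>I. supertile m (fst t) (snd t))"
    have UG: "U \<subseteq> ?G" by (auto simp: U_def I_def)
    have Ub: "U \<in> sets borel" unfolding U_def by (intro sets.finite_UN \<open>finite I\<close> supertile_borel)
    have bU: "bounded U" using UG Gb(2) bounded_subset by blast
    have CU: "(+) h ` ?C \<subseteq> U"
    proof
      fix p assume p: "p \<in> (+) h ` ?C"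
      obtain x j where xj: "(x, j) \<in> L" "p \<in> supertile m x j" using supertile_cover by blast
      have "supertile m x j \<subseteq> ?G"
      proof
        fix p' assume "p' \<in> supertile m x j"
        then have "norm (p' - QQ m x) \<le> R" "norm (p - QQ m x) \<le> R" using xj(2) R(2) by (auto simp: supertile_iff)
        then have "norm (p - p') < 3 * R"
          using norm_triangle_ineq4[of "p - QQ m x" "p' - QQ m x"] R(1) by simp
        then have "p' - h \<in> ball (p - h) (3 * R)" by (simp add: dist_norm)
        moreover have "ball (p - h) (3 * R) \<subseteq> ?inflated" using p by (auto simp: core_def)
        ultimately show "p' \<in> ?G" by (auto simp: mem_translation_iff)
      qed
      then have "(x, j) \<in> I" using xj(1) by (simp add: I_def)
      then show "p \<in> U" using xj(2) unfolding U_def by force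
    qed
    have fm: "?G \<in> fmeasurable lborel" "U \<in> fmeasurable lborel"
      using Gb Ub bU by (auto intro: bounded_borel_fmeasurable)
    have volU: "vol ?C \<le> vol U"
    proof -
      have Cb: "?C \<in> sets borel" by (rule borel_closed[OF closed_core])
      have "vol ((+) h ` ?C) \<le> vol U"
        using translation_measure(1)[OF Cb] fm by (intro measure_mono_fmeasurable CU) auto
      then show ?thesis using translation_measure(2)[OF Cb] by simp
    qed
    have volUG: "vol U \<le> vol ?G" using UG Ub fm by (intro measure_mono_fmeasurable) auto
    have null: "supertile m (fst s) (snd s) \<inter> supertile m (fst t) (snd t) \<in> null_sets lborel"
      if "s \<in> I" "t \<in> I" "s \<noteq> t" for s t
      using that by (intro supertile_overlap_null) (auto simp: I_def)
    \<comment> \<open>With \<open>c\<close> subtracted, each complete supertile contributes at most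
      e/2 times its volume, and the leftover is controlled by the bound of the function.\<close>
    let ?f = "\<lambda>x. \<phi> x - c"
    have fbf: "bounded_function ?f (B + \<bar>c\<bar>)" by (rule bounded_function_diff[OF \<phi>_bf0 bounded_function_const])
    interpret bounded_function ?f "B + \<bar>c\<bar>" by (rule fbf)
    have U_sum: "integral_over g U = (\<Sum>t\<in>I. integral_over g (supertile m (fst t) (snd t)))"
      if "bounded_function g b" for g b
      unfolding U_def by (rule bounded_function.integral_over_UN[OF that \<open>finite I\<close> supertile_bounded supertile_borel null])
    have "\<bar>integral_over ?f U\<bar> \<le> (\<Sum>t\<in>I. \<bar>integral_over ?f (supertile m (fst t) (snd t))\<bar>)"
      unfolding U_sum[OF fbf] by (rule sum_abs)
    also have "\<dots> \<le> (\<Sum>t\<in>I. e/2 * vol (supertile m (fst t) (snd t)))"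
    proof (rule sum_mono)
      fix t assume "t \<in> I"
      then have t: "(fst t, snd t) \<in> L" by (auto simp: I_def)
      have "integral_over ?f (supertile m (fst t) (snd t)) = (Av m (fst t) (snd t) - c) * vol (inflated m (snd t))"
        unfolding integral_over_diff[OF \<phi>_bf0 bounded_function_const supertile_bounded supertile_borel]
          integral_over_const[OF supertile_bounded supertile_borel] integral_over_Av supertile_vol by (rule left_diff_distrib[symmetric])
      then have "\<bar>integral_over ?f (supertile m (fst t) (snd t))\<bar> = \<bar>Av m (fst t) (snd t) - c\<bar> * vol (inflated m (snd t))"
        using inflated_vol_pos[of m "snd t"] by (simp add: abs_mult)
      also have "\<dots> \<le> e/2 * vol (inflated m (snd t))" unfolding c_def
        using m[OF t x0] by (rule mult_right_mono) simp
      finally show "\<bar>integral_over ?f (supertile m (fst t) (snd t))\<bar> \<le> e/2 * vol (supertile m (fst t) (snd t))" by (simp add: supertile_vol)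
    qed
    also have "\<dots> = e/2 * vol U"
    proof -
      have "vol U = (\<Sum>t\<in>I. vol (supertile m (fst t) (snd t)))"
        using U_sum[OF bounded_function_const[of 1]]
        unfolding integral_over_const[OF supertile_bounded supertile_borel] integral_over_const[OF bU Ub] by simp
      then show ?thesis by (simp only: sum_distrib_left)
    qed
    also have "\<dots> \<le> e/2 * vol ?inflated" using volUG volG e by simp
    finally have 1: "\<bar>integral_over ?f U\<bar> \<le> e/2 * vol ?inflated" .
    have "\<bar>integral_over ?f (?G - U)\<bar> \<le> (B + \<bar>c\<bar>) * vol (?G - U)"
      using Gb Ub bdd by (intro integral_over_bound bounded_diff) auto
    also have "vol (?G - U) = vol ?G - vol U"
      using UG Gb Ub fmeasurableD2[OF fm(1)] by (intro measure_Diff) auto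
    also have "(B + \<bar>c\<bar>) * (vol ?G - vol U) \<le> (B + B) * (d * vol ?inflated)"
    proof (rule mult_mono)
      show "B + \<bar>c\<bar> \<le> B + B" using cB by simp
      show "vol ?G - vol U \<le> d * vol ?inflated" using volU volG M by linarith
      show "0 \<le> vol ?G - vol U" using volUG by simp
    qed (use B in simp)
    also have "\<dots> \<le> e/2 * vol ?inflated"
    proof -
      have "(B + B) * d \<le> e/2" using e B by (simp add: d_def field_simps)
      then have "(B + B) * d * vol ?inflated \<le> e/2 * vol ?inflated" by (rule mult_right_mono) simp
      then show ?thesis by (simp only: mult.assoc)
    qed
    finally have 2: "\<bar>integral_over ?f (?G - U)\<bar> \<le> e/2 * vol ?inflated" .
    have "integral_over (\<lambda>x. \<phi> (h + x)) ?inflated - c * vol ?inflated = integral_over \<phi> ?G - integral_over (\<lambda>_. c) ?G"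
      by (simp add: integral_over_const Gb volG bounded_function.integral_over_translation[OF \<phi>_bf0 inflated_borel])
    also have "\<dots> = integral_over ?f ?G"
      by (rule integral_over_diff[OF \<phi>_bf0 bounded_function_const Gb(2,1), symmetric])
    also have "\<dots> = integral_over ?f U + integral_over ?f (?G - U)"
      by (rule integral_over_split[OF Gb(2) UG Ub Gb(1)])
    finally show ?thesis using 1 2 by linarith
  qed
  then show ?thesis using inflated_bounded inflated_borel inflated_vol_pos by (intro exI[of _ ?inflated] exI[of _ c]) simp
qed

text \<open>A Riemann sum over a partition of \<open>S\<close> into small pieces, weighted by their
  relative volumes. Uniform continuity of \<phi> makes the error uniform in \<open>h\<close> for
  nodes and weights chosen once.\<close>

theorem finite_averages_near_constant:
  assumes e: "0 < e"
  shows "\<exists>(N::nat) w g c. (\<forall>k<N. 0 \<le> w k) \<and> (\<Sum>k<N. w k) = 1 \<and>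
    (\<forall>h. \<bar>(\<Sum>k<N. w k * \<phi> (h + g k)) - c\<bar> \<le> e)"
proof -
  have e2: "0 < e/2" using e by simp
  obtain S c where S: "bounded S" "S \<in> sets borel" "0 < vol S"
    and c: "\<And>h. \<bar>integral_over (\<lambda>x. \<phi> (h + x)) S - c * vol S\<bar> \<le> e/2 * vol S"
    using averages_near_constant[OF e2] by blast
  obtain d where d: "d > 0" "\<And>g h. norm (g - h) < d \<Longrightarrow> \<bar>\<phi> g - \<phi> h\<bar> < e/2" using \<phi>_ucont[OF e2] by blast
  have "compact (closure S)" using S(1) by (simp add: compact_closure)
  then obtain C where C: "finite C" "closure S \<subseteq> (\<Union>x\<in>C. ball x d)"
    using d(1) unfolding compact_eq_totally_bounded by blast
  obtain g N where g: "C = g ` {i::nat. i < N}" using finite_imp_nat_seg_image_inj_on[OF C(1)] by blast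
  define T where "T k = disjointed (\<lambda>k. S \<inter> ball (g k) d) k" for k
  define w where "w k = vol (T k) / vol S" for k
  have Tb: "T k \<in> sets borel" for k unfolding T_def
    using S(2) by (intro sets.range_disjointed_sets[THEN subsetD, OF _ rangeI, of "\<lambda>k. S \<inter> ball (g k) d" borel]) auto
  have Tsub: "T k \<subseteq> S \<inter> ball (g k) d" for k unfolding T_def by (rule disjointed_subset)
  have bT: "bounded (T k)" for k using Tsub S(1) bounded_subset by blast
  have TU: "(\<Union>k<N. T k) = S"
  proof -
    have "(\<Union>k<N. T k) = (\<Union>k<N. S \<inter> ball (g k) d)"
      using finite_UN_disjointed_eq[of "\<lambda>k. S \<inter> ball (g k) d" N] by (simp add: T_def atLeast0LessThan)
    also have "\<dots> = S" using C(2) closure_subset[of S] unfolding g by blast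
    finally show ?thesis .
  qed
  have Tnull: "T i \<inter> T k \<in> null_sets lborel" if "i \<noteq> k" for i k
    using disjoint_family_disjointed[of "\<lambda>k. S \<inter> ball (g k) d"] that
    unfolding disjoint_family_on_def T_def by simp
  have sum: "integral_over f S = (\<Sum>k<N. integral_over f (T k))" if "bounded_function f b" for f b
    using bounded_function.integral_over_UN[OF that, of "{..<N}" T] bT Tb Tnull unfolding TU by simp
  have vS: "vol S = (\<Sum>k<N. vol (T k))"
    using sum[OF bounded_function_const[of 1]] by (simp add: integral_over_const S bT Tb)
  show ?thesis
  proof (intro exI conjI allI impI)
    show "0 \<le> w k" for k using S(3) by (simp add: w_def)
    show "(\<Sum>k<N. w k) = 1" using vS S(3) by (simp add: w_def flip: sum_divide_distrib)
    fix h
    have "(\<Sum>k<N. w k * \<phi> (h + g k)) * vol S = (\<Sum>k<N. integral_over (\<lambda>_. \<phi> (h + g k)) (T k))"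
      unfolding sum_distrib_right using S(3)
      by (intro sum.cong refl) (simp add: integral_over_const bT Tb w_def)
    then have "\<bar>(\<Sum>k<N. w k * \<phi> (h + g k)) * vol S - integral_over (\<lambda>x. \<phi> (h + x)) S\<bar>
      = \<bar>\<Sum>k<N. integral_over (\<lambda>_. \<phi> (h + g k)) (T k) - integral_over (\<lambda>x. \<phi> (h + x)) (T k)\<bar>"
      by (simp add: sum[OF \<phi>_bf] sum_subtractf)
    also have "\<dots> \<le> (\<Sum>k<N. \<bar>integral_over (\<lambda>_. \<phi> (h + g k)) (T k) - integral_over (\<lambda>x. \<phi> (h + x)) (T k)\<bar>)"
      by (rule sum_abs)
    also have "\<dots> \<le> (\<Sum>k<N. e/2 * vol (T k))"
    proof (rule sum_mono)
      fix k
      have "integral_over (\<lambda>_. \<phi> (h + g k)) (T k) - integral_over (\<lambda>x. \<phi> (h + x)) (T k)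
        = integral_over (\<lambda>x. \<phi> (h + g k) - \<phi> (h + x)) (T k)"
        by (rule integral_over_diff[OF bounded_function_const \<phi>_bf bT Tb, symmetric])
      also have "\<bar>\<dots>\<bar> \<le> e/2 * vol (T k)"
      proof (rule bounded_function.integral_over_bound[OF bounded_function_diff[OF bounded_function_const \<phi>_bf] bT Tb])
        fix x assume "x \<in> T k"
        then have "x \<in> ball (g k) d" using Tsub by blast
        then have "norm (h + g k - (h + x)) < d" by (simp add: dist_norm)
        then show "\<bar>\<phi> (h + g k) - \<phi> (h + x)\<bar> \<le> e/2" using d(2) less_imp_le by blast
      qed
      finally show "\<bar>integral_over (\<lambda>_. \<phi> (h + g k)) (T k) - integral_over (\<lambda>x. \<phi> (h + x)) (T k)\<bar> \<le> e/2 * vol (T k)" .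
    qed
    also have "\<dots> = e/2 * vol S" unfolding vS by (rule sum_distrib_left[symmetric])
    finally have "\<bar>(\<Sum>k<N. w k * \<phi> (h + g k)) * vol S - c * vol S\<bar> \<le> e * vol S" using c[of h] by linarith
    then have "\<bar>(\<Sum>k<N. w k * \<phi> (h + g k)) - c\<bar> * vol S \<le> e * vol S"
      using S(3) by (simp add: abs_mult flip: left_diff_distrib)
    then show "\<bar>(\<Sum>k<N. w k * \<phi> (h + g k)) - c\<bar> \<le> e" using S(3) by simp
  qed
qed

end

section \<open>The hull as a compact action, and the conclusion\<close>

lemma (in compact_action) comb_sum:
  assumes "\<And>k. k < n \<Longrightarrow> 0 \<le> w k"
  shows "comb (\<Sum>k<n. w k) (\<lambda>f x. \<Sum>k<(n::nat). w k * f (act (g k) x))"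
  using assms
proof (induction n)
  case 0 show ?case using comb.zero by simp
next
  case (Suc n)
  have "comb (w n * 1) (\<lambda>f x. w n * f (act (g n) x))"
    by (rule comb.scale[OF comb.shift]) (simp add: Suc.prems)
  from comb.add[OF Suc.IH[OF Suc.prems] this] show ?case by simp
qed

lemma (in compact_action) uniformly_continuous:
  assumes f: "cont f" and e: "0 < e"
  shows "\<exists>r>0. \<forall>x\<in>M. \<forall>y\<in>M. d x y < r \<longrightarrow> \<bar>f x - f y\<bar> < e"
proof -
  have "uniformly_continuous_map (metric (M, d)) euclidean_metric f"
    using f compact by (intro continuous_imp_uniformly_continuous_map) simp
  then show ?thesis using e unfolding uniformly_continuous_map_def
    by (simp add: dist_real_def commute abs_minus_commute)
qed

context prototiles
begin

definition orbit_closure :: "('n, 'k) tile set \<Rightarrow> ('n, 'k) tile set set" where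
  "orbit_closure \<T> = TM.mtopology closure_of (range (\<lambda>g. tiling_shift g \<T>))"

lemma orbit_closure_subset: "orbit_closure \<T> \<subseteq> tilings_by A"
  unfolding orbit_closure_def using closure_of_subset_topspace[of TM.mtopology] by simp

lemma orbit_subset_orbit_closure: "\<T> \<in> tilings_by A \<Longrightarrow> tiling_shift g \<T> \<in> orbit_closure \<T>"
  unfolding orbit_closure_def using closure_of_subset[of "range (\<lambda>g. tiling_shift g \<T>)" TM.mtopology] tiling_shift_in by auto

lemma orbit_closure_metric: "Metric_space (orbit_closure \<T>) (tiling_dist A)"
  by (rule TM.subspace[OF orbit_closure_subset])

lemma orbit_closure_topology:
  "Metric_space.mtopology (orbit_closure \<T>) (tiling_dist A) = subtopology TM.mtopology (orbit_closure \<T>)"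
proof -
  interpret Submetric "tilings_by A" "tiling_dist A" "orbit_closure \<T>"
    by unfold_locales (rule orbit_closure_subset)
  show ?thesis by (rule mtopology_submetric)
qed

lemma tiling_hull_eq: "tiling_hull A \<T> = subtopology TM.mtopology (orbit_closure \<T>)"
  unfolding tiling_hull_def tilings_topology_def orbit_closure_def ..

lemma orbit_closure_action:
  assumes T: "\<T> \<in> tilings_by A"
  shows "compact_action (orbit_closure \<T>) (tiling_dist A) tiling_shift"
proof -
  interpret H: Metric_space "orbit_closure \<T>" "tiling_dist A" by (rule orbit_closure_metric)
  have top: "H.mtopology = subtopology TM.mtopology (orbit_closure \<T>)" by (rule orbit_closure_topology)
  show ?thesis
  proof
    have "closedin TM.mtopology (orbit_closure \<T>)" unfolding orbit_closure_def by (rule closedin_closure_of)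
    then have "compactin TM.mtopology (orbit_closure \<T>)" using tilings_compact closedin_compact_space by blast
    then show "compact_space H.mtopology" unfolding top by (simp add: compact_space_subtopology)
    show "orbit_closure \<T> \<noteq> {}" using orbit_subset_orbit_closure[OF T] by blast
    fix g
    have "tiling_shift g ` orbit_closure \<T> \<subseteq> TM.mtopology closure_of (tiling_shift g ` range (\<lambda>g. tiling_shift g \<T>))"
      unfolding orbit_closure_def by (rule continuous_map_image_closure_subset[OF tiling_shift_continuous])
    also have "\<dots> \<subseteq> orbit_closure \<T>" unfolding orbit_closure_def
      by (rule closure_of_mono) (auto simp: tiling_shift_add)
    finally have "tiling_shift g \<in> topspace (subtopology TM.mtopology (orbit_closure \<T>)) \<rightarrow> orbit_closure \<T>" by auto
    then show "continuous_map H.mtopology H.mtopology (tiling_shift g)" unfolding top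
      by (rule continuous_map_into_subtopology[OF continuous_map_from_subtopology[OF tiling_shift_continuous]])
  qed (simp_all add: tiling_shift_0 tiling_shift_add)
qed

lemma subst_fixed_coloured_set:
  assumes "subst_tiles A Q D \<T> = \<T>"
  shows "(x, i) \<in> coloured_set A \<T> \<longleftrightarrow> (\<exists>y j u. (y, j) \<in> coloured_set A \<T> \<and> u \<in> D i j \<and> x = Q y + u)"
proof -
  have "(x, i) \<in> coloured_set A \<T> \<longleftrightarrow> tile A x i \<in> subst_tiles A Q D \<T>"
    unfolding assms by (rule mem_coloured_set)
  also have "\<dots> \<longleftrightarrow> (\<exists>y j u k. (y, j) \<in> coloured_set A \<T> \<and> u \<in> D k j \<and> tile A x i = translate_tile (Q y) (tile A u k))"
    unfolding subst_tiles_def subst_prototile_def tile_def by blast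
  also have "\<dots> \<longleftrightarrow> (\<exists>y j u. (y, j) \<in> coloured_set A \<T> \<and> u \<in> D i j \<and> x = Q y + u)"
    unfolding translate_tile tile_inj by blast
  finally show ?thesis .
qed

lemma near_of_patch_eq:
  assumes r: "0 < r" and p: "\<And>z i. norm z < r \<Longrightarrow> (z, i) \<in> L \<Longrightarrow> (z, i) \<in> L'"
  shows "near (1/r) L L'"
  unfolding near_def using assms by force

end

theorem theorem4p14:
  fixes A :: "'k::finite \<Rightarrow> (real ^ 'n) set"
    and Q :: "real ^ 'n \<Rightarrow> real ^ 'n"
    and D :: "'k \<Rightarrow> 'k \<Rightarrow> (real ^ 'n) set"
    and \<T> :: "('n, 'k) tile set"
  assumes "tile_substitution A Q D"
    and "primitive_substitution D"
    and "subst_fixed_point A Q D \<T>"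
  shows "uniquely_ergodic (tiling_hull A \<T>) tiling_shift"
proof -
  have ts: "prototile_supports A" "expansive Q" "\<And>i j. finite (D i j)"
    "\<And>j. Q ` A j = (\<Union>i. \<Union>u\<in>D i j. (+) u ` A i)"
    using assms(1) unfolding tile_substitution_def by blast+
  have T: "\<T> \<in> tilings_by A" "subst_tiles A Q D \<T> = \<T>"
    using assms(3) unfolding subst_fixed_point_def by blast+
  interpret prototiles A by unfold_locales (rule ts(1))
  obtain P where P: "linear P" "\<And>v. P (Q v) = v" "\<And>v. Q (P v) = v"
    "\<And>e. 0 < e \<Longrightarrow> \<exists>K. \<forall>k\<ge>K. \<forall>v. norm ((P ^^ k) v) \<le> e * norm v"
    using expansive_inverse[OF ts(2)] by metis
  have lin: "linear Q" using ts(2) by (simp add: expansive_def)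
  obtain q where q: "q > 0" "\<And>S. S \<in> sets borel \<Longrightarrow> Q ` S \<in> sets borel"
    "\<And>S. S \<in> sets borel \<Longrightarrow> measure lborel (Q ` S) = q * measure lborel S"
    using linear_image_measure[OF lin P(1-3)] by metis
  obtain l where "\<And>i j. (((**) (subst_matrix D) ^^ l) (mat 1)) $ i $ j \<noteq> 0"
    using assms(2) unfolding primitive_substitution_def by blast
  then have l: "\<And>i j. Dpow Q D l i j \<noteq> {}" by (rule matrix_power_Dpow)
  let ?L = "coloured_set A \<T>"
  have sat: "self_affine_tiling A Q P D ?L q l"
    by (intro self_affine_tiling.intro prototiles_axioms self_affine_tiling_axioms.intro)
      (fact lin P q ts(3,4) tilings_byD(1,2)[OF T(1)] subst_fixed_coloured_set[OF T(2)] l)+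
  interpret H: compact_action "orbit_closure \<T>" "tiling_dist A" tiling_shift by (rule orbit_closure_action[OF T(1)])
  have top: "H.mtopology = subtopology TM.mtopology (orbit_closure \<T>)" by (rule orbit_closure_topology)
  have orbit: "tiling_shift h \<T> \<in> orbit_closure \<T>" for h by (rule orbit_subset_orbit_closure[OF T(1)])
  have "uniquely_ergodic H.mtopology tiling_shift"
  proof (rule H.uniquely_ergodicI)
    fix f and e :: real assume f: "H.cont f" and e: "0 < e"
    obtain B where B: "\<And>S. S \<in> orbit_closure \<T> \<Longrightarrow> \<bar>f S\<bar> \<le> B" using H.cont_bounded[OF f] by blast
    define \<phi> where "\<phi> h = f (tiling_shift h \<T>)" for h
    have "tiling_observable A Q P D ?L q l \<phi> B"
    proof (intro tiling_observable.intro sat tiling_observable_axioms.intro)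
      show "\<bar>\<phi> x\<bar> \<le> B" for x unfolding \<phi>_def by (rule B[OF orbit])
    next
      fix e :: real assume "0 < e"
      then obtain r where r: "r > 0" "\<And>S S'. S \<in> orbit_closure \<T> \<Longrightarrow> S' \<in> orbit_closure \<T> \<Longrightarrow> tiling_dist A S S' < r \<Longrightarrow> \<bar>f S - f S'\<bar> < e"
        using H.uniformly_continuous[OF f] by metis
      have "\<bar>\<phi> g - \<phi> h\<bar> < e" if "norm (g - h) < r/2" for g h
        using tiling_dist_shift_le[OF that, of \<T>] r(1) unfolding \<phi>_def by (intro r(2) orbit) linarith
      then show "\<exists>d>0. \<forall>g h. norm (g - h) < d \<longrightarrow> \<bar>\<phi> g - \<phi> h\<bar> < e"
        using r(1) half_gt_zero by blast
    next
      fix e :: real assume "0 < e"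
      then obtain r where r: "r > 0" "\<And>S S'. S \<in> orbit_closure \<T> \<Longrightarrow> S' \<in> orbit_closure \<T> \<Longrightarrow> tiling_dist A S S' < r \<Longrightarrow> \<bar>f S - f S'\<bar> < e"
        using H.uniformly_continuous[OF f] by metis
      \<comment> \<open>Agreement on a window of radius 2/r gives a distance of at most r/2, which
        leaves room for the strict bound \<open>r\<close>.\<close>
      have r2: "0 < 2/r" "0 < 1/(2/r)" "1/(2/r) < r" using r(1) by auto
      have "\<bar>\<phi> g - \<phi> h\<bar> < e"
        if p: "\<forall>z i. norm z < 2/r \<longrightarrow> ((z + g, i) \<in> ?L \<longleftrightarrow> (z + h, i) \<in> ?L)" for g h
        unfolding \<phi>_def
      proof (rule r(2)[OF orbit orbit])
        show "tiling_dist A (tiling_shift g \<T>) (tiling_shift h \<T>) < r"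
          using p by (intro tiling_dist_less_near[OF r2(2) _ _ r2(3)] near_of_patch_eq[OF r2(1)])
            (auto simp: coloured_set_shift)
      qed
      then show "\<exists>r>0. \<forall>g h. (\<forall>z i. norm z < r \<longrightarrow> ((z + g, i) \<in> ?L \<longleftrightarrow> (z + h, i) \<in> ?L)) \<longrightarrow> \<bar>\<phi> g - \<phi> h\<bar> < e"
        using r2(1) by blast
    qed
    then interpret O: tiling_observable A Q P D ?L q l \<phi> B .
    have e3: "0 < e/3" using e by simp
    obtain N w g c where N: "\<And>k. k < N \<Longrightarrow> 0 \<le> w k" "(\<Sum>k<(N::nat). w k) = 1"
      "\<And>h. \<bar>(\<Sum>k<N. w k * \<phi> (h + g k)) - c\<bar> \<le> e/3"
      using O.finite_averages_near_constant[OF e3] by blast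
    define M where "M f x = (\<Sum>k<N. w k * f (tiling_shift (g k) x))" for f :: "('n, 'k) tile set \<Rightarrow> real" and x
    have M: "H.comb 1 M" using H.comb_sum[OF N(1), of N "\<lambda>k. k" g] unfolding N(2) M_def[abs_def] by simp
    \<comment> \<open>The estimate is known on the orbit only. The average is continuous, so the set
      where it lies in this closed interval is closed in the hull and contains the whole orbit
      closure.\<close>
    let ?C = "{S \<in> orbit_closure \<T>. M f S \<in> {c - e/3..c + e/3}}"
    have "closedin H.mtopology ?C"
      using closedin_continuous_map_preimage[OF H.comb_cont[OF M f], of "{c - e/3..c + e/3}"] by simp
    then have "closedin TM.mtopology ?C"
      unfolding top by (rule closedin_trans_full) (simp only: orbit_closure_def closedin_closure_of)
    moreover have "tiling_shift h \<T> \<in> ?C" for h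
    proof -
      have "M f (tiling_shift h \<T>) = (\<Sum>k<N. w k * \<phi> (h + g k))"
        by (simp add: M_def \<phi>_def tiling_shift_add add.commute)
      moreover have "c - e/3 \<le> (\<Sum>k<N. w k * \<phi> (h + g k))" "(\<Sum>k<N. w k * \<phi> (h + g k)) \<le> c + e/3"
        using N(3)[of h] by linarith+
      ultimately show ?thesis using orbit by simp
    qed
    then have "range (\<lambda>h. tiling_shift h \<T>) \<subseteq> ?C" by blast
    ultimately have sub: "TM.mtopology closure_of range (\<lambda>h. tiling_shift h \<T>) \<subseteq> ?C"
      by (intro closure_of_minimal)
    then have "orbit_closure \<T> \<subseteq> ?C" by (simp only: orbit_closure_def)
    have close: "\<bar>M f S - c\<bar> \<le> e/3" if "S \<in> orbit_closure \<T>" for S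
    proof -
      have "c - e/3 \<le> M f S" "M f S \<le> c + e/3" using that \<open>orbit_closure \<T> \<subseteq> ?C\<close> by auto
      then show ?thesis by linarith
    qed
    have "\<bar>M f S - M f S'\<bar> < e" if "S \<in> orbit_closure \<T>" "S' \<in> orbit_closure \<T>" for S S'
      using close[OF that(1)] close[OF that(2)] e by linarith
    then show "\<exists>N. H.comb 1 N \<and> (\<forall>x\<in>orbit_closure \<T>. \<forall>y\<in>orbit_closure \<T>. \<bar>N f x - N f y\<bar> < e)" using M by blast
  qed
  then show ?thesis unfolding orbit_closure_topology tiling_hull_eq .
qed

end
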